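(* There is an isomorphism of rings $$\Phi_n:\ \mathcal{QK}(Fl_n)_{\mathrm{loc}}\ \overset{\sim}{\longrightarrow}\ K_*(Gr_{SL_n})_{\mathrm{loc}}$$ given by $$z_i\mapsto \frac{\tau_i\,\sigma_{i-1}}{\sigma_i\,\tau_{i-1}}\quad(1\le i\le n),\qquad Q_i\mapsto\frac{\tau_{i-1}\,\tau_{i+1}}{\tau_i^2}\quad(1\le i\le n-1).$$
   Context: Let $n\ge 2$. For $1\le i\le n$ put $$F_i(z,Q)=\sum_{I\subset\{1,\dots,n\},\ \#I=i}\ \prod_{j\in I}z_j\prod_{j\in I,\ j+1\notin I}(1-Q_j),\qquad Q_n:=0,$$ a polynomial in $z_1,\dots,z_n,Q_1,\dots,Q_{n-1}$. Define $$\mathcal{QK}(Fl_n):=\mathbb{C}[z_1,\dots,z_n,Q_1,\dots,Q_{n-1}]\Big/\Big\langle F_i(z,Q)-\tbinom{n}{i}\ (1\le i\le n)\Big\rangle,$$ and let $\mathcal{QK}(Fl_n)_{\mathrm{loc}}$ be its localization obtained by inverting $Q_1,\dots,Q_{n-1}$. Let $\Lambda=\mathbb{C}[h_1,h_2,\dots]$ be the ring of symmetric functions ($h_i$ the complete symmetric functions, $h_0=1$, $h_k=0$ for $k<0$), and $\Lambda_{(n)}=\mathbb{C}[h_1,\dots,h_{n-1}]$. For a partition $\lambda$ of length $\ell$, the dual stable Grothendieck polynomial is $$g_\lambda=\det\Big(\sum_{m\ge0}(-1)^m\tbinom{1-i}{m}h_{\lambda_i+j-i-m}\Big)_{1\le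 i,j\le\ell},\qquad \tbinom{1-i}{m}=\frac{(1-i)(-i)\cdots(1-i-m+1)}{m!},\qquad g_\emptyset=1.$$ For $1\le i\le n-1$ let $R_i$ be the rectangle with $i$ rows and $n-i$ columns, and set $$\tau_i=g_{R_i},\qquad \sigma_i=\sum_{\mu\subset R_i}g_\mu$$ (the sum is over all partitions $\mu$, including the empty one, whose diagram is contained in $R_i$), and $\tau_0=\sigma_0=\tau_n=\sigma_n=1$. Define $$K_*(Gr_{SL_n})_{\mathrm{loc}}:=\Lambda_{(n)}[\sigma_i^{-1},\tau_i^{-1}\ (1\le i\le n-1)].$$ (The notation refers to the Lam–Schilling–Shimozono isomorphism of the $K$-homology ring $K_*(Gr_{SL_n})$ of the affine Grassmannian with $\Lambda_{(n)}$; only the ring just defined is needed.) *)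

theory Defs
  imports
    "HOL-Algebra.QuotRing"
    "HOL-Library.Poly_Mapping"
    "Jordan_Normal_Form.Determinant"
begin

section \<open>Localization of a commutative ring\<close>

inductive_set submonoid_gen :: "('a, 'b) ring_scheme \<Rightarrow> 'a set \<Rightarrow> 'a set"
  for R (structure) and X where
    one: "\<one> \<in> submonoid_gen R X"
  | step: "x \<in> X \<Longrightarrow> s \<in> submonoid_gen R X \<Longrightarrow> x \<otimes> s \<in> submonoid_gen R X"

definition loc_rel :: "('a, 'b) ring_scheme \<Rightarrow> 'a set \<Rightarrow> (('a \<times> 'a) \<times> ('a \<times> 'a)) set" where
  "loc_rel R S = {((a, s), (b, t)). a \<in> carrier R \<and> b \<in> carrier R \<and> s \<in> S \<and> t \<in> S \<and>
      (\<exists>u\<in>S. u \<otimes>\<^bsub>R\<^esub> (a \<otimes>\<^bsub>R\<^esub> t) = u \<otimes>\<^bsub>R\<^esub> (b \<otimes>\<^bsub>R\<^esub> s))}"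

text \<open>The fraction $a/s$, as an equivalence class of pairs.\<close>

definition loc_frac :: "('a, 'b) ring_scheme \<Rightarrow> 'a set \<Rightarrow> 'a \<Rightarrow> 'a \<Rightarrow> ('a \<times> 'a) set" where
  "loc_frac R S a s = loc_rel R S `` {(a, s)}"

text \<open>The ring $S^{-1}R$ for a multiplicative subset $S$.  Sums and products of classes are
  formed as unions over all representatives; these unions are of equal sets.\<close>

definition localization :: "('a, 'b) ring_scheme \<Rightarrow> 'a set \<Rightarrow> ('a \<times> 'a) set ring" where
  "localization R S =
    \<lparr> carrier = (carrier R \<times> S) // loc_rel R S,
      monoid.mult = (\<lambda>X Y. \<Union>(a, s)\<in>X. \<Union>(b, t)\<in>Y. loc_frac R S (a \<otimes>\<^bsub>R\<^esub> b) (s \<otimes>\<^bsub>R\<^esub> t)),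
      one = loc_frac R S \<one>\<^bsub>R\<^esub> \<one>\<^bsub>R\<^esub>,
      zero = loc_frac R S \<zero>\<^bsub>R\<^esub> \<one>\<^bsub>R\<^esub>,
      add = (\<lambda>X Y. \<Union>(a, s)\<in>X. \<Union>(b, t)\<in>Y.
               loc_frac R S (a \<otimes>\<^bsub>R\<^esub> t \<oplus>\<^bsub>R\<^esub> b \<otimes>\<^bsub>R\<^esub> s) (s \<otimes>\<^bsub>R\<^esub> t)) \<rparr>"

locale mult_subset = cring R for R (structure) +
  fixes S
  assumes S_sub: "S \<subseteq> carrier R"
    and S_one: "\<one> \<in> S"
    and S_mult: "s \<in> S \<Longrightarrow> t \<in> S \<Longrightarrow> s \<otimes> t \<in> S"
begin

lemma S_carr [simp]: "s \<in> S \<Longrightarrow> s \<in> carrier R"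
  using S_sub by auto

lemma loc_rel_iff:
  "((a, s), (b, t)) \<in> loc_rel R S \<longleftrightarrow> a \<in> carrier R \<and> b \<in> carrier R \<and> s \<in> S \<and> t \<in> S \<and>
      (\<exists>u\<in>S. u \<otimes> (a \<otimes> t) = u \<otimes> (b \<otimes> s))"
  by (auto simp: loc_rel_def)

lemma equiv_loc_rel: "equiv (carrier R \<times> S) (loc_rel R S)"
proof (rule equivI)
  show "loc_rel R S \<subseteq> (carrier R \<times> S) \<times> (carrier R \<times> S)"
    by (auto simp: loc_rel_def)
  show "refl_on (carrier R \<times> S) (loc_rel R S)"
    using S_one by (auto simp: refl_on_def loc_rel_def)
  show "sym (loc_rel R S)"
    by (rule symI) (auto simp: loc_rel_def intro: sym)
  show "trans (loc_rel R S)"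
  proof (rule transI, clarify)
    fix a s b t c r
    assume 1: "((a, s), (b, t)) \<in> loc_rel R S" and 2: "((b, t), (c, r)) \<in> loc_rel R S"
    from 1 obtain u where u: "u \<in> S" "u \<otimes> (a \<otimes> t) = u \<otimes> (b \<otimes> s)" by (auto simp: loc_rel_iff)
    from 2 obtain v where v: "v \<in> S" "v \<otimes> (b \<otimes> r) = v \<otimes> (c \<otimes> t)" by (auto simp: loc_rel_iff)
    have m: "a \<in> carrier R" "b \<in> carrier R" "c \<in> carrier R" "s \<in> S" "t \<in> S" "r \<in> S"
      using 1 2 by (auto simp: loc_rel_iff)
    have "(u \<otimes> (v \<otimes> t)) \<otimes> (a \<otimes> r) = (v \<otimes> r) \<otimes> (u \<otimes> (a \<otimes> t))"
      using m u(1) v(1) by (simp add: m_ac)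
    also have "\<dots> = (u \<otimes> s) \<otimes> (v \<otimes> (b \<otimes> r))"
      using m u v(1) by (simp add: m_ac)
    also have "\<dots> = (u \<otimes> (v \<otimes> t)) \<otimes> (c \<otimes> s)"
      using m u(1) v by (simp add: m_ac)
    finally show "((a, s), (c, r)) \<in> loc_rel R S"
      using m u(1) v(1) S_mult by (auto simp: loc_rel_iff)
  qed
qed

lemma loc_frac_eq_iff:
  assumes "a \<in> carrier R" "b \<in> carrier R" "s \<in> S" "t \<in> S"
  shows "loc_frac R S a s = loc_frac R S b t \<longleftrightarrow> (\<exists>u\<in>S. u \<otimes> (a \<otimes> t) = u \<otimes> (b \<otimes> s))"
  using eq_equiv_class_iff[OF equiv_loc_rel, of "(a, s)" "(b, t)"] assms
  by (auto simp: loc_frac_def loc_rel_iff)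

lemma loc_frac_eqI:
  assumes "a \<in> carrier R" "b \<in> carrier R" "s \<in> S" "t \<in> S" "a \<otimes> t = b \<otimes> s"
  shows "loc_frac R S a s = loc_frac R S b t"
  using assms S_one by (auto simp: loc_frac_eq_iff)

lemma loc_frac_closed [simp]:
  "a \<in> carrier R \<Longrightarrow> s \<in> S \<Longrightarrow> loc_frac R S a s \<in> carrier (localization R S)"
  by (auto simp: localization_def loc_frac_def intro: quotientI)

lemma loc_frac_cases:
  assumes "X \<in> carrier (localization R S)"
  obtains a s where "a \<in> carrier R" "s \<in> S" "X = loc_frac R S a s"
  using assms by (auto simp: localization_def loc_frac_def elim!: quotientE)

lemma loc_frac_mult:
  assumes "a \<in> carrier R" "b \<in> carrier R" "s \<in> S" "t \<in> S"
  shows "loc_frac R S a s \<otimes>\<^bsub>localization R S\<^esub> loc_frac R S b t = loc_frac R S (a \<otimes> b) (s \<otimes> t)"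
proof -
  let ?f = "\<lambda>(a, s) (b, t). loc_frac R S (a \<otimes> b) (s \<otimes> t)"
  have "(\<lambda>(a, s) (b, t). loc_frac R S (a \<otimes> b) (s \<otimes> t)) respects2 loc_rel R S"
  proof (rule congruent2_commuteI[OF equiv_loc_rel])
    fix y z assume "y \<in> carrier R \<times> S" "z \<in> carrier R \<times> S"
    then show "?f y z = ?f z y" by (auto simp: m_comm)
  next
    fix y z w assume *: "w \<in> carrier R \<times> S" "(y, z) \<in> loc_rel R S"
    obtain a s b t c r where e: "y = (a, s)" "z = (b, t)" "w = (c, r)"
      by (cases y, cases z, cases w)
    from * obtain u where u: "u \<in> S" "u \<otimes> (a \<otimes> t) = u \<otimes> (b \<otimes> s)"
      by (auto simp: loc_rel_iff e)
    have m: "a \<in> carrier R" "b \<in> carrier R" "c \<in> carrier R" "s \<in> S" "t \<in> S" "r \<in> S"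
      using * by (auto simp: loc_rel_iff e)
    have "u \<otimes> ((c \<otimes> a) \<otimes> (r \<otimes> t)) = (c \<otimes> r) \<otimes> (u \<otimes> (a \<otimes> t))"
      using m u(1) by (simp add: m_ac)
    also have "\<dots> = u \<otimes> ((c \<otimes> b) \<otimes> (r \<otimes> s))"
      using m u by (simp add: m_ac)
    finally show "?f w y = ?f w z"
      using m u(1) S_mult by (auto simp: e loc_frac_eq_iff)
  qed
  from UN_equiv_class2[OF equiv_loc_rel equiv_loc_rel this, of "(a, s)" "(b, t)"] assms
  show ?thesis by (simp add: localization_def loc_frac_def split_def)
qed

lemma loc_frac_add:
  assumes "a \<in> carrier R" "b \<in> carrier R" "s \<in> S" "t \<in> S"
  shows "loc_frac R S a s \<oplus>\<^bsub>localization R S\<^esub> loc_frac R S b t = loc_frac R S (a \<otimes> t \<oplus> b \<otimes> s) (s \<otimes> t)"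
proof -
  let ?f = "\<lambda>(a, s) (b, t). loc_frac R S (a \<otimes> t \<oplus> b \<otimes> s) (s \<otimes> t)"
  have "(\<lambda>(a, s) (b, t). loc_frac R S (a \<otimes> t \<oplus> b \<otimes> s) (s \<otimes> t)) respects2 loc_rel R S"
  proof (rule congruent2_commuteI[OF equiv_loc_rel])
    fix y z assume "y \<in> carrier R \<times> S" "z \<in> carrier R \<times> S"
    then show "?f y z = ?f z y" by (auto simp: m_comm a_comm)
  next
    fix y z w assume *: "w \<in> carrier R \<times> S" "(y, z) \<in> loc_rel R S"
    obtain a s b t c r where e: "y = (a, s)" "z = (b, t)" "w = (c, r)"
      by (cases y, cases z, cases w)
    from * obtain u where u: "u \<in> S" "u \<otimes> (a \<otimes> t) = u \<otimes> (b \<otimes> s)"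
      by (auto simp: loc_rel_iff e)
    have m: "a \<in> carrier R" "b \<in> carrier R" "c \<in> carrier R" "s \<in> S" "t \<in> S" "r \<in> S"
      using * by (auto simp: loc_rel_iff e)
    have "u \<otimes> ((c \<otimes> s \<oplus> a \<otimes> r) \<otimes> (r \<otimes> t)) =
        u \<otimes> (c \<otimes> s \<otimes> r \<otimes> t) \<oplus> (r \<otimes> r) \<otimes> (u \<otimes> (a \<otimes> t))"
      using m u(1) by (simp add: m_ac l_distr r_distr)
    also have "\<dots> = u \<otimes> ((c \<otimes> t \<oplus> b \<otimes> r) \<otimes> (r \<otimes> s))"
      using m u by (simp add: m_ac l_distr r_distr)
    finally show "?f w y = ?f w z"
      using m u(1) S_mult by (auto simp: e loc_frac_eq_iff)
  qed
  from UN_equiv_class2[OF equiv_loc_rel equiv_loc_rel this, of "(a, s)" "(b, t)"] assms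
  show ?thesis by (simp add: localization_def loc_frac_def split_def)
qed

lemma localization_one: "\<one>\<^bsub>localization R S\<^esub> = loc_frac R S \<one> \<one>"
  and localization_zero: "\<zero>\<^bsub>localization R S\<^esub> = loc_frac R S \<zero> \<one>"
  by (simp_all add: localization_def)

theorem localization_cring: "cring (localization R S)"
proof (intro cringI abelian_groupI comm_monoidI)
  fix X Y Z
  assume "X \<in> carrier (localization R S)" "Y \<in> carrier (localization R S)"
    "Z \<in> carrier (localization R S)"
  then obtain a s b t c r
    where m: "a \<in> carrier R" "b \<in> carrier R" "c \<in> carrier R" "s \<in> S" "t \<in> S" "r \<in> S"
      and e: "X = loc_frac R S a s" "Y = loc_frac R S b t" "Z = loc_frac R S c r"
    by (metis loc_frac_cases)
  show "(X \<oplus>\<^bsub>localization R S\<^esub> Y) \<oplus>\<^bsub>localization R S\<^esub> Z =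
      X \<oplus>\<^bsub>localization R S\<^esub> (Y \<oplus>\<^bsub>localization R S\<^esub> Z)"
    using m S_mult by (auto simp: e loc_frac_add m_ac a_ac l_distr r_distr intro!: loc_frac_eqI)
  show "(X \<otimes>\<^bsub>localization R S\<^esub> Y) \<otimes>\<^bsub>localization R S\<^esub> Z =
      X \<otimes>\<^bsub>localization R S\<^esub> (Y \<otimes>\<^bsub>localization R S\<^esub> Z)"
    using m S_mult by (auto simp: e loc_frac_mult m_ac intro!: loc_frac_eqI)
  have "loc_frac R S ((a \<otimes> t \<oplus> b \<otimes> s) \<otimes> c) (s \<otimes> t \<otimes> r) =
      loc_frac R S (a \<otimes> c \<otimes> (t \<otimes> r) \<oplus> b \<otimes> c \<otimes> (s \<otimes> r)) (s \<otimes> r \<otimes> (t \<otimes> r))"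
    using m S_mult by (intro loc_frac_eqI) (auto simp: m_ac l_distr r_distr)
  then show "(X \<oplus>\<^bsub>localization R S\<^esub> Y) \<otimes>\<^bsub>localization R S\<^esub> Z =
      X \<otimes>\<^bsub>localization R S\<^esub> Z \<oplus>\<^bsub>localization R S\<^esub> Y \<otimes>\<^bsub>localization R S\<^esub> Z"
    using m S_mult by (simp add: e loc_frac_mult loc_frac_add)
next
  fix X Y
  assume "X \<in> carrier (localization R S)" "Y \<in> carrier (localization R S)"
  then obtain a s b t
    where m: "a \<in> carrier R" "b \<in> carrier R" "s \<in> S" "t \<in> S"
      and e: "X = loc_frac R S a s" "Y = loc_frac R S b t"
    by (metis loc_frac_cases)
  show "X \<oplus>\<^bsub>localization R S\<^esub> Y \<in> carrier (localization R S)"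
    "X \<otimes>\<^bsub>localization R S\<^esub> Y \<in> carrier (localization R S)"
    using m S_mult by (auto simp: e loc_frac_add loc_frac_mult)
  show "X \<oplus>\<^bsub>localization R S\<^esub> Y = Y \<oplus>\<^bsub>localization R S\<^esub> X"
    "X \<otimes>\<^bsub>localization R S\<^esub> Y = Y \<otimes>\<^bsub>localization R S\<^esub> X"
    using m by (simp_all add: e loc_frac_add loc_frac_mult m_comm a_comm)
next
  fix X
  assume "X \<in> carrier (localization R S)"
  then obtain a s where m: "a \<in> carrier R" "s \<in> S" and e: "X = loc_frac R S a s"
    by (metis loc_frac_cases)
  show "\<zero>\<^bsub>localization R S\<^esub> \<oplus>\<^bsub>localization R S\<^esub> X = X"
    "\<one>\<^bsub>localization R S\<^esub> \<otimes>\<^bsub>localization R S\<^esub> X = X"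
    using m S_one by (simp_all add: e loc_frac_add loc_frac_mult localization_zero localization_one)
  have "loc_frac R S (\<ominus> a) s \<oplus>\<^bsub>localization R S\<^esub> X = \<zero>\<^bsub>localization R S\<^esub>"
    using m S_one S_mult loc_frac_eqI[of \<zero> \<zero> "s \<otimes> s" \<one>]
    by (simp add: e loc_frac_add localization_zero l_minus l_neg)
  then show "\<exists>Y\<in>carrier (localization R S). Y \<oplus>\<^bsub>localization R S\<^esub> X = \<zero>\<^bsub>localization R S\<^esub>"
    using m by (intro bexI[of _ "loc_frac R S (\<ominus> a) s"]) auto
qed (use S_one in \<open>auto simp: localization_zero localization_one\<close>)

end

lemma (in cring) mult_subset_submonoid_gen:
  assumes "X \<subseteq> carrier R"
  shows "mult_subset R (submonoid_gen R X)"
proof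
  show sub: "submonoid_gen R X \<subseteq> carrier R"
  proof
    fix x assume "x \<in> submonoid_gen R X"
    then show "x \<in> carrier R" by induction (use assms in auto)
  qed
  show "\<one> \<in> submonoid_gen R X" by (rule submonoid_gen.one)
  show "s \<otimes> t \<in> submonoid_gen R X" if "s \<in> submonoid_gen R X" "t \<in> submonoid_gen R X" for s t
    using that
  proof induction
    case one
    then show ?case using sub by auto
  next
    case (step x s)
    then have "x \<in> carrier R" "s \<in> carrier R" "t \<in> carrier R" using assms sub by auto
    then show ?case using step submonoid_gen.step[of x X "s \<otimes> t" R] by (simp add: m_assoc)
  qed
qed


section \<open>Polynomial rings over the complex numbers\<close>

text \<open>Polynomials in variables indexed by \<open>'v\<close>: finitely supported maps from monomials
  (finitely supported exponent vectors) to coefficients.\<close>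

type_synonym 'v cpoly = "('v \<Rightarrow>\<^sub>0 nat) \<Rightarrow>\<^sub>0 complex"

definition Const :: "complex \<Rightarrow> 'v cpoly" where
  "Const c = Poly_Mapping.single 0 c"

definition Var :: "'v \<Rightarrow> 'v cpoly" where
  "Var x = Poly_Mapping.single (Poly_Mapping.single x 1) 1"

definition poly_ring :: "'v set \<Rightarrow> 'v cpoly ring" where
  "poly_ring V =
    \<lparr> carrier = {p. \<forall>m\<in>Poly_Mapping.keys p. Poly_Mapping.keys m \<subseteq> V},
      monoid.mult = (*), one = 1, zero = 0, add = (+) \<rparr>"

lemma poly_ring_simps [simp]:
  "x \<otimes>\<^bsub>poly_ring V\<^esub> y = x * y" "\<one>\<^bsub>poly_ring V\<^esub> = 1"
  "x \<oplus>\<^bsub>poly_ring V\<^esub> y = x + y" "\<zero>\<^bsub>poly_ring V\<^esub> = 0"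
  by (simp_all add: poly_ring_def)

lemma poly_ring_closed:
  shows poly_ring_add: "p \<in> carrier (poly_ring V) \<Longrightarrow> q \<in> carrier (poly_ring V) \<Longrightarrow>
      p + q \<in> carrier (poly_ring V)"
    and poly_ring_mult: "p \<in> carrier (poly_ring V) \<Longrightarrow> q \<in> carrier (poly_ring V) \<Longrightarrow>
      p * q \<in> carrier (poly_ring V)"
    and poly_ring_Const: "Const c \<in> carrier (poly_ring V)"
    and poly_ring_Var: "x \<in> V \<Longrightarrow> Var x \<in> carrier (poly_ring V)"
    and poly_ring_0: "0 \<in> carrier (poly_ring V)"
    and poly_ring_1: "1 \<in> carrier (poly_ring V)"
proof -
  show "p + q \<in> carrier (poly_ring V)"
    if "p \<in> carrier (poly_ring V)" "q \<in> carrier (poly_ring V)"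
    using that keys_add[of p q] by (auto simp: poly_ring_def)
  show "p * q \<in> carrier (poly_ring V)"
    if *: "p \<in> carrier (poly_ring V)" "q \<in> carrier (poly_ring V)"
  proof -
    have "Poly_Mapping.keys m \<subseteq> V" if "m \<in> Poly_Mapping.keys (p * q)" for m
    proof -
      obtain a b where "m = a + b" "a \<in> Poly_Mapping.keys p" "b \<in> Poly_Mapping.keys q"
        using \<open>m \<in> Poly_Mapping.keys (p * q)\<close> keys_mult[of p q] by blast
      then show ?thesis using * keys_add[of a b] by (fastforce simp: poly_ring_def)
    qed
    then show ?thesis by (simp add: poly_ring_def)
  qed
qed (auto simp: poly_ring_def Const_def Var_def)

lemma poly_ring_uminus: "p \<in> carrier (poly_ring V) \<Longrightarrow> - p \<in> carrier (poly_ring V)"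
  by (auto simp: poly_ring_def Poly_Mapping.in_keys_iff)

lemma poly_ring_minus: "p \<in> carrier (poly_ring V) \<Longrightarrow> q \<in> carrier (poly_ring V) \<Longrightarrow>
    p - q \<in> carrier (poly_ring V)"
  using poly_ring_add[of p V "- q"] poly_ring_uminus[of q V] by simp

lemma poly_ring_sum: "(\<And>x. x \<in> A \<Longrightarrow> f x \<in> carrier (poly_ring V)) \<Longrightarrow>
    sum f A \<in> carrier (poly_ring V)"
  by (induction A rule: infinite_finite_induct) (auto simp: poly_ring_0 poly_ring_add)

lemma poly_ring_prod: "(\<And>x. x \<in> A \<Longrightarrow> f x \<in> carrier (poly_ring V)) \<Longrightarrow>
    prod f A \<in> carrier (poly_ring V)"
  by (induction A rule: infinite_finite_induct) (auto simp: poly_ring_1 poly_ring_mult)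

lemma poly_ring_of_nat: "of_nat k \<in> carrier (poly_ring V)"
  by (induction k) (auto simp: poly_ring_0 poly_ring_1 poly_ring_add)

lemma cring_poly_ring: "cring (poly_ring V)"
proof (intro cringI abelian_groupI comm_monoidI)
  fix p assume "p \<in> carrier (poly_ring V)"
  then show "\<exists>q\<in>carrier (poly_ring V). q \<oplus>\<^bsub>poly_ring V\<^esub> p = \<zero>\<^bsub>poly_ring V\<^esub>"
    by (intro bexI[of _ "- p"]) (auto simp: poly_ring_uminus)
qed (auto simp: poly_ring_closed algebra_simps)


section \<open>The quantum side\<close>

datatype qk_var = ZV nat | QV nat

definition QK_poly :: "nat \<Rightarrow> qk_var cpoly ring" where
  "QK_poly n = poly_ring (ZV ` {1..n} \<union> QV ` {1..n - 1})"

definition QK_z :: "nat \<Rightarrow> qk_var cpoly" where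
  "QK_z i = Var (ZV i)"

definition QK_Q :: "nat \<Rightarrow> nat \<Rightarrow> qk_var cpoly" where
  "QK_Q n i = (if i = n then 0 else Var (QV i))"

definition QK_F :: "nat \<Rightarrow> nat \<Rightarrow> qk_var cpoly" where
  "QK_F n i = (\<Sum>I | I \<subseteq> {1..n} \<and> card I = i.
      (\<Prod>j\<in>I. QK_z j) * (\<Prod>j | j \<in> I \<and> j + 1 \<notin> I. 1 - QK_Q n j))"

definition QK_ideal :: "nat \<Rightarrow> qk_var cpoly set" where
  "QK_ideal n = Idl\<^bsub>QK_poly n\<^esub> {QK_F n i - of_nat (n choose i) | i. 1 \<le> i \<and> i \<le> n}"

definition QK :: "nat \<Rightarrow> qk_var cpoly set ring" where
  "QK n = QK_poly n Quot QK_ideal n"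

definition QK_class :: "nat \<Rightarrow> qk_var cpoly \<Rightarrow> qk_var cpoly set" where
  "QK_class n p = QK_ideal n +>\<^bsub>QK_poly n\<^esub> p"

definition QK_denoms :: "nat \<Rightarrow> qk_var cpoly set set" where
  "QK_denoms n = submonoid_gen (QK n) {QK_class n (QK_Q n i) | i. 1 \<le> i \<and> i \<le> n - 1}"

definition QK_loc :: "nat \<Rightarrow> (qk_var cpoly set \<times> qk_var cpoly set) set ring" where
  "QK_loc n = localization (QK n) (QK_denoms n)"

text \<open>The image of a polynomial in the localized quotient ring.\<close>

definition QK_elem :: "nat \<Rightarrow> qk_var cpoly \<Rightarrow> (qk_var cpoly set \<times> qk_var cpoly set) set" where
  "QK_elem n p = loc_frac (QK n) (QK_denoms n) (QK_class n p) \<one>\<^bsub>QK n\<^esub>"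

lemma QK_generators_closed:
  "1 \<le> i \<Longrightarrow> i \<le> n \<Longrightarrow> QK_z i \<in> carrier (QK_poly n)"
  "1 \<le> i \<Longrightarrow> i \<le> n \<Longrightarrow> QK_Q n i \<in> carrier (QK_poly n)"
  by (auto simp: QK_poly_def QK_z_def QK_Q_def intro!: poly_ring_Var poly_ring_0)

lemma QK_F_closed: "QK_F n i \<in> carrier (QK_poly n)"
proof -
  have "(\<Prod>j\<in>I. QK_z j) * (\<Prod>j | j \<in> I \<and> j + 1 \<notin> I. 1 - QK_Q n j) \<in> carrier (QK_poly n)"
    if "I \<subseteq> {1..n}" for I
    using that QK_generators_closed[of _ n] unfolding QK_poly_def
    by (intro poly_ring_mult poly_ring_prod poly_ring_minus poly_ring_1) auto
  then show ?thesis
    unfolding QK_F_def by (auto simp: QK_poly_def intro!: poly_ring_sum)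
qed

lemma ideal_QK_ideal: "ideal (QK_ideal n) (QK_poly n)"
proof -
  interpret cring "QK_poly n" unfolding QK_poly_def by (rule cring_poly_ring)
  show ?thesis unfolding QK_ideal_def
  proof (rule genideal_ideal)
    show "{QK_F n i - of_nat (n choose i) | i. 1 \<le> i \<and> i \<le> n} \<subseteq> carrier (QK_poly n)"
      using QK_F_closed[of n] by (auto simp: QK_poly_def intro!: poly_ring_minus poly_ring_of_nat)
  qed
qed

lemma cring_QK: "cring (QK n)"
  unfolding QK_def
  by (rule ideal.quotient_is_cring[OF ideal_QK_ideal]) (simp add: QK_poly_def cring_poly_ring)

lemma QK_class_closed: "p \<in> carrier (QK_poly n) \<Longrightarrow> QK_class n p \<in> carrier (QK n)"
  by (auto simp: QK_class_def QK_def FactRing_def A_RCOSETS_def')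

lemma mult_subset_QK: "mult_subset (QK n) (QK_denoms n)"
  unfolding QK_denoms_def
  by (rule cring.mult_subset_submonoid_gen[OF cring_QK])
     (auto intro!: QK_class_closed QK_generators_closed)

lemma cring_QK_loc: "cring (QK_loc n)"
  unfolding QK_loc_def by (rule mult_subset.localization_cring[OF mult_subset_QK])


section \<open>Dual stable Grothendieck polynomials\<close>

text \<open>Symmetric functions are polynomials in the variables \<open>Var 1, Var 2, \<dots>\<close>, with \<open>Var k\<close>
  standing for the complete symmetric function $h_k$.\<close>

definition hsym :: "int \<Rightarrow> nat cpoly" where
  "hsym k = (if k < 0 then 0 else if k = 0 then 1 else Var (nat k))"

definition Lambda_n :: "nat \<Rightarrow> nat cpoly ring" where
  "Lambda_n n = poly_ring {1..n - 1}"

definition is_partition :: "nat list \<Rightarrow> bool" where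
  "is_partition \<mu> \<longleftrightarrow> sorted_wrt (\<ge>) \<mu> \<and> (\<forall>x\<in>set \<mu>. 0 < x)"

definition diagram_subset :: "nat list \<Rightarrow> nat list \<Rightarrow> bool" where
  "diagram_subset \<mu> \<nu> \<longleftrightarrow> length \<mu> \<le> length \<nu> \<and> (\<forall>k<length \<mu>. \<mu> ! k \<le> \<nu> ! k)"

text \<open>The entry in row \<open>i\<close> and column \<open>j\<close> of the determinant, both counted from 1.  The sum
  over all $m \ge 0$ is cut off where the index of \<open>h\<close> becomes negative.\<close>

definition g_entry :: "nat list \<Rightarrow> nat \<Rightarrow> nat \<Rightarrow> nat cpoly" where
  "g_entry \<mu> i j = (let k = int (\<mu> ! (i - 1)) + int j - int i in
     \<Sum>m\<le>nat k. Const ((-1) ^ m * ((1 - of_nat i) gchoose m)) * hsym (k - int m))"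

definition dual_Groth :: "nat list \<Rightarrow> nat cpoly" where
  "dual_Groth \<mu> = det (mat (length \<mu>) (length \<mu>) (\<lambda>(a, b). g_entry \<mu> (a + 1) (b + 1)))"

definition rect :: "nat \<Rightarrow> nat \<Rightarrow> nat list" where
  "rect n i = replicate i (n - i)"

definition tau :: "nat \<Rightarrow> nat \<Rightarrow> nat cpoly" where
  "tau n i = (if i = 0 \<or> i = n then 1 else dual_Groth (rect n i))"

definition sigma :: "nat \<Rightarrow> nat \<Rightarrow> nat cpoly" where
  "sigma n i = (if i = 0 \<or> i = n then 1
     else \<Sum>\<mu> | is_partition \<mu> \<and> diagram_subset \<mu> (rect n i). dual_Groth \<mu>)"

definition K_denoms :: "nat \<Rightarrow> nat cpoly set" where
  "K_denoms n = submonoid_gen (Lambda_n n)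
     ({sigma n i | i. 1 \<le> i \<and> i \<le> n - 1} \<union> {tau n i | i. 1 \<le> i \<and> i \<le> n - 1})"

definition K_loc :: "nat \<Rightarrow> (nat cpoly \<times> nat cpoly) set ring" where
  "K_loc n = localization (Lambda_n n) (K_denoms n)"

definition K_frac :: "nat \<Rightarrow> nat cpoly \<Rightarrow> nat cpoly \<Rightarrow> (nat cpoly \<times> nat cpoly) set" where
  "K_frac n p q = loc_frac (Lambda_n n) (K_denoms n) p q"

lemma dual_Groth_Nil: "dual_Groth [] = 1"
  by (simp add: dual_Groth_def)

lemma finite_sub_rect: "finite {\<mu>. is_partition \<mu> \<and> diagram_subset \<mu> (rect n i)}"
proof (rule finite_subset)
  show "{\<mu>. is_partition \<mu> \<and> diagram_subset \<mu> (rect n i)} \<subseteq>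
      {\<mu>. set \<mu> \<subseteq> {..n} \<and> length \<mu> \<le> i}"
    by (fastforce simp: diagram_subset_def rect_def in_set_conv_nth)
  show "finite {\<mu>. set \<mu> \<subseteq> {..n} \<and> length \<mu> \<le> i}"
    by (rule finite_lists_length_le) simp
qed

lemma dual_Groth_closed:
  assumes "1 \<le> i" "i \<le> n - 1" "diagram_subset \<mu> (rect n i)"
  shows "dual_Groth \<mu> \<in> carrier (Lambda_n n)"
proof -
  have h: "hsym k \<in> carrier (Lambda_n n)" if "k \<le> int n - 1" for k
    using that by (auto simp: hsym_def Lambda_n_def poly_ring_0 poly_ring_1 intro!: poly_ring_Var)
  have len: "length \<mu> \<le> i" and part: "\<And>a. a < length \<mu> \<Longrightarrow> \<mu> ! a \<le> n - i"
    using assms(3) by (auto simp: diagram_subset_def rect_def)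
  have entry: "g_entry \<mu> (a + 1) (b + 1) \<in> carrier (Lambda_n n)"
    if "a < length \<mu>" "b < length \<mu>" for a b
    using part[OF that(1)] that len assms(1,2) unfolding g_entry_def Let_def
    by (intro poly_ring_sum[where V = "{1..n - 1}", folded Lambda_n_def]
        poly_ring_mult[where V = "{1..n - 1}", folded Lambda_n_def]
        poly_ring_Const[where V = "{1..n - 1}", folded Lambda_n_def] h) auto
  have "signof p \<in> carrier (Lambda_n n)" for p
    by (auto simp: Lambda_n_def sign_def poly_ring_1 intro!: poly_ring_uminus)
  with entry show ?thesis
    unfolding dual_Groth_def det_def
    by (auto simp: Lambda_n_def intro!: poly_ring_sum poly_ring_mult poly_ring_prod)
qed

lemma tau_sigma_closed:
  assumes "1 \<le> i" "i \<le> n - 1"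
  shows "tau n i \<in> carrier (Lambda_n n)" "sigma n i \<in> carrier (Lambda_n n)"
proof -
  have "diagram_subset (rect n i) (rect n i)" by (simp add: diagram_subset_def)
  then show "tau n i \<in> carrier (Lambda_n n)"
    using dual_Groth_closed[OF assms] by (auto simp: tau_def Lambda_n_def poly_ring_1)
  show "sigma n i \<in> carrier (Lambda_n n)"
    using dual_Groth_closed[OF assms]
    by (auto simp: sigma_def Lambda_n_def poly_ring_1 intro!: poly_ring_sum)
qed

lemma mult_subset_K: "mult_subset (Lambda_n n) (K_denoms n)"
  unfolding K_denoms_def
proof (rule cring.mult_subset_submonoid_gen)
  show "cring (Lambda_n n)" unfolding Lambda_n_def by (rule cring_poly_ring)
qed (use tau_sigma_closed[of _ n] in auto)

lemma cring_K_loc: "cring (K_loc n)"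
  unfolding K_loc_def by (rule mult_subset.localization_cring[OF mult_subset_K])

end

theory Submission
  imports Defs "HOL-Computational_Algebra.Formal_Power_Series" "HOL-Computational_Algebra.Fraction_Field"
    "Jordan_Normal_Form.Char_Poly"
begin

text \<open>
Let $\zeta=1-t$ and $u=1/\zeta$.  The polynomials $F_i$ are the coefficients of the characteristic polynomial of
the Lax matrix of the relativistic Toda chain (\<open>toda_poly_eq_sum_toda_F\<close>).  So a point of
$\mathcal{QK}(Fl_n)_{\mathrm{loc}}$ is a choice of $z_i$ and invertible $Q_i$ for which this matrix is unipotent.
The leading principal minors of $\zeta B-A$, where $AB^{-1}$ is the Lax matrix, satisfy a three-term recurrence;
divided by a power of $\zeta$ they are polynomials $S_0,\dots,S_n$ in $u$, with $S_k$ of degree $k$, and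
unipotency means $S_n(u)=(1-u)^n$, which vanishes modulo $t^n$.

The correspondence is a Pade-type approximation.  A point of $K_*(Gr_{SL_n})_{\mathrm{loc}}$ is a series
$H=1+h_1t+\dots+h_{n-1}t^{n-1}$ modulo $t^n$.  Call row $k$ short if $HS_k(u)$ has degree less than $n-k$ modulo $t^n$.  A solution of
the Toda relations and a series $H$ correspond to each other if all rows are short; row $n-1$ then says that $H$ is,
up to a scalar, the inverse of $S_{n-1}(u)$.  Conversely the $S_k$ are the denominators of the approximations to $H$.

The functions $\tau_i$ and $\sigma_i$ are minors of the matrices with rows $H(u-1)^a$ and $Hu(u-1)^a$.  For $\tau_i$
this is the definition, and for $\sigma_i$ it is \<open>sum_box_gdet\<close>: the sum over the partitions in a
rectangle telescopes, because the sum of a row of the determinant over all smaller parts is the next row.  Row operations replace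
the powers of $u-1$ by the $S_k$.  If the rows are short, the determinants become antitriangular, with values in terms of
the top coefficient $A_k$ and the sum $B_k$ of the coefficients of $HS_k(u)$ (\<open>tau_det_eqv\<close>,
\<open>sigma_det_eqv\<close>).  In the same terms, if rows $k$ and $k+1$ are short, then row $k+2$ is short if and only if two equations hold,
$A_{k+1}=Q_{k+1}z_{k+1}A_k$ and $z_{k+2}B_{k+1}=Q_{k+1}z_{k+1}B_k$.  They are the formulas for $Q_{k+1}$ and $z_{k+2}$
in the theorem.

This gives both directions.  Over the field of fractions of $\Lambda$, the values of $z_i$ and $Q_i$ prescribed by the
theorem make all rows short and hence satisfy the relations (\<open>toda_F_of_generating_series\<close>); this defines
$\Phi_n$.  Modulo the ideal of relations, the inverse of $S_{n-1}(u)$ is a series whose determinants are units and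
return the classes of $z_i$ and $Q_i$ (\<open>toda_solution_determinants\<close>); its coefficients are the
images of the $h_k$ under the inverse $\Psi$ of $\Phi_n$.  That the kernel of $\Phi_n$ is the
ideal and that its image is the localization of $\Lambda_{(n)}$ is deduced from $\Psi$ in
\<open>toda_emb_kernel_image\<close>.
\<close>

section \<open>Conserved quantities of the relativistic Toda chain\<close>

text \<open>The polynomials $S_k(x)$.  Let $A$ be the matrix with diagonal $z_1,\dots,z_n$ and entries $-1$ above the
diagonal, and $B$ the matrix with diagonal $1,\dots,1$ and entries $-Q_jz_j$ below it; the Lax matrix of the
relativistic Toda chain is $AB^{-1}$.  Expanding the tridiagonal determinant along its last row shows that
$\zeta^kS_k(1/\zeta)$ is the $k$-th leading principal minor of $\zeta B-A$.\<close>

fun toda_poly :: "(nat \<Rightarrow> 'a::comm_ring_1) \<Rightarrow> (nat \<Rightarrow> 'a) \<Rightarrow> 'a \<Rightarrow> nat \<Rightarrow> 'a" where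
  "toda_poly z Q x 0 = 1"
| "toda_poly z Q x (Suc 0) = 1 - x * z 1"
| "toda_poly z Q x (Suc (Suc k)) =
     (1 - x * z (k + 2)) * toda_poly z Q x (Suc k) + x * (Q (k + 1) * z (k + 1)) * toda_poly z Q x k"

definition toda_F :: "(nat \<Rightarrow> 'a::comm_ring_1) \<Rightarrow> (nat \<Rightarrow> 'a) \<Rightarrow> nat \<Rightarrow> nat \<Rightarrow> 'a" where
  "toda_F z Q n i = (\<Sum>I | I \<subseteq> {1..n} \<and> card I = i.
      (\<Prod>j\<in>I. z j) * (\<Prod>j | j \<in> I \<and> j + 1 \<notin> I. 1 - Q j))"

text \<open>The generating function of the subsets of $\{1,\dots,k\}$ that underlies $F_i$: every maximal block of
consecutive elements contributes a factor $1-Q_j$ at its end $j$.  Setting $Q_k$ to $0$ removes the factor of a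
block that ends at $k$, which is how blocks that may still be continued are counted.\<close>

definition block_sum :: "(nat \<Rightarrow> 'a::comm_ring_1) \<Rightarrow> (nat \<Rightarrow> 'a) \<Rightarrow> nat \<Rightarrow> 'a" where
  "block_sum y Q k = (\<Sum>I\<in>Pow {1..k}. (\<Prod>j\<in>I. y j) * (\<Prod>j | j \<in> I \<and> j + 1 \<notin> I. 1 - Q j))"

lemma block_sum_cong:
  assumes "\<And>j. 1 \<le> j \<Longrightarrow> j \<le> k \<Longrightarrow> y j = y' j" "\<And>j. 1 \<le> j \<Longrightarrow> j \<le> k \<Longrightarrow> Q j = Q' j"
  shows "block_sum y Q k = block_sum y' Q' k"
  unfolding block_sum_def
  by (intro sum.cong arg_cong2[of _ _ _ _ "(*)"] prod.cong refl) (use assms in \<open>auto\<close>)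

text \<open>Sort the subsets of $\{1,\dots,k+1\}$ by whether they contain $k+1$.  If they do, a block ending at $k$ is
continued and loses its factor, whence $Q_k=0$ on the right.\<close>

lemma block_sum_Suc:
  "block_sum y Q (Suc k) = block_sum y Q k + y (Suc k) * (1 - Q (Suc k)) * block_sum y (Q(k := 0)) k"
proof -
  let ?w = "\<lambda>Q I. (\<Prod>j\<in>I. y j) * (\<Prod>j | j \<in> I \<and> j + 1 \<notin> I. 1 - Q j)"
  have "Pow {1..Suc k} = Pow {1..k} \<union> insert (Suc k) ` Pow {1..k}"
    by (simp add: atLeastAtMostSuc_conv Pow_insert)
  moreover have "Pow {1..k} \<inter> insert (Suc k) ` Pow {1..k} = {}" by auto
  ultimately have "block_sum y Q (Suc k) =
      block_sum y Q k + (\<Sum>I\<in>insert (Suc k) ` Pow {1..k}. ?w Q I)"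
    unfolding block_sum_def by (simp add: sum.union_disjoint)
  also have "(\<Sum>I\<in>insert (Suc k) ` Pow {1..k}. ?w Q I) = (\<Sum>I\<in>Pow {1..k}. ?w Q (insert (Suc k) I))"
  proof (rule sum.reindex_cong[OF _ refl refl])
    show "inj_on (insert (Suc k)) (Pow {1..k})"
      by (rule inj_onI) (metis Pow_iff Suc_n_not_le_n atLeastAtMost_iff insert_ident subsetD)
  qed
  also have "\<dots> = (\<Sum>I\<in>Pow {1..k}. y (Suc k) * (1 - Q (Suc k)) * ?w (Q(k := 0)) I)"
  proof (rule sum.cong[OF refl])
    fix I assume "I \<in> Pow {1..k}"
    then have I: "I \<subseteq> {1..k}" "finite I" by (auto intro: finite_subset)
    have nin: "Suc k \<notin> I" using I by auto
    have nin2: "Suc (Suc k) \<notin> I" using I by auto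
    have s: "{j. j \<in> insert (Suc k) I \<and> j + 1 \<notin> insert (Suc k) I}
        = insert (Suc k) {j. j \<in> I \<and> j + 1 \<notin> I \<and> j \<noteq> k}"
      using nin nin2 by auto
    have "(\<Prod>j | j \<in> I \<and> j + 1 \<notin> I. 1 - (Q(k := 0)) j) = (\<Prod>j | j \<in> I \<and> j + 1 \<notin> I \<and> j \<noteq> k. 1 - Q j)"
      by (rule prod.mono_neutral_cong_right) (use I in auto)
    then show "?w Q (insert (Suc k) I) = y (Suc k) * (1 - Q (Suc k)) * ?w (Q(k := 0)) I"
      unfolding s using nin I by (simp add: mult_ac)
  qed
  finally show ?thesis by (simp add: block_sum_def sum_distrib_left)
qed

text \<open>The two sides differ in the factor at the end $k+1$ of the last block, hence only in the subsets that contain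
$k+1$.\<close>

lemma block_sum_cut:
  "block_sum y Q (Suc k) = block_sum y (Q(Suc k := 0)) (Suc k) - Q (Suc k) * y (Suc k) * block_sum y (Q(k := 0)) k"
proof -
  have 1: "block_sum y (Q(Suc k := 0)) k = block_sum y Q k"
    by (rule block_sum_cong) auto
  have 2: "block_sum y (Q(Suc k := 0, k := 0)) k = block_sum y (Q(k := 0)) k"
    by (rule block_sum_cong) auto
  show ?thesis
    unfolding block_sum_Suc[of y Q] block_sum_Suc[of y "Q(Suc k := 0)"] 1 2
    by (simp add: algebra_simps)
qed

lemma block_sum_0: "block_sum y Q 0 = 1"
  by (simp add: block_sum_def)

lemma toda_poly_block_sum: "toda_poly z Q x k = block_sum (\<lambda>j. - x * z j) (Q(k := 0)) k"
proof (induction z Q x k rule: toda_poly.induct)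
  case (1 z Q x)
  show ?case by (simp add: block_sum_0)
next
  case (2 z Q x)
  show ?case by (simp add: block_sum_Suc[of _ _ 0] block_sum_0)
next
  case (3 z Q x k)
  let ?y = "\<lambda>j. - x * z j"
  have "block_sum ?y (Q(Suc (Suc k) := 0)) (Suc (Suc k)) = block_sum ?y (Q(Suc (Suc k) := 0)) (Suc k)
     + ?y (Suc (Suc k)) * block_sum ?y (Q(Suc (Suc k) := 0, Suc k := 0)) (Suc k)"
    by (subst block_sum_Suc) simp
  also have "block_sum ?y (Q(Suc (Suc k) := 0)) (Suc k) = block_sum ?y Q (Suc k)"
    by (rule block_sum_cong) auto
  also note block_sum_cut[of ?y Q k]
  also have "block_sum ?y (Q(Suc (Suc k) := 0, Suc k := 0)) (Suc k) = block_sum ?y (Q(Suc k := 0)) (Suc k)"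
    by (rule block_sum_cong) auto
  finally show ?case
    by (simp only: toda_poly.simps 3) (simp add: algebra_simps del: fun_upd_apply)
qed

text \<open>The $F_i$ are, up to sign, the coefficients of the characteristic polynomial of the Lax matrix.  So the defining
relations of the quantum $K$-ring say that this polynomial is $(\zeta-1)^n$.\<close>

lemma toda_poly_eq_sum_toda_F:
  assumes "Q n = 0"
  shows "toda_poly z Q x n = (\<Sum>i\<le>n. toda_F z Q n i * (- x) ^ i)"
proof -
  let ?w = "\<lambda>I. (\<Prod>j\<in>I. z j) * (\<Prod>j | j \<in> I \<and> j + 1 \<notin> I. 1 - Q j) * (- x) ^ card I"
  have "toda_poly z Q x n = (\<Sum>I\<in>Pow {1..n}. ?w I)"
    using assms unfolding toda_poly_block_sum block_sum_def
    by (intro sum.cong refl)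
       (simp add: prod.distrib fun_upd_idem mult_ac flip: prod_constant power_mult_distrib mult_minus_left)
  also have "\<dots> = (\<Sum>i\<le>n. \<Sum>I | I \<in> Pow {1..n} \<and> card I = i. ?w I)"
  proof (rule sum.group[symmetric])
    show "card ` Pow {1..n} \<subseteq> {..n}" using card_mono[of "{1..n}"] by fastforce
  qed auto
  also have "\<dots> = (\<Sum>i\<le>n. toda_F z Q n i * (- x) ^ i)"
    unfolding toda_F_def sum_distrib_right by (intro sum.cong) auto
  finally show ?thesis .
qed

section \<open>Determinants in powers of t/(1-t)\<close>

text \<open>The series $u=1/(1-t)$.  Throughout, $\zeta=1-t$, so that $u=\zeta^{-1}$ and $u-1=t/(1-t)$.\<close>

definition geo :: "'a::comm_ring_1 fps" where
  "geo = Abs_fps (\<lambda>_. 1)"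

lemma geo_nth [simp]: "fps_nth geo k = 1"
  by (simp add: geo_def)

lemma fps_mult_geo_nth: "fps_nth (f * geo) k = (\<Sum>l\<le>k. fps_nth f l)"
  by (simp add: fps_mult_nth geo_def atLeast0AtMost)

lemma geo_inverse: "(1 - fps_X) * geo = 1"
proof (rule fps_ext)
  fix k show "fps_nth ((1 - fps_X) * geo) k = fps_nth (1::'a fps) k"
    by (cases k) (simp_all add: left_diff_distrib)
qed

lemma geo_minus_1: "geo - 1 = fps_X * geo"
  using geo_inverse by (simp add: algebra_simps)

lemma geo_minus_1_power_nth:
  "k < a \<Longrightarrow> fps_nth ((geo - 1) ^ a) k = 0" "fps_nth ((geo - 1) ^ a) a = 1"
  by (simp_all add: geo_minus_1 power_mult_distrib fps_X_power_mult_nth fps_power_zeroth)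

text \<open>With $H=\sum_kh_kt^k$ the entry in row $a$ and column $b$, both counted from $0$, is the coefficient of
$t^{m+b-a}$ in $(1-t)^{-a}H$.  This is the entry of the determinant for the dual stable Grothendieck polynomial
of a rectangle with $i$ rows and $m$ columns; the power of $t/(1-t)$ accounts for both the shift of the index
and the binomial coefficients.\<close>

definition tau_det :: "'a::comm_ring_1 fps \<Rightarrow> nat \<Rightarrow> nat \<Rightarrow> 'a" where
  "tau_det H m i = det (mat i i (\<lambda>(a, b). fps_nth (H * (geo - 1) ^ a) (m + b)))"

text \<open>One factor $1/(1-t)$ more than in the determinant for $\tau$, so every entry is replaced by a partial sum of
the coefficients of its row.  By \<open>sum_box_gdet\<close> below this is the sum of the
$g_\mu$ over the rectangle.\<close>

definition sigma_det :: "'a::comm_ring_1 fps \<Rightarrow> nat \<Rightarrow> nat \<Rightarrow> 'a" where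
  "sigma_det H m i = det (mat i i (\<lambda>(a, b). fps_nth (H * geo * (geo - 1) ^ a) (m + b)))"

lemma det_power_basis_0:
  assumes "fps_nth W 0 = 1"
  shows "det (mat n n (\<lambda>(a, b). fps_nth (W * (geo - 1) ^ a) b)) = 1"
proof -
  let ?M = "mat n n (\<lambda>(a, b). fps_nth (W * (geo - 1) ^ a) b)"
  have e: "fps_nth (W * (geo - 1) ^ a) b = (if b < a then 0 else if a = b then 1 else fps_nth (W * (geo - 1) ^ a) b)" for a b
    using assms by (auto simp: geo_minus_1 power_mult_distrib mult.left_commute[of W]
        fps_X_power_mult_nth fps_power_zeroth)
  have "det ?M = prod_list (diag_mat ?M)"
    by (rule det_upper_triangular) (auto simp: upper_triangular_def e)
  also have "\<dots> = 1" by (simp add: prod_list_diag_prod e)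
  finally show ?thesis .
qed

lemma tau_det_0: "fps_nth H 0 = 1 \<Longrightarrow> tau_det H 0 n = 1"
  by (simp add: tau_det_def det_power_basis_0)

lemma sigma_det_0: "fps_nth H 0 = 1 \<Longrightarrow> sigma_det H 0 n = 1"
  by (simp add: sigma_det_def det_power_basis_0)

text \<open>Replacing the rows $W(u-1)^a$ by $Wf_k$, with $f_k$ a polynomial of degree $k$ in $u-1$, is multiplication by a
lower triangular matrix with the leading coefficients on its diagonal.\<close>

lemma det_triangular_rows:
  fixes W :: "'a::comm_ring_1 fps"
  assumes f: "\<And>k. k < i \<Longrightarrow> f k = (\<Sum>a\<le>k. fps_const (c k a) * (geo - 1) ^ a)"
  shows "det (mat i i (\<lambda>(k, b). fps_nth (W * f k) (m + b))) =
    (\<Prod>k<i. c k k) * det (mat i i (\<lambda>(a, b). fps_nth (W * (geo - 1) ^ a) (m + b)))"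
proof -
  let ?U = "mat i i (\<lambda>(k, a). if a \<le> k then c k a else 0)"
  let ?M = "mat i i (\<lambda>(a, b). fps_nth (W * (geo - 1) ^ a) (m + b))"
  have "mat i i (\<lambda>(k, b). fps_nth (W * f k) (m + b)) = ?U * ?M"
  proof (rule eq_matI)
    fix k b assume kb: "k < dim_row (?U * ?M)" "b < dim_col (?U * ?M)"
    have "fps_nth (W * f k) (m + b) = (\<Sum>a\<le>k. c k a * fps_nth (W * (geo - 1) ^ a) (m + b))"
      using kb by (simp add: f sum_distrib_left fps_sum_nth mult.left_commute[of W])
    also have "\<dots> = (\<Sum>a\<in>{0..<i}. (if a \<le> k then c k a else 0) * fps_nth (W * (geo - 1) ^ a) (m + b))"
      using kb by (intro sum.mono_neutral_cong_left) auto
    finally show "mat i i (\<lambda>(k, b). fps_nth (W * f k) (m + b)) $$ (k, b) = (?U * ?M) $$ (k, b)"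
      using kb by (simp add: scalar_prod_def)
  qed auto
  moreover have "det ?U = prod_list (diag_mat ?U)"
    by (rule det_lower_triangular[where n = i]) auto
  moreover have "prod_list (diag_mat ?U) = (\<Prod>k<i. c k k)"
    by (simp add: prod_list_diag_prod lessThan_atLeast0)
  ultimately show ?thesis
    using det_mult[of ?U i ?M] by simp
qed

lemma det_last_row_first_entry:
  fixes M :: "'a::comm_ring_1 mat"
  assumes M: "M \<in> carrier_mat (Suc i) (Suc i)" and z: "\<And>b. 0 < b \<Longrightarrow> b \<le> i \<Longrightarrow> M $$ (i, b) = 0"
  shows "det M = (-1) ^ i * M $$ (i, 0) * det (mat i i (\<lambda>(k, b). M $$ (k, Suc b)))"
proof -
  have "det M = (\<Sum>j<Suc i. M $$ (i, j) * cofactor M i j)"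
    by (rule laplace_expansion_row[OF M]) simp
  also have "\<dots> = M $$ (i, 0) * cofactor M i 0"
    by (rule sum.remove[of _ 0, THEN trans]) (use z in auto)
  also have "mat_delete M i 0 = mat i i (\<lambda>(k, b). M $$ (k, Suc b))"
    using M by (auto simp: mat_delete_def)
  then have "cofactor M i 0 = (-1) ^ i * det (mat i i (\<lambda>(k, b). M $$ (k, Suc b)))"
    by (simp add: cofactor_def)
  finally show ?thesis by (simp add: mult_ac)
qed

text \<open>If row $k$ has degree less than $n-k$, then the minor of the last $i$ of the columns $t^0,\dots,t^{n-1}$ is
triangular with respect to the antidiagonal, and its value is the product of top coefficients.  The sign of each
row is the one that expansion along the last row produces.\<close>

lemma det_descending_degrees:
  fixes N :: "nat \<Rightarrow> 'a::comm_ring_1 fps"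
  assumes "\<And>k m. k < i \<Longrightarrow> n - k \<le> m \<Longrightarrow> m < n \<Longrightarrow> fps_nth (N k) m = 0" "i \<le> n"
  shows "det (mat i i (\<lambda>(k, b). fps_nth (N k) (n - i + b))) =
    (\<Prod>k<i. (-1) ^ k * fps_nth (N k) (n - 1 - k))"
  using assms
proof (induction i)
  case 0
  then show ?case by simp
next
  case (Suc i)
  let ?M = "mat (Suc i) (Suc i) (\<lambda>(k, b). fps_nth (N k) (n - Suc i + b))"
  have "det ?M = (-1) ^ i * ?M $$ (i, 0) * det (mat i i (\<lambda>(k, b). ?M $$ (k, Suc b)))"
    by (rule det_last_row_first_entry) (use Suc.prems in auto)
  also have "mat i i (\<lambda>(k, b). ?M $$ (k, Suc b)) = mat i i (\<lambda>(k, b). fps_nth (N k) (n - i + b))"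
    using Suc.prems(2) by (intro eq_matI) (auto simp: Suc_diff_Suc)
  also have "det \<dots> = (\<Prod>k<i. (-1) ^ k * fps_nth (N k) (n - 1 - k))"
    using Suc by auto
  finally show ?case by (simp add: mult_ac)
qed

text \<open>The analogue for the rows $N_k/(1-t)$.  Subtracting from each column the one before it turns partial sums back
into coefficients, except in the first column; the last row is then zero outside the first column.\<close>

lemma det_partial_sums_descending_degrees:
  fixes N :: "nat \<Rightarrow> 'a::comm_ring_1 fps"
  assumes N: "\<And>k m. k < Suc i \<Longrightarrow> n - k \<le> m \<Longrightarrow> m < n \<Longrightarrow> fps_nth (N k) m = 0" and i: "Suc i \<le> n"
  shows "det (mat (Suc i) (Suc i) (\<lambda>(k, b). fps_nth (N k * geo) (n - Suc i + b))) =
    (-1) ^ i * fps_nth (N i * geo) (n - Suc i) * (\<Prod>k<i. (-1) ^ k * fps_nth (N k) (n - 1 - k))"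
proof -
  let ?m = "n - Suc i"
  let ?M = "mat (Suc i) (Suc i) (\<lambda>(k, b). fps_nth (N k * geo) (?m + b))"
  let ?P = "mat (Suc i) (Suc i) (\<lambda>(k, b). if b = 0 then fps_nth (N k * geo) ?m else fps_nth (N k) (?m + b))"
  let ?C = "mat (Suc i) (Suc i) (\<lambda>(c, b). if c \<le> b then 1 else 0 :: 'a)"
  have part: "fps_nth (f * geo) (m + b) =
      (\<Sum>c\<le>b. if c = 0 then fps_nth (f * geo) m else fps_nth f (m + c))" for f :: "'a fps" and m b
    by (induction b) (simp_all add: fps_mult_geo_nth)
  have "?M = ?P * ?C"
  proof (rule eq_matI)
    fix k b assume kb: "k < dim_row (?P * ?C)" "b < dim_col (?P * ?C)"
    have "(\<Sum>c\<le>b. if c = 0 then fps_nth (N k * geo) ?m else fps_nth (N k) (?m + c)) =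
       (\<Sum>c\<in>{0..<Suc i}. (if c = 0 then fps_nth (N k * geo) ?m else fps_nth (N k) (?m + c)) *
          (if c \<le> b then 1 else 0))"
      using kb by (intro sum.mono_neutral_cong_left) auto
    then show "?M $$ (k, b) = (?P * ?C) $$ (k, b)"
      using kb by (simp add: scalar_prod_def part[of "N k" ?m b] del: sum.op_ivl_Suc)
  qed auto
  moreover have "det ?C = prod_list (diag_mat ?C)"
    by (rule det_upper_triangular) (auto simp: upper_triangular_def)
  then have "det ?C = 1" by (simp add: prod_list_diag_prod)
  ultimately have "det ?M = det ?P"
    using det_mult[of ?P "Suc i" ?C] by simp
  also have "\<dots> = (-1) ^ i * ?P $$ (i, 0) * det (mat i i (\<lambda>(k, b). ?P $$ (k, Suc b)))"
    by (rule det_last_row_first_entry) (use N i in auto)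
  also have "mat i i (\<lambda>(k, b). ?P $$ (k, Suc b)) = mat i i (\<lambda>(k, b). fps_nth (N k) (n - i + b))"
    using i by (intro eq_matI) (auto simp: Suc_diff_Suc)
  also have "det \<dots> = (\<Prod>k<i. (-1) ^ k * fps_nth (N k) (n - 1 - k))"
    by (rule det_descending_degrees) (use N i in auto)
  finally show ?thesis by simp
qed

section \<open>The Toda polynomials as power series\<close>

lemma toda_poly_hom:
  assumes "comm_ring_hom h"
  shows "h (toda_poly z Q x k) = toda_poly (\<lambda>j. h (z j)) (\<lambda>j. h (Q j)) (h x) k"
proof -
  interpret comm_ring_hom h by fact
  show ?thesis by (induction z Q x k rule: toda_poly.induct) (simp_all add: hom_distribs)
qed

lemma toda_F_hom:
  assumes "comm_ring_hom h"
  shows "h (toda_F z Q n i) = toda_F (\<lambda>j. h (z j)) (\<lambda>j. h (Q j)) n i"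
proof -
  interpret comm_ring_hom h by fact
  show ?thesis by (simp add: toda_F_def hom_distribs)
qed

text \<open>Only the full set contributes, it forms a single block, and the block ends at $n$.\<close>

lemma toda_F_top: "Q n = 0 \<Longrightarrow> toda_F z Q n n = (\<Prod>j=1..n. z j)"
proof -
  assume Q: "Q n = 0"
  have "{I. I \<subseteq> {1..n} \<and> card I = n} = {{1..n}}"
    using card_subset_eq[of "{1..n}"] by auto
  moreover have "(\<Prod>j | j \<in> {1..n} \<and> j + 1 \<notin> {1..n}. 1 - Q j) = 1"
  proof (rule prod.neutral, rule ballI)
    fix j assume "j \<in> {j. j \<in> {1..n} \<and> j + 1 \<notin> {1..n}}"
    then have "j = n" by auto
    with Q show "1 - Q j = 1" by simp
  qed
  ultimately show ?thesis by (simp add: toda_F_def)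
qed

definition toda_fps :: "(nat \<Rightarrow> 'a::comm_ring_1) \<Rightarrow> (nat \<Rightarrow> 'a) \<Rightarrow> nat \<Rightarrow> 'a fps" where
  "toda_fps z Q = toda_poly (\<lambda>j. fps_const (z j)) (\<lambda>j. fps_const (Q j)) geo"

text \<open>$S_k$ as a polynomial in $v=u-1$; its coefficients express the rows $HS_k(u)$ through the rows $Hv^a$ of the
determinants.\<close>

definition toda_pol :: "(nat \<Rightarrow> 'a::comm_ring_1) \<Rightarrow> (nat \<Rightarrow> 'a) \<Rightarrow> nat \<Rightarrow> 'a poly" where
  "toda_pol z Q = toda_poly (\<lambda>j. [:z j:]) (\<lambda>j. [:Q j:]) [:1, 1:]"

lemma comm_ring_hom_eval_fps: "comm_ring_hom (\<lambda>p. poly (map_poly fps_const p) w)"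
proof -
  interpret c: comm_ring_hom "fps_const :: 'a \<Rightarrow> 'a fps" by standard simp_all
  interpret map_poly_comm_ring_hom "fps_const :: 'a \<Rightarrow> 'a fps" ..
  show ?thesis by standard (simp_all add: hom_distribs)
qed

lemma comm_ring_hom_fps_const: "comm_ring_hom fps_const"
  by standard simp_all

text \<open>Two consecutive values of $k$ are treated together because the recurrence has depth two.\<close>

lemma degree_toda_pol: "degree (toda_pol z Q k) \<le> k"
  and coeff_toda_pol: "coeff (toda_pol z Q k) k = (-1) ^ k * (\<Prod>j=1..k. z j)"
proof -
  have "degree (toda_pol z Q k) \<le> k \<and> degree (toda_pol z Q (Suc k)) \<le> Suc k \<and>
     coeff (toda_pol z Q k) k = (-1) ^ k * (\<Prod>j=1..k. z j) \<and>
     coeff (toda_pol z Q (Suc k)) (Suc k) = (-1) ^ Suc k * (\<Prod>j=1..Suc k. z j)"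
  proof (induction k)
    case 0
    then show ?case by (simp add: toda_pol_def one_pCons)
  next
    case (Suc k)
    let ?p = "toda_pol z Q k" and ?p' = "toda_pol z Q (Suc k)"
    have e: "toda_pol z Q (Suc (Suc k)) = smult (1 - z (k + 2)) ?p' - pCons 0 (smult (z (k + 2)) ?p')
        + smult (Q (k + 1) * z (k + 1)) ?p + pCons 0 (smult (Q (k + 1) * z (k + 1)) ?p)"
      unfolding toda_pol_def toda_poly.simps by (simp add: algebra_simps smult_add_right smult_add_left smult_diff_left)
    have "coeff (toda_pol z Q (Suc (Suc k))) m = 0" if "m > Suc (Suc k)" for m
      using that Suc unfolding e by (auto simp: coeff_eq_0 coeff_pCons split: nat.split)
    then have d: "degree (toda_pol z Q (Suc (Suc k))) \<le> Suc (Suc k)"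
      by (intro degree_le) auto
    have "coeff (toda_pol z Q (Suc (Suc k))) (Suc (Suc k)) = - z (k + 2) * coeff ?p' (Suc k)"
      using Suc unfolding e by (auto simp: coeff_eq_0)
    with d Suc show ?case by simp
  qed
  then show "degree (toda_pol z Q k) \<le> k"
    "coeff (toda_pol z Q k) k = (-1) ^ k * (\<Prod>j=1..k. z j)" by auto
qed

lemma map_poly_const_fps: "map_poly fps_const [:c:] = [:fps_const c:]"
  by (cases "c = 0") (simp_all add: map_poly_pCons)

lemma toda_fps_expansion:
  "toda_fps z Q k = (\<Sum>a\<le>k. fps_const (coeff (toda_pol z Q k) a) * (geo - 1) ^ a)"
proof -
  have "toda_fps z Q k = poly (map_poly fps_const (toda_pol z Q k)) (geo - 1)"
    unfolding toda_fps_def toda_pol_def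
    by (subst toda_poly_hom[OF comm_ring_hom_eval_fps]) (simp add: map_poly_const_fps)
  also have "\<dots> = (\<Sum>a\<le>degree (toda_pol z Q k). fps_const (coeff (toda_pol z Q k) a) * (geo - 1) ^ a)"
    using eval_poly_as_sum[of fps_const "toda_pol z Q k" "geo - 1"] by (simp add: eval_poly_def mult.commute)
  also have "\<dots> = (\<Sum>a\<le>k. fps_const (coeff (toda_pol z Q k) a) * (geo - 1) ^ a)"
    using degree_toda_pol[of z Q k] by (intro sum.mono_neutral_left) (auto simp: coeff_eq_0)
  finally show ?thesis .
qed

lemma toda_fps_eq_sum_toda_F:
  "Q n = 0 \<Longrightarrow> toda_fps z Q n = (\<Sum>i\<le>n. fps_const (toda_F z Q n i) * (- geo) ^ i)"
  by (simp add: toda_fps_def toda_poly_eq_sum_toda_F toda_F_hom[OF comm_ring_hom_fps_const])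

text \<open>Multiplication by $u=1/(1-t)$ forms partial sums, so the recurrence becomes a relation between the coefficients
of $HS_{k+2}$ and $HS_{k+1}$ and the partial sums of the coefficients of $HS_{k+1}$ and $HS_k$.\<close>

lemma toda_fps_mult_nth:
  fixes H :: "'a::comm_ring_1 fps" and z Q :: "nat \<Rightarrow> 'a"
  defines "N \<equiv> \<lambda>k. H * toda_fps z Q k"
  shows "fps_nth (N (Suc 0)) m = fps_nth (N 0) m - z 1 * fps_nth (N 0 * geo) m"
    and "fps_nth (N (Suc (Suc k))) m = fps_nth (N (Suc k)) m - z (k + 2) * fps_nth (N (Suc k) * geo) m
      + Q (k + 1) * z (k + 1) * fps_nth (N k * geo) m"
proof -
  have "N (Suc 0) = N 0 - fps_const (z 1) * (N 0 * geo)"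
    by (simp add: N_def toda_fps_def algebra_simps)
  then show "fps_nth (N (Suc 0)) m = fps_nth (N 0) m - z 1 * fps_nth (N 0 * geo) m" by simp
  have "N (Suc (Suc k)) = N (Suc k) - fps_const (z (k + 2)) * (N (Suc k) * geo)
      + fps_const (Q (k + 1) * z (k + 1)) * (N k * geo)"
    by (simp add: N_def toda_fps_def algebra_simps flip: fps_const_mult)
  then show "fps_nth (N (Suc (Suc k))) m = fps_nth (N (Suc k)) m - z (k + 2) * fps_nth (N (Suc k) * geo) m
      + Q (k + 1) * z (k + 1) * fps_nth (N k * geo) m"
    by (simp only: fps_add_nth fps_sub_nth fps_mult_left_const_nth)
qed

section \<open>Congruence modulo an ideal\<close>

text \<open>The same linear algebra is used twice: over a field, where the relations hold exactly, and over a polynomial ring,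
where they hold modulo an ideal.  Congruence modulo an ideal of a commutative ring covers both cases; the field is
the case of the zero ideal.\<close>

locale ideal_cong =
  fixes J :: "'a::comm_ring_1 set"
  assumes zero_mem: "0 \<in> J" and add_mem: "x \<in> J \<Longrightarrow> y \<in> J \<Longrightarrow> x + y \<in> J"
    and mult_mem: "x \<in> J \<Longrightarrow> r * x \<in> J"
begin

definition eqv :: "'a \<Rightarrow> 'a \<Rightarrow> bool" (infix "\<sim>" 50) where
  "x \<sim> y \<longleftrightarrow> x - y \<in> J"

lemma eqv_refl [simp, intro]: "x \<sim> x"
  by (simp add: eqv_def zero_mem)

lemma uminus_mem: "x \<in> J \<Longrightarrow> - x \<in> J"
  using mult_mem[of x "- 1"] by simp

lemma eqv_sym: "x \<sim> y \<Longrightarrow> y \<sim> x"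
  using uminus_mem[of "x - y"] by (simp add: eqv_def)

lemma eqv_trans [trans]: "x \<sim> y \<Longrightarrow> y \<sim> w \<Longrightarrow> x \<sim> w"
  using add_mem[of "x - y" "y - w"] by (simp add: eqv_def)

lemma eqv_add: "x \<sim> y \<Longrightarrow> x' \<sim> y' \<Longrightarrow> x + x' \<sim> y + y'"
  using add_mem[of "x - y" "x' - y'"] by (simp add: eqv_def algebra_simps)

lemma eqv_mult: "x \<sim> y \<Longrightarrow> x' \<sim> y' \<Longrightarrow> x * x' \<sim> y * y'"
  using add_mem[OF mult_mem[of "x - y" x'] mult_mem[of "x' - y'" y]]
  by (simp add: eqv_def algebra_simps)

lemma eqv_mult_left: "x \<sim> y \<Longrightarrow> r * x \<sim> r * y"
  by (rule eqv_mult) auto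

lemma eqv_uminus: "x \<sim> y \<Longrightarrow> - x \<sim> - y"
  using eqv_mult_left[of x y "- 1"] by simp

lemma eqv_diff: "x \<sim> y \<Longrightarrow> x' \<sim> y' \<Longrightarrow> x - x' \<sim> y - y'"
  using eqv_add[OF _ eqv_uminus, of x y x' y'] by simp

lemma eqv_diff_0_iff: "x - y \<sim> 0 \<longleftrightarrow> x \<sim> y"
  by (simp add: eqv_def)

lemma eqv_sum: "(\<And>i. i \<in> A \<Longrightarrow> f i \<sim> g i) \<Longrightarrow> sum f A \<sim> sum g A"
  by (induction A rule: infinite_finite_induct) (auto intro: eqv_add)

lemma eqv_prod: "(\<And>i. i \<in> A \<Longrightarrow> f i \<sim> g i) \<Longrightarrow> prod f A \<sim> prod g A"
  by (induction A rule: infinite_finite_induct) (auto intro: eqv_mult)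

lemma eqv_det:
  assumes "\<And>a b. a < i \<Longrightarrow> b < i \<Longrightarrow> f (a, b) \<sim> g (a, b)"
  shows "det (mat i i f) \<sim> det (mat i i g)"
proof -
  have "f (a, p a) \<sim> g (a, p a)" if "p permutes {0..<i}" "a \<in> {0..<i}" for p a
    using assms[of a "p a"] permutes_in_image[OF that(1), of a] that(2) by auto
  then show ?thesis
    by (auto simp: det_def intro!: eqv_sum eqv_mult_left eqv_prod)
qed

text \<open>The power series whose first $n$ coefficients lie in $J$ form an ideal.\<close>

lemma eqv_fps_mult:
  assumes "\<And>k. k < n \<Longrightarrow> fps_nth f k \<sim> fps_nth f' k" "\<And>k. k < n \<Longrightarrow> fps_nth g k \<sim> fps_nth g' k" "k < n"
  shows "fps_nth (f * g) k \<sim> fps_nth (f' * g') k"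
  unfolding fps_mult_nth by (intro eqv_sum eqv_mult assms) (use assms(3) in auto)

definition unit :: "'a \<Rightarrow> bool" where
  "unit x \<longleftrightarrow> (\<exists>y. x * y \<sim> 1)"

lemma unit_mult_iff: "unit (x * y) \<longleftrightarrow> unit x \<and> unit y"
proof
  assume "unit (x * y)"
  then obtain w where "x * y * w \<sim> 1" by (auto simp: unit_def)
  then have "x * (y * w) \<sim> 1" "y * (x * w) \<sim> 1" by (simp_all add: mult_ac)
  then show "unit x \<and> unit y" unfolding unit_def by blast
next
  assume "unit x \<and> unit y"
  then obtain v w where vw: "x * v \<sim> 1" "y * w \<sim> 1" by (auto simp: unit_def)
  have "(x * y) * (v * w) = (x * v) * (y * w)" by (simp add: mult_ac)
  also have "\<dots> \<sim> 1 * 1" by (rule eqv_mult) (use vw in auto)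
  finally show "unit (x * y)" unfolding unit_def by auto
qed

lemma unit_cong: "x \<sim> y \<Longrightarrow> unit y \<Longrightarrow> unit x"
  unfolding unit_def by (meson eqv_mult eqv_refl eqv_trans)

lemma unit_1 [simp]: "unit 1"
  by (auto simp: unit_def intro: exI[of _ 1])

lemma unit_prod_iff: "finite A \<Longrightarrow> unit (prod f A) \<longleftrightarrow> (\<forall>i\<in>A. unit (f i))"
  by (induction A rule: finite_induct) (auto simp: unit_mult_iff)

lemma eqv_cancel:
  assumes "unit x" "x * a \<sim> x * b"
  shows "a \<sim> b"
proof -
  obtain y where y: "x * y \<sim> 1" using assms(1) by (auto simp: unit_def)
  have e: "y * (x * c) \<sim> c" for c
    using eqv_mult[OF y eqv_refl[of c]] by (simp add: mult_ac)
  have "a \<sim> y * (x * a)" by (rule eqv_sym[OF e])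
  also have "\<dots> \<sim> y * (x * b)" by (rule eqv_mult_left[OF assms(2)])
  also have "\<dots> \<sim> b" by (rule e)
  finally show ?thesis .
qed

section \<open>Short rows and determinants\<close>

text \<open>The rows $N_k=HS_k(u)$.  Row $k$ is called short if modulo $t^n$ it has degree less than $n-k$.  Since
$u^{-k}S_k(u)$ is a polynomial of degree $k$ in $t$, this makes it the denominator of a Pade-type approximation of
$H$.  For short rows $A_k$, the coefficient of $t^{n-1-k}$, is the top coefficient of $N_k$, and $B_k$ is
the sum of all its coefficients.\<close>

context
  fixes n :: nat and z Q :: "nat \<Rightarrow> 'a" and H :: "'a fps"
begin

abbreviation "hrow k \<equiv> H * toda_fps z Q k"
abbreviation "top_coeff k \<equiv> fps_nth (hrow k) (n - 1 - k)"
abbreviation "top_sum k \<equiv> fps_nth (hrow k * geo) (n - 1 - k)"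
abbreviation "Zprod i \<equiv> (\<Prod>k<i. \<Prod>j=1..k. z j)"

definition short_row :: "nat \<Rightarrow> bool" where
  "short_row k \<longleftrightarrow> (\<forall>m. n - k \<le> m \<longrightarrow> m < n \<longrightarrow> fps_nth (hrow k) m \<sim> 0)"

text \<open>The sign $\prod_{k<i}(-1)^k$ of an $i\times i$ antidiagonal determinant is also the sign of the product of the
leading coefficients of $S_0,\dots,S_{i-1}$.  So the two signs in the next two lemmas cancel.\<close>

lemma minus_one_power_square: "(\<Prod>k<i. (-1) ^ k) * (\<Prod>k<i. (-1) ^ k) = (1::'a)"
  by (simp add: prod.distrib[symmetric] flip: power_mult_distrib)

lemma prod_coeff_toda_pol: "(\<Prod>k<i. coeff (toda_pol z Q k) k) = (\<Prod>k<i. (-1) ^ k) * Zprod i"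
  by (simp add: coeff_toda_pol prod.distrib)

text \<open>Passing from the rows $H(u-1)^a$ to the short rows $HS_k(u)$ makes the determinant antitriangular:
$\tau_i\prod_{k<i}z_1\cdots z_k=\prod_{k<i}A_k$.\<close>

lemma tau_det_eqv:
  assumes "i \<le> n" "\<And>k. k < i \<Longrightarrow> short_row k"
  shows "Zprod i * tau_det H (n - i) i \<sim> (\<Prod>k<i. top_coeff k)"
proof -
  \<comment> \<open>Cutting off the coefficients that lie in the ideal makes the vanishing exact.\<close>
  define N where "N = (\<lambda>k. Abs_fps (\<lambda>m. if m < n - k then fps_nth (hrow k) m else 0))"
  let ?e = "\<Prod>k<i. (-1) ^ k :: 'a"
  have "?e * (Zprod i * tau_det H (n - i) i) = det (mat i i (\<lambda>(k, b). fps_nth (hrow k) (n - i + b)))"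
    unfolding tau_det_def
    by (subst det_triangular_rows[OF toda_fps_expansion]) (simp add: prod_coeff_toda_pol mult.assoc)
  also have "\<dots> \<sim> det (mat i i (\<lambda>(k, b). fps_nth (N k) (n - i + b)))"
    by (rule eqv_det) (use assms in \<open>auto simp: N_def short_row_def\<close>)
  also have "\<dots> = (\<Prod>k<i. (-1) ^ k * fps_nth (N k) (n - 1 - k))"
    by (rule det_descending_degrees) (use assms(1) in \<open>auto simp: N_def\<close>)
  also have "\<dots> = ?e * (\<Prod>k<i. top_coeff k)"
    using assms(1) by (auto simp: prod.distrib N_def intro!: prod.cong arg_cong[of _ _ "(*) _"])
  finally have "?e * (?e * (Zprod i * tau_det H (n - i) i)) \<sim> ?e * (?e * (\<Prod>k<i. top_coeff k))"
    by (rule eqv_mult_left)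
  then show ?thesis by (simp add: minus_one_power_square flip: mult.assoc)
qed

text \<open>The same change of rows gives $\sigma_{i+1}\prod_{k\le i}z_1\cdots z_k=B_i\prod_{k<i}A_k$.  Compared with
the formula for $\tau_{i+1}$, one top coefficient is replaced by the sum of the coefficients, whence
$\sigma_{i+1}/\tau_{i+1}=B_i/A_i$.\<close>

lemma sigma_det_eqv:
  assumes "Suc i \<le> n" "\<And>k. k < Suc i \<Longrightarrow> short_row k"
  shows "Zprod (Suc i) * sigma_det H (n - Suc i) (Suc i) \<sim> top_sum i * (\<Prod>k<i. top_coeff k)"
proof -
  define N where "N = (\<lambda>k. Abs_fps (\<lambda>m. if m < n - k then fps_nth (hrow k) m else 0))"
  let ?e = "\<lambda>i. \<Prod>k<i. (-1) ^ k :: 'a"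
  have NR: "fps_nth (N k) m \<sim> fps_nth (hrow k) m" if "m < n" "k < Suc i" for m k
    using assms(2)[of k] that by (auto simp: N_def short_row_def intro: eqv_sym)
  have NRg: "fps_nth (N k * geo) m \<sim> fps_nth (hrow k * geo) m" if "m < n" "k < Suc i" for m k
    by (rule eqv_fps_mult[where n = n]) (use NR that in auto)
  have "?e (Suc i) * (Zprod (Suc i) * sigma_det H (n - Suc i) (Suc i)) =
      det (mat (Suc i) (Suc i) (\<lambda>(k, b). fps_nth (hrow k * geo) (n - Suc i + b)))"
    using det_triangular_rows[where W = "H * geo" and f = "toda_fps z Q" and m = "n - Suc i" and i = "Suc i",
        OF toda_fps_expansion]
    unfolding sigma_det_def prod_coeff_toda_pol by (simp only: mult_ac)
  also have "\<dots> \<sim> det (mat (Suc i) (Suc i) (\<lambda>(k, b). fps_nth (N k * geo) (n - Suc i + b)))"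
    by (rule eqv_det) (use assms(1) in \<open>auto intro!: eqv_sym[OF NRg]\<close>)
  also have "\<dots> = (-1) ^ i * fps_nth (N i * geo) (n - Suc i) * (\<Prod>k<i. (-1) ^ k * fps_nth (N k) (n - 1 - k))"
    by (rule det_partial_sums_descending_degrees) (use assms(1) in \<open>auto simp: N_def\<close>)
  also have "(\<Prod>k<i. (-1) ^ k * fps_nth (N k) (n - 1 - k)) = ?e i * (\<Prod>k<i. top_coeff k)"
    using assms(1) by (auto simp: prod.distrib N_def intro!: prod.cong arg_cong[of _ _ "(*) _"])
  also have "(-1) ^ i * fps_nth (N i * geo) (n - Suc i) * (?e i * (\<Prod>k<i. top_coeff k)) \<sim>
     (-1) ^ i * top_sum i * (?e i * (\<Prod>k<i. top_coeff k))"
    by (intro eqv_mult eqv_refl) (use NRg[of "n - Suc i" i] assms(1) in auto)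
  also have "\<dots> = ?e (Suc i) * (top_sum i * (\<Prod>k<i. top_coeff k))"
    by (simp add: mult_ac)
  finally have "?e (Suc i) * (?e (Suc i) * (Zprod (Suc i) * sigma_det H (n - Suc i) (Suc i))) \<sim>
      ?e (Suc i) * (?e (Suc i) * (top_sum i * (\<Prod>k<i. top_coeff k)))"
    by (rule eqv_mult_left)
  then show ?thesis
    using minus_one_power_square[of "Suc i"] by (simp only: mult_1 flip: mult.assoc)
qed

lemma mult_geo_nth_Suc: "fps_nth (f * geo) (Suc m) = fps_nth (f * geo) m + fps_nth f (Suc m)"
  by (simp add: fps_mult_geo_nth)

text \<open>Beyond the degree of a row its partial sums do not change any more.\<close>

lemma partial_sums_stationary:
  assumes "short_row k" "n - 1 - k \<le> m" "m < n"
  shows "fps_nth (hrow k * geo) m \<sim> top_sum k"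
  using assms(2,3)
proof (induction m rule: dec_induct)
  case (step m)
  have "fps_nth (hrow k) (Suc m) \<sim> 0"
    using assms(1) step.hyps step.prems by (auto simp: short_row_def)
  then show ?case
    using eqv_add[of "fps_nth (hrow k * geo) m" "top_sum k" "fps_nth (hrow k) (Suc m)" 0] step
    by (simp add: mult_geo_nth_Suc)
qed simp

lemma partial_sum_before_top:
  assumes "Suc k < n"
  shows "fps_nth (hrow k * geo) (n - 2 - k) = top_sum k - top_coeff k"
proof -
  have "n - 1 - k = Suc (n - 2 - k)" using assms by simp
  then show ?thesis by (simp only: mult_geo_nth_Suc) simp
qed

text \<open>In the degrees where $N_{k+1}$ vanishes already, all coefficients of $N_{k+2}$ have the same value.\<close>

lemma recurrence_above_top:
  assumes "short_row k" "short_row (Suc k)" "n - 1 - k \<le> m" "m < n"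
  shows "fps_nth (hrow (Suc (Suc k))) m \<sim> Q (k + 1) * z (k + 1) * top_sum k - z (k + 2) * top_sum (Suc k)"
proof -
  have "fps_nth (hrow (Suc k)) m \<sim> 0"
    using assms by (auto simp: short_row_def)
  moreover have "fps_nth (hrow (Suc k) * geo) m \<sim> top_sum (Suc k)"
    by (rule partial_sums_stationary) (use assms in auto)
  moreover have "fps_nth (hrow k * geo) m \<sim> top_sum k"
    by (rule partial_sums_stationary) (use assms in auto)
  ultimately have "fps_nth (hrow (Suc (Suc k))) m \<sim> 0 - z (k + 2) * top_sum (Suc k) + Q (k + 1) * z (k + 1) * top_sum k"
    unfolding toda_fps_mult_nth by (intro eqv_add eqv_diff eqv_mult_left)
  then show ?thesis by simp
qed

lemma recurrence_at_top:
  assumes "short_row k" "short_row (Suc k)" "Suc k < n"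
  shows "fps_nth (hrow (Suc (Suc k))) (n - 2 - k) \<sim>
    (top_coeff (Suc k) - Q (k + 1) * z (k + 1) * top_coeff k) + (Q (k + 1) * z (k + 1) * top_sum k - z (k + 2) * top_sum (Suc k))"
proof -
  have "fps_nth (hrow (Suc (Suc k))) (n - 2 - k) = top_coeff (Suc k) - z (k + 2) * top_sum (Suc k) + Q (k + 1) * z (k + 1) * (top_sum k - top_coeff k)"
    unfolding toda_fps_mult_nth partial_sum_before_top[OF assms(3)] by (simp add: numeral_2_eq_2)
  also have "\<dots> = (top_coeff (Suc k) - Q (k + 1) * z (k + 1) * top_coeff k) + (Q (k + 1) * z (k + 1) * top_sum k - z (k + 2) * top_sum (Suc k))"
    by (simp add: algebra_simps)
  finally show ?thesis by simp
qed

lemma short_row_0: "short_row 0"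
  by (auto simp: short_row_def)

lemma short_row_1:
  assumes "z 1 * top_sum 0 \<sim> top_coeff 0"
  shows "short_row 1"
proof (cases "n = 0")
  case True
  then show ?thesis unfolding short_row_def by simp
next
  case False
  have "fps_nth (hrow (Suc 0)) (n - 1) = top_coeff 0 - z 1 * top_sum 0"
    unfolding toda_fps_mult_nth by simp
  moreover have "top_coeff 0 - z 1 * top_sum 0 \<sim> 0"
    using eqv_diff[OF eqv_refl[of "top_coeff 0"] assms] by simp
  moreover have "m = n - 1" if "n - 1 \<le> m" "m < n" for m using that by simp
  ultimately show ?thesis
    unfolding short_row_def by (metis One_nat_def)
qed

text \<open>Given short rows $k$ and $k+1$, row $k+2$ is short if and only if $A_{k+1}=Q_{k+1}z_{k+1}A_k$ and
$z_{k+2}B_{k+1}=Q_{k+1}z_{k+1}B_k$: the first equation makes the coefficient of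
$t^{n-2-k}$ in $N_{k+2}$ agree with the common value of the higher ones, and the second makes this value $0$.
This lemma and \<open>short_row_relations\<close> are the two directions.\<close>

lemma short_row_step:
  assumes "short_row k" "short_row (Suc k)" "Suc k < n"
    and "top_coeff (Suc k) \<sim> Q (k + 1) * z (k + 1) * top_coeff k"
    and "z (k + 2) * top_sum (Suc k) \<sim> Q (k + 1) * z (k + 1) * top_sum k"
  shows "short_row (Suc (Suc k))"
  unfolding short_row_def
proof (intro allI impI)
  fix m assume m: "n - Suc (Suc k) \<le> m" "m < n"
  have z: "Q (k + 1) * z (k + 1) * top_sum k - z (k + 2) * top_sum (Suc k) \<sim> 0"
    using eqv_diff[OF eqv_refl assms(5), of "Q (k + 1) * z (k + 1) * top_sum k"] by simp
  show "fps_nth (hrow (Suc (Suc k))) m \<sim> 0"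
  proof (cases "m = n - 2 - k")
    case True
    have "top_coeff (Suc k) - Q (k + 1) * z (k + 1) * top_coeff k \<sim> 0"
      using eqv_diff[OF assms(4) eqv_refl, of "Q (k + 1) * z (k + 1) * top_coeff k"] by simp
    from eqv_trans[OF recurrence_at_top[OF assms(1-3)] eqv_add[OF this z]]
    show ?thesis using True by simp
  next
    case False
    then show ?thesis
      using eqv_trans[OF recurrence_above_top[OF assms(1,2), of m] z] m by simp
  qed
qed

lemma short_row_first_relation:
  assumes "short_row 1" "0 < n"
  shows "z 1 * top_sum 0 \<sim> top_coeff 0"
proof -
  have "fps_nth (hrow (Suc 0)) (n - 1) = top_coeff 0 - z 1 * top_sum 0"
    unfolding toda_fps_mult_nth by simp
  moreover have "fps_nth (hrow (Suc 0)) (n - 1) \<sim> 0"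
    using assms by (auto simp: short_row_def)
  ultimately have "top_coeff 0 - z 1 * top_sum 0 \<sim> 0" by simp
  then have "top_coeff 0 \<sim> z 1 * top_sum 0" by (simp only: eqv_diff_0_iff)
  then show ?thesis by (rule eqv_sym)
qed

lemma short_row_relations:
  assumes "short_row k" "short_row (Suc k)" "short_row (Suc (Suc k))" "Suc k < n"
  shows "z (k + 2) * top_sum (Suc k) \<sim> Q (k + 1) * z (k + 1) * top_sum k"
    and "top_coeff (Suc k) \<sim> Q (k + 1) * z (k + 1) * top_coeff k"
proof -
  let ?b = "Q (k + 1) * z (k + 1) * top_sum k - z (k + 2) * top_sum (Suc k)"
  have "fps_nth (hrow (Suc (Suc k))) (n - 1 - k) \<sim> 0" "fps_nth (hrow (Suc (Suc k))) (n - 2 - k) \<sim> 0"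
    using assms by (auto simp: short_row_def)
  moreover have "n - 1 - k < n" using assms(4) by simp
  ultimately have b: "?b \<sim> 0" and a: "(top_coeff (Suc k) - Q (k + 1) * z (k + 1) * top_coeff k) + ?b \<sim> 0"
    using eqv_trans[OF eqv_sym[OF recurrence_above_top[OF assms(1,2) order_refl]]]
      eqv_trans[OF eqv_sym[OF recurrence_at_top[OF assms(1,2,4)]]] by blast+
  show "z (k + 2) * top_sum (Suc k) \<sim> Q (k + 1) * z (k + 1) * top_sum k"
    by (rule eqv_sym) (use b in \<open>simp only: eqv_diff_0_iff\<close>)
  have "(top_coeff (Suc k) - Q (k + 1) * z (k + 1) * top_coeff k) + ?b - ?b \<sim> 0 - 0"
    by (rule eqv_diff[OF a b])
  then show "top_coeff (Suc k) \<sim> Q (k + 1) * z (k + 1) * top_coeff k"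
    by (simp add: eqv_def)
qed

text \<open>The recurrence read backwards: where $N_{k+1}$ and $N_{k+2}$ vanish, the partial sums of $N_k$ are constant.\<close>

lemma short_row_descend:
  assumes "short_row (Suc k)" "short_row (Suc (Suc k))" "unit (Q (k + 1) * z (k + 1))" "Suc k < n"
  shows "short_row k"
proof -
  let ?q = "Q (k + 1) * z (k + 1)"
  have c: "?q * fps_nth (hrow k * geo) m \<sim> z (k + 2) * top_sum (Suc k)" if m: "n - 1 - k \<le> m" "m < n" for m
  proof -
    have "?q * fps_nth (hrow k * geo) m = fps_nth (hrow (Suc (Suc k))) m - fps_nth (hrow (Suc k)) m
        + z (k + 2) * fps_nth (hrow (Suc k) * geo) m"
      unfolding toda_fps_mult_nth by (simp add: algebra_simps)
    also have "\<dots> \<sim> 0 - 0 + z (k + 2) * top_sum (Suc k)"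
      using assms m by (intro eqv_add eqv_diff eqv_mult_left partial_sums_stationary)
         (auto simp: short_row_def)
    finally show ?thesis by simp
  qed
  show ?thesis unfolding short_row_def
  proof (intro allI impI)
    fix m assume m: "n - k \<le> m" "m < n"
    show "fps_nth (hrow k) m \<sim> 0"
    proof (cases m)
      case 0
      then show ?thesis using m assms(4) by simp
    next
      case (Suc l)
      have "?q * fps_nth (hrow k) m = ?q * fps_nth (hrow k * geo) m - ?q * fps_nth (hrow k * geo) l"
        by (simp only: Suc mult_geo_nth_Suc) (simp add: algebra_simps)
      also have "\<dots> \<sim> z (k + 2) * top_sum (Suc k) - z (k + 2) * top_sum (Suc k)"
        using m Suc by (intro eqv_diff c) auto
      finally have "?q * fps_nth (hrow k) m \<sim> ?q * 0" by simp
      then show ?thesis by (rule eqv_cancel[OF assms(3)])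
    qed
  qed
qed

end

end

section \<open>From a solution to a generating series\<close>

lemma fps_monic_inverse:
  fixes W :: "'a::comm_ring_1 fps"
  assumes "fps_nth W 0 = 1"
  obtains V where "V * W = 1" "fps_nth V 0 = 1"
proof
  show "fps_right_inverse W 1 * W = 1"
    using fps_right_inverse[of W 1] assms by (simp add: mult.commute)
  show "fps_nth (fps_right_inverse W 1) 0 = 1" by simp
qed

context ideal_cong
begin


context
  fixes n :: nat and z Q :: "nat \<Rightarrow> 'a"
  assumes n: "2 \<le> n" and Q_n: "Q n = 0"
    and unit_Q: "\<And>j. 1 \<le> j \<Longrightarrow> j < n \<Longrightarrow> unit (Q j)"
    and F: "\<And>i. 1 \<le> i \<Longrightarrow> i \<le> n \<Longrightarrow> toda_F z Q n i \<sim> of_nat (n choose i)"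
begin

lemma prod_z_eqv_1: "(\<Prod>j=1..n. z j) \<sim> 1"
  using F[of n] n by (simp add: toda_F_top[of Q n, OF Q_n])

lemma unit_z: "1 \<le> j \<Longrightarrow> j \<le> n \<Longrightarrow> unit (z j)"
  using unit_cong[OF prod_z_eqv_1 unit_1] by (simp add: unit_prod_iff)

lemma toda_F_0: "toda_F z Q n 0 = 1"
proof -
  have "{I. I \<subseteq> {1..n} \<and> card I = 0} = {{}}" by (auto simp: finite_subset)
  then show ?thesis by (simp add: toda_F_def)
qed

text \<open>The relations $F_i=\binom ni$ say that $S_n(u)=(1-u)^n$, and $1-u=-t/(1-t)$ is divisible by $t$.\<close>

lemma toda_fps_top_eqv_0:
  assumes "k < n"
  shows "fps_nth (toda_fps z Q n) k \<sim> 0"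
proof -
  have "fps_nth (toda_fps z Q n) k = (\<Sum>i\<le>n. toda_F z Q n i * fps_nth ((- geo) ^ i) k)"
    by (simp add: toda_fps_eq_sum_toda_F[of Q n, OF Q_n] fps_sum_nth)
  also have "\<dots> \<sim> (\<Sum>i\<le>n. of_nat (n choose i) * fps_nth ((- geo) ^ i) k)"
  proof (intro eqv_sum eqv_mult eqv_refl)
    fix i assume "i \<in> {..n}"
    then show "toda_F z Q n i \<sim> of_nat (n choose i)"
      using F[of i] by (cases "i = 0") (auto simp: toda_F_0)
  qed
  also have "\<dots> = fps_nth (\<Sum>i\<le>n. of_nat (n choose i) * (- geo) ^ i * 1 ^ (n - i)) k"
    by (simp add: fps_sum_nth fps_of_nat[symmetric] del: fps_of_nat)
  also have "(\<Sum>i\<le>n. of_nat (n choose i) * (- geo) ^ i * 1 ^ (n - i)) = (- geo + 1 :: 'a fps) ^ n"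
    by (rule binomial_ring[symmetric])
  also have "(- geo + 1) ^ n = (-1) ^ n * (geo - 1 :: 'a fps) ^ n"
    by (simp flip: power_mult_distrib)
  also have "fps_nth \<dots> k = 0"
    using assms geo_minus_1_power_nth(1)[of k n, where 'a = 'a]
    by (cases "even n") simp_all
  finally show ?thesis .
qed

text \<open>At $t=0$, that is at $u=1$, the recurrence read backwards expresses every $S_k(1)$ as a multiple of
$S_{n-1}(1)$, because $S_n(1)=0$ and the $Q_kz_k$ are units.  In particular $S_0=1$ is such a multiple.\<close>

lemma unit_toda_poly_at_1: "unit (toda_poly z Q 1 (n - 1))"
proof -
  let ?s = "toda_poly z Q 1"
  have s: "?s k = fps_nth (toda_fps z Q k) 0" for k
  proof -
    have "comm_ring_hom (\<lambda>f::'a fps. fps_nth f 0)" by standard simp_all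
    from toda_poly_hom[OF this, of "\<lambda>j. fps_const (z j)" "\<lambda>j. fps_const (Q j)" geo k]
    show ?thesis by (simp add: toda_fps_def)
  qed
  \<comment> \<open>The induction runs downwards from the index $n-1$, and reaches $0$ for $k=n-1$.\<close>
  have "\<exists>y. ?s (n - 1 - k) \<sim> y * ?s (n - 1)" if "k \<le> n - 1" for k
    using that
  proof (induction k rule: less_induct)
    case (less k)
    show ?case
    proof (cases "k = 0")
      case True
      then show ?thesis by (auto intro: exI[of _ 1])
    next
      case False
      define l where "l = n - 1 - k"
      have l: "n - 1 - (k - 1) = Suc l" "Suc l < n"
        using False less.prems n by (auto simp: l_def)
      have "k - 1 < k" "k - 1 \<le> n - 1" using False less.prems by auto
      from less.IH[OF this] obtain y1 where y1: "?s (Suc l) \<sim> y1 * ?s (n - 1)"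
        unfolding l(1) by blast
      have "\<exists>y2. ?s (Suc (Suc l)) \<sim> y2 * ?s (n - 1)"
      proof (cases "Suc (Suc l) = n")
        case True
        then show ?thesis using toda_fps_top_eqv_0[of 0] n s by (intro exI[of _ 0]) simp
      next
        case False
        then have "n - 1 - (k - 2) = Suc (Suc l)"
          using l less.prems by (auto simp: l_def)
        moreover have "k - 2 < k" "k - 2 \<le> n - 1"
          using \<open>k \<noteq> 0\<close> less.prems by auto
        ultimately show ?thesis using less.IH[of "k - 2"] by metis
      qed
      then obtain y2 where y2: "?s (Suc (Suc l)) \<sim> y2 * ?s (n - 1)" by blast
      have "unit (Q (l + 1) * z (l + 1))"
        using unit_Q unit_z l by (simp add: unit_mult_iff)
      then obtain q where q: "Q (l + 1) * z (l + 1) * q \<sim> 1" by (auto simp: unit_def)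
      have "?s l = 1 * ?s l" by simp
      also have "\<dots> \<sim> Q (l + 1) * z (l + 1) * q * ?s l"
        by (rule eqv_mult[OF eqv_sym[OF q] eqv_refl])
      also have "\<dots> = q * (?s (Suc (Suc l)) - (1 - z (l + 2)) * ?s (Suc l))"
        by (simp add: algebra_simps)
      also have "\<dots> \<sim> q * (y2 * ?s (n - 1) - (1 - z (l + 2)) * (y1 * ?s (n - 1)))"
        by (intro eqv_mult_left eqv_diff y1 y2)
      also have "\<dots> = q * (y2 - (1 - z (l + 2)) * y1) * ?s (n - 1)"
        by (simp add: algebra_simps)
      finally show ?thesis unfolding l_def by blast
    qed
  qed
  from this[of "n - 1"] obtain y where "1 \<sim> y * ?s (n - 1)" by auto
  then show ?thesis unfolding unit_def by (auto simp: mult.commute intro: eqv_sym)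
qed

text \<open>The generating series attached to a solution is the inverse of $S_{n-1}(u)$, normalised to have constant term
$1$.  With this choice row $n-1$ is a constant and row $n$ is zero modulo $t^n$, and the recurrence shows from the
top down that all rows are short.\<close>

lemma toda_solution_generating_series:
  obtains H where "fps_nth H 0 = 1" "\<And>k. k \<le> n \<Longrightarrow> short_row n z Q H k"
    "unit (fps_nth (H * toda_fps z Q (n - 1)) 0)"
proof -
  define T where "T = toda_fps z Q (n - 1)"
  have T0: "fps_nth T 0 = toda_poly z Q 1 (n - 1)"
  proof -
    have "comm_ring_hom (\<lambda>f::'a fps. fps_nth f 0)" by standard simp_all
    from toda_poly_hom[OF this, of "\<lambda>j. fps_const (z j)" "\<lambda>j. fps_const (Q j)" geo "n - 1"]
    show ?thesis by (simp add: T_def toda_fps_def)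
  qed
  obtain s where s: "fps_nth T 0 * s \<sim> 1"
    using unit_toda_poly_at_1 by (auto simp: unit_def T0)
  \<comment> \<open>The constant term $s\,T_0$ is only congruent to $1$; it is replaced by $1$ so that the inverse exists exactly.\<close>
  define W where "W = Abs_fps (\<lambda>k. if k = 0 then 1 else s * fps_nth T k)"
  have W: "fps_nth W k \<sim> s * fps_nth T k" for k
    using eqv_sym[OF s] by (simp add: W_def mult.commute)
  obtain H where H: "H * W = 1" "fps_nth H 0 = 1"
    using fps_monic_inverse[of W] by (auto simp: W_def)
  have "short_row n z Q H n"
    unfolding short_row_def
  proof (intro allI impI)
    fix m assume m: "m < n"
    have "fps_nth (H * toda_fps z Q n) m \<sim> fps_nth (H * 0) m"
      by (rule eqv_fps_mult[where n = n]) (use m toda_fps_top_eqv_0 in auto)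
    then show "fps_nth (H * toda_fps z Q n) m \<sim> 0" by simp
  qed
  moreover have "short_row n z Q H (n - 1)"
    unfolding short_row_def
  proof (intro allI impI)
    fix m assume m: "n - (n - 1) \<le> m" "m < n"
    have T': "fps_nth T k \<sim> fps_nth (fps_const (fps_nth T 0) * W) k" for k
    proof -
      have "fps_nth T k = 1 * fps_nth T k" by simp
      also have "\<dots> \<sim> fps_nth T 0 * s * fps_nth T k"
        by (rule eqv_mult[OF eqv_sym[OF s] eqv_refl])
      also have "\<dots> \<sim> fps_nth T 0 * fps_nth W k"
        unfolding mult.assoc by (rule eqv_mult_left[OF eqv_sym[OF W]])
      finally show ?thesis by simp
    qed
    have "fps_nth (H * T) m \<sim> fps_nth (H * (fps_const (fps_nth T 0) * W)) m"
      by (rule eqv_fps_mult[where n = n]) (use m T' in auto)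
    also have "H * (fps_const (fps_nth T 0) * W) = fps_const (fps_nth T 0) * (H * W)"
      by (simp add: mult_ac)
    also have "fps_nth \<dots> m = 0" using m n by (simp add: H)
    finally show "fps_nth (H * toda_fps z Q (n - 1)) m \<sim> 0" by (simp add: T_def)
  qed
  moreover have desc: "short_row n z Q H k \<and> short_row n z Q H (Suc k)"
    if "k \<le> n - 1" "short_row n z Q H n" "short_row n z Q H (n - 1)" for k
    using that(1)
  proof (induction k rule: inc_induct)
    case base
    then show ?case using that n by simp
  next
    case (step k)
    then show ?case
      using short_row_descend[of n z Q H k] unit_Q[of "k + 1"] unit_z[of "k + 1"]
      by (auto simp: unit_mult_iff)
  qed
  ultimately have "short_row n z Q H k" if "k \<le> n" for k
    using desc[of k] that by (cases "k = n") auto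
  moreover have "unit (fps_nth (H * toda_fps z Q (n - 1)) 0)"
    using unit_toda_poly_at_1 H(2) T0 by (simp add: T_def)
  ultimately show ?thesis using that H by blast
qed

text \<open>The determinants of the generating series recover the solution: from $\tau_i\prod_{k<i}Z_k=\prod_{k<i}A_k$ with
$Z_k=z_1\cdots z_k$, from $B_kZ_{k+1}=A_k$ and from $A_k=Q_kz_kA_{k-1}$ follow $\sigma_iZ_i=\tau_i$ and
$\tau_{i+1}Z_i=A_i\tau_i$, and these give the formulas for $z_i$ and $Q_i$.  All $A_k$ are units since they
divide the constant $A_{n-1}$, so that $\tau_i$ and $\sigma_i$ are units too.\<close>

theorem toda_solution_determinants:
  obtains H where "fps_nth H 0 = 1"
    "\<And>i. i \<le> n \<Longrightarrow> unit (tau_det H (n - i) i)" "\<And>i. i \<le> n \<Longrightarrow> unit (sigma_det H (n - i) i)"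
    "\<And>i. 1 \<le> i \<Longrightarrow> i \<le> n \<Longrightarrow> z i * (sigma_det H (n - i) i * tau_det H (n - (i - 1)) (i - 1)) \<sim>
       tau_det H (n - i) i * sigma_det H (n - (i - 1)) (i - 1)"
    "\<And>i. 1 \<le> i \<Longrightarrow> i < n \<Longrightarrow> Q i * (tau_det H (n - i) i)\<^sup>2 \<sim>
       tau_det H (n - (i - 1)) (i - 1) * tau_det H (n - (i + 1)) (i + 1)"
    "short_row n z Q H (n - 1)" "unit (fps_nth (H * toda_fps z Q (n - 1)) 0)"
proof -
  obtain H where H0: "fps_nth H 0 = 1" and short: "\<And>k. k \<le> n \<Longrightarrow> short_row n z Q H k"
    and unit_last: "unit (fps_nth (H * toda_fps z Q (n - 1)) 0)"
    using toda_solution_generating_series by blast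
  define A where "A = (\<lambda>k. fps_nth (H * toda_fps z Q k) (n - 1 - k))"
  define B where "B = (\<lambda>k. fps_nth (H * toda_fps z Q k * geo) (n - 1 - k))"
  define t where "t = (\<lambda>i. tau_det H (n - i) i)"
  define s where "s = (\<lambda>i. sigma_det H (n - i) i)"
  define Z where "Z = (\<lambda>k. \<Prod>j=1..k. z j)"
  have Z_Suc: "Z (Suc k) = Z k * z (Suc k)" for k by (simp add: Z_def)
  have unit_Z: "unit (Z k)" if "k \<le> n" for k
    using that by (auto simp: Z_def unit_prod_iff intro: unit_z)
  have A_Suc: "A (Suc k) \<sim> Q (Suc k) * z (Suc k) * A k"
    and B_Suc: "z (k + 2) * B (Suc k) \<sim> Q (Suc k) * z (Suc k) * B k" if "Suc k < n" for k
    using short_row_relations[of n z Q H k] that short by (simp_all add: A_def B_def)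
  have unit_A: "unit (A k)" if "k \<le> n - 1" for k
    using that
  proof (induction k rule: inc_induct)
    case base
    then show ?case using unit_last by (simp add: A_def)
  next
    case (step k)
    then have "unit (Q (Suc k) * z (Suc k) * A k)"
      using unit_cong[OF eqv_sym[OF A_Suc]] by auto
    then show ?case by (simp add: unit_mult_iff)
  qed
  have B_Z: "B k * Z (Suc k) \<sim> A k" if "k < n" for k
    using that
  proof (induction k)
    case 0
    then show ?case
      using short_row_first_relation[of n z Q H] short[of 1] by (simp add: A_def B_def Z_def mult.commute)
  next
    case (Suc k)
    have "B (Suc k) * Z (Suc (Suc k)) = Z (Suc k) * (z (k + 2) * B (Suc k))"
      by (simp add: Z_Suc mult_ac)
    also have "\<dots> \<sim> Z (Suc k) * (Q (Suc k) * z (Suc k) * B k)"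
      using Suc.prems by (intro eqv_mult_left B_Suc)
    also have "\<dots> = Q (Suc k) * z (Suc k) * (B k * Z (Suc k))"
      by (simp add: mult_ac)
    also have "\<dots> \<sim> Q (Suc k) * z (Suc k) * A k"
      using Suc by (intro eqv_mult_left) auto
    also have "\<dots> \<sim> A (Suc k)" using Suc.prems by (intro eqv_sym[OF A_Suc])
    finally show ?case .
  qed
  have t: "(\<Prod>k<i. Z k) * t i \<sim> (\<Prod>k<i. A k)" if "i \<le> n" for i
    using tau_det_eqv[of i n z Q H] that short by (simp add: t_def A_def Z_def)
  have unit_ZZ: "unit (\<Prod>k<i. Z k)" if "i \<le> n" for i
    using that unit_Z by (simp add: unit_prod_iff)
  have unit_t: "unit (t i)" if "i \<le> n" for i
  proof -
    have "unit (\<Prod>k<i. A k)" using that unit_A by (simp add: unit_prod_iff)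
    from unit_cong[OF t[OF that] this] show ?thesis by (simp add: unit_mult_iff)
  qed
  have s: "s i * Z i \<sim> t i" if "i \<le> n" for i
  proof (cases i)
    case 0
    then show ?thesis by (simp add: s_def t_def Z_def sigma_det_def tau_det_def)
  next
    case (Suc l)
    have "(\<Prod>k<i. Z k) * (s i * Z i) = ((\<Prod>k<Suc l. Z k) * s (Suc l)) * Z i"
      using Suc by (simp add: mult_ac)
    also have "\<dots> \<sim> (B l * (\<Prod>k<l. A k)) * Z i"
      by (rule eqv_mult[OF _ eqv_refl])
         (use sigma_det_eqv[of l n z Q H] that Suc short in \<open>simp add: s_def A_def B_def Z_def\<close>)
    also have "\<dots> = (B l * Z (Suc l)) * (\<Prod>k<l. A k)"
      using Suc by (simp add: mult_ac)
    also have "\<dots> \<sim> A l * (\<Prod>k<l. A k)"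
      using that Suc by (intro eqv_mult eqv_refl B_Z) auto
    also have "\<dots> = (\<Prod>k<i. A k)"
      using Suc by (simp add: mult_ac)
    also have "\<dots> \<sim> (\<Prod>k<i. Z k) * t i"
      by (rule eqv_sym[OF t[OF that]])
    finally show ?thesis by (rule eqv_cancel[OF unit_ZZ[OF that]])
  qed
  have unit_s: "unit (s i)" if "i \<le> n" for i
    using unit_cong[OF s[OF that] unit_t[OF that]] by (simp add: unit_mult_iff)
  have t_Suc: "t (Suc i) * Z i \<sim> A i * t i" if "i < n" for i
  proof -
    have "(\<Prod>k<i. Z k) * (t (Suc i) * Z i) = (\<Prod>k<Suc i. Z k) * t (Suc i)"
      by (simp add: mult_ac)
    also have "\<dots> \<sim> (\<Prod>k<Suc i. A k)" using that by (intro t) auto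
    also have "\<dots> = A i * (\<Prod>k<i. A k)" by (simp add: mult_ac)
    also have "\<dots> \<sim> A i * ((\<Prod>k<i. Z k) * t i)"
      using that by (intro eqv_mult_left eqv_sym[OF t]) auto
    also have "\<dots> = (\<Prod>k<i. Z k) * (A i * t i)" by (simp add: mult_ac)
    finally have e: "(\<Prod>k<i. Z k) * (t (Suc i) * Z i) \<sim> (\<Prod>k<i. Z k) * (A i * t i)" .
    show ?thesis by (rule eqv_cancel[OF unit_ZZ e]) (use that in simp)
  qed
  show ?thesis
  proof
    show "fps_nth H 0 = 1" by (rule H0)
    show "short_row n z Q H (n - 1)" using short by simp
    show "unit (fps_nth (H * toda_fps z Q (n - 1)) 0)" by (rule unit_last)
    show "unit (tau_det H (n - i) i)" "unit (sigma_det H (n - i) i)" if "i \<le> n" for i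
      using unit_t[OF that] unit_s[OF that] by (simp_all add: t_def s_def)
  next
    fix i assume i: "1 \<le> i" "i \<le> n"
    then obtain l where l: "i = Suc l" by (cases i) auto
    have "z i * (s i * t l) \<sim> z i * (s i * (s l * Z l))"
      using i l by (intro eqv_mult_left eqv_sym[OF s]) auto
    also have "\<dots> = s i * Z i * s l" by (simp add: l Z_Suc mult_ac)
    also have "\<dots> \<sim> t i * s l" using i by (intro eqv_mult eqv_refl s) auto
    finally show "z i * (sigma_det H (n - i) i * tau_det H (n - (i - 1)) (i - 1)) \<sim>
       tau_det H (n - i) i * sigma_det H (n - (i - 1)) (i - 1)"
      by (simp add: s_def t_def l)
  next
    fix i assume i: "1 \<le> i" "i < n"
    then obtain l where l: "i = Suc l" by (cases i) auto
    have "Z i * A l * (Q i * (t i)\<^sup>2) = (Q i * z i * A l) * t i * (t i * Z l)"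
      by (simp add: l Z_Suc power2_eq_square mult_ac)
    also have "\<dots> \<sim> A i * t i * (A l * t l)"
    proof (rule eqv_mult[OF eqv_mult[OF _ eqv_refl]])
      show "Q i * z i * A l \<sim> A i" using eqv_sym[OF A_Suc[of l]] i l by simp
      show "t i * Z l \<sim> A l * t l" using t_Suc[of l] i l by simp
    qed
    also have "\<dots> \<sim> t (Suc i) * Z i * (A l * t l)"
      by (rule eqv_mult[OF eqv_sym[OF t_Suc] eqv_refl]) (use i in simp)
    also have "\<dots> = Z i * A l * (t l * t (Suc i))" by (simp add: mult_ac)
    finally have e: "Z i * A l * (Q i * (t i)\<^sup>2) \<sim> Z i * A l * (t l * t (Suc i))" .
    have "unit (Z i * A l)" using i l unit_Z[of i] unit_A[of l] by (simp add: unit_mult_iff)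
    from eqv_cancel[OF this e] have "Q i * (t i)\<^sup>2 \<sim> t l * t (Suc i)" .
    then show "Q i * (tau_det H (n - i) i)\<^sup>2 \<sim>
       tau_det H (n - (i - 1)) (i - 1) * tau_det H (n - (i + 1)) (i + 1)"
      by (simp add: t_def l)
  qed
qed

end

end

section \<open>From a generating series to a solution\<close>

lemma ideal_cong_zero: "ideal_cong {0}"
  by standard auto

lemma eqv_iff_eq: "ideal_cong.eqv {0} x y \<longleftrightarrow> x = y"
  using ideal_cong.eqv_def[OF ideal_cong_zero, of x y] by simp

lemma comm_ring_hom_pcompose: "comm_ring_hom (\<lambda>p. pcompose p q)"
  by standard (simp_all add: pcompose_add pcompose_mult)

lemma comm_ring_hom_const_poly: "comm_ring_hom (\<lambda>c. [:c:])"
  by standard simp_all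

lemma const_mult_minus_X_power: "[:c::'a::comm_ring_1:] * (- [:0, 1:]) ^ k = monom ((-1) ^ k * c) k"
proof -
  have "- [:0, 1:] = monom (- 1 :: 'a::comm_ring_1) 1" by (simp add: monom_altdef)
  then have "[:c:] * (- [:0, 1:]) ^ k = monom c 0 * monom (- 1) 1 ^ k"
    by (simp only: monom_0)
  then show ?thesis by (simp add: monom_power mult_monom mult.commute)
qed

text \<open>If $S_n=(1-u)^n$ as polynomials, comparing the coefficients of $u^i$ gives the relations.\<close>

lemma toda_F_of_monomial_toda_pol:
  fixes z Q :: "nat \<Rightarrow> 'a::{comm_ring_1}"
  assumes Q: "Q n = 0" and mon: "toda_pol z Q n = monom ((-1) ^ n) n" and i: "i \<le> n"
  shows "toda_F z Q n i = of_nat (n choose i)"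
proof -
  let ?x = "[:0, 1:] :: 'a poly"
  let ?s = "\<lambda>p. pcompose p [:-1, 1:] :: 'a poly"
  interpret pc: comm_ring_hom ?s by (rule comm_ring_hom_pcompose)
  have "(\<Sum>k\<le>n. [:toda_F z Q n k:] * (- ?x) ^ k) = toda_poly (\<lambda>j. [:z j:]) (\<lambda>j. [:Q j:]) ?x n"
    using toda_poly_eq_sum_toda_F[of "\<lambda>j. [:Q j:]" n "\<lambda>j. [:z j:]" ?x] Q
    by (simp only: toda_F_hom[OF comm_ring_hom_const_poly]) simp
  also have "\<dots> = ?s (toda_pol z Q n)"
    unfolding toda_pol_def toda_poly_hom[OF comm_ring_hom_pcompose] by (simp add: pcompose_pCons)
  also have "toda_pol z Q n = (- ?x) ^ n"
    unfolding mon using const_mult_minus_X_power[of 1 n, symmetric]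
    by (simp only: one_pCons[symmetric] mult_1 mult_1_right)
  also have "?s ((- ?x) ^ n) = (- ?x + 1) ^ n"
    by (simp add: hom_distribs pcompose_uminus pcompose_pCons one_pCons)
  also have "\<dots> = (\<Sum>k\<le>n. [:of_nat (n choose k):] * (- ?x) ^ k)"
    unfolding binomial_ring by (simp add: of_nat_poly)
  finally have e: "(\<Sum>k\<le>n. [:toda_F z Q n k:] * (- ?x) ^ k) = (\<Sum>k\<le>n. [:of_nat (n choose k):] * (- ?x) ^ k)" .
  have c: "coeff (\<Sum>k\<le>n. [:f k:] * (- ?x) ^ k) i = (-1) ^ i * f i" for f :: "nat \<Rightarrow> 'a"
    using i by (simp only: const_mult_minus_X_power) (simp add: coeff_sum)
  have "(-1) ^ i * toda_F z Q n i = (-1) ^ i * of_nat (n choose i)"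
    using arg_cong[OF e, of "\<lambda>p. coeff p i"] by (simp only: c)
  then show ?thesis by (simp add: minus_one_power_iff split: if_splits)
qed

text \<open>As $(u-1)^a$ begins with $t^a$, a polynomial in $u-1$ that vanishes modulo $t^n$ has no terms of degree less
than $n$.\<close>

lemma toda_pol_monomial:
  fixes z Q :: "nat \<Rightarrow> 'a::comm_ring_1"
  assumes "\<And>m. m < n \<Longrightarrow> fps_nth (toda_fps z Q n) m = 0"
  shows "toda_pol z Q n = monom ((-1) ^ n * (\<Prod>j=1..n. z j)) n"
proof -
  let ?c = "coeff (toda_pol z Q n)"
  have "?c a = 0" if "a < n" for a
    using that
  proof (induction a rule: less_induct)
    case (less a)
    have "0 = (\<Sum>b\<le>n. ?c b * fps_nth ((geo - 1) ^ b) a)"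
      using assms[OF less.prems] unfolding toda_fps_expansion by (simp add: fps_sum_nth)
    also have "\<dots> = (\<Sum>b\<in>{a}. ?c b * fps_nth ((geo - 1) ^ b) a)"
    proof (intro sum.mono_neutral_right ballI)
      fix b assume "b \<in> {..n} - {a}"
      then consider "b < a" | "a < b" by fastforce
      then show "?c b * fps_nth ((geo - 1) ^ b) a = 0"
        by cases (use less in \<open>auto simp: geo_minus_1_power_nth\<close>)
    qed (use less.prems in auto)
    finally show ?case by (simp add: geo_minus_1_power_nth)
  qed
  moreover have "?c a = 0" if "n < a" for a
    using degree_toda_pol[of z Q n] that by (simp add: coeff_eq_0)
  ultimately show ?thesis
    by (intro poly_eqI) (auto simp: coeff_toda_pol linorder_neq_iff)
qed

text \<open>The converse construction over a field: $z_i$ and $Q_i$ are defined from $H$ by the formulas of the theorem.\<close>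

context
  fixes H :: "'a::field fps" and n :: nat and t s z Q :: "nat \<Rightarrow> 'a"
  defines "t \<equiv> \<lambda>i. tau_det H (n - i) i" and "s \<equiv> \<lambda>i. sigma_det H (n - i) i"
  assumes n: "2 \<le> n" and H0: "fps_nth H 0 = 1"
    and t_nz: "\<And>i. i \<le> n \<Longrightarrow> t i \<noteq> 0" and s_nz: "\<And>i. i \<le> n \<Longrightarrow> s i \<noteq> 0"
    and z: "\<And>i. 1 \<le> i \<Longrightarrow> i \<le> n \<Longrightarrow> z i = t i * s (i - 1) / (s i * t (i - 1))"
    and Q: "\<And>i. 1 \<le> i \<Longrightarrow> i < n \<Longrightarrow> Q i = t (i - 1) * t (i + 1) / (t i)\<^sup>2" and Q_n: "Q n = 0"
begin

interpretation ideal_cong "{0 :: 'a}" by (rule ideal_cong_zero)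

lemma prod_z: "k \<le> n \<Longrightarrow> (\<Prod>j=1..k. z j) = t k / s k"
proof (induction k)
  case 0
  then show ?case by (simp add: t_def s_def tau_det_def sigma_det_def)
next
  case (Suc k)
  then show ?case using t_nz[of k] s_nz[of k] by (simp add: z)
qed

text \<open>By induction on $k$.  If all rows before row $k$ are short, then $\tau_i$ and $\sigma_i$ for $i\le k$ are known in
terms of the $A_l$ and $B_l$ with $l<k$; solving for these and inserting the definition of $z_k$ and
$Q_{k-1}$ verifies the two equations that make row $k$ short.\<close>

lemma all_rows_short: "k \<le> n \<Longrightarrow> short_row n z Q H k"
proof (induction k rule: less_induct)
  case (less k)
  define A where "A = (\<lambda>k. fps_nth (H * toda_fps z Q k) (n - 1 - k))"
  define B where "B = (\<lambda>k. fps_nth (H * toda_fps z Q k * geo) (n - 1 - k))"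
  let ?Z = "\<lambda>i. t i / s i"
  let ?P = "\<lambda>i. \<Prod>l<i. \<Prod>j=1..l. z j"
  have P_nz: "?P i \<noteq> 0" if "i \<le> n" for i
  proof -
    have "?P i = (\<Prod>l<i. ?Z l)" using that by (intro prod.cong prod_z refl) auto
    then show ?thesis using that t_nz s_nz by simp
  qed
  have T: "?P i * t i = (\<Prod>l<i. A l)" if "i \<le> k" for i
    using tau_det_eqv[of i n z Q H] less that by (simp add: eqv_iff_eq A_def t_def)
  have A: "A i = ?Z i * t (Suc i) / t i" if "i < k" for i
  proof -
    have "?P i * (t i * A i) = (\<Prod>l<Suc i. A l)"
      using T[of i] that by (simp flip: mult.assoc)
    also have "\<dots> = ?P (Suc i) * t (Suc i)" by (rule T[symmetric]) (use that in simp)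
    also have "\<dots> = ?P i * (?Z i * t (Suc i))"
      using prod_z[of i] that less.prems by (simp add: mult.assoc)
    finally have "t i * A i = ?Z i * t (Suc i)"
      using mult_left_cancel[OF P_nz[of i]] that less.prems by (metis less_imp_le order_less_le_trans)
    then show ?thesis
      using nonzero_mult_div_cancel_left[OF t_nz[of i]] that less.prems
      by (metis less_imp_le order_less_le_trans)
  qed
  have B: "B i = ?Z i * s (Suc i) / t i" if "i < k" for i
  proof -
    have "?P (Suc i) * s (Suc i) = B i * (\<Prod>l<i. A l)"
      using sigma_det_eqv[of i n z Q H] less that by (simp add: eqv_iff_eq A_def B_def s_def)
    moreover have "?P i * (t i * B i) = B i * (\<Prod>l<i. A l)"
      using T[of i] that by (simp flip: mult.assoc)
    moreover have "?P (Suc i) * s (Suc i) = ?P i * (?Z i * s (Suc i))"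
      using prod_z[of i] that less.prems by (simp add: mult.assoc)
    ultimately have "?P i * (t i * B i) = ?P i * (?Z i * s (Suc i))" by (simp only:)
    then have "t i * B i = ?Z i * s (Suc i)"
      using mult_left_cancel[OF P_nz[of i]] that less.prems by (metis less_imp_le order_less_le_trans)
    then show ?thesis
      using nonzero_mult_div_cancel_left[OF t_nz[of i]] that less.prems
      by (metis less_imp_le order_less_le_trans)
  qed
  have 0: "t 0 = 1" "s 0 = 1" by (simp_all add: t_def s_def tau_det_def sigma_det_def)
  consider "k = 0" | "k = 1" | l where "k = Suc (Suc l)"
    by (metis One_nat_def old.nat.exhaust)
  then show ?case
  proof cases
    case 1
    then show ?thesis by (simp add: short_row_0)
  next
    case 2
    have "z 1 * B 0 = A 0"
      using A[of 0] B[of 0] z[of 1] s_nz[of 1] 2 n 0 by simp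
    then show ?thesis using short_row_1[where z = z and H = H and n = n and Q = Q] 2 by (simp add: eqv_iff_eq A_def B_def)
  next
    case (3 l)
    have nz: "t l \<noteq> 0" "t (Suc l) \<noteq> 0" "t (Suc (Suc l)) \<noteq> 0" "s l \<noteq> 0" "s (Suc l) \<noteq> 0" "s (Suc (Suc l)) \<noteq> 0"
      using less.prems 3 t_nz s_nz by auto
    have vals: "A l = ?Z l * t (Suc l) / t l" "A (Suc l) = ?Z (Suc l) * t (Suc (Suc l)) / t (Suc l)"
      "B l = ?Z l * s (Suc l) / t l" "B (Suc l) = ?Z (Suc l) * s (Suc (Suc l)) / t (Suc l)"
      "z (Suc l) = t (Suc l) * s l / (s (Suc l) * t l)"
      "z (l + 2) = t (Suc (Suc l)) * s (Suc l) / (s (Suc (Suc l)) * t (Suc l))"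
      "Q (Suc l) = t l * t (Suc (Suc l)) / (t (Suc l))\<^sup>2"
      using A[of l] A[of "Suc l"] B[of l] B[of "Suc l"] z[of "Suc l"] z[of "l + 2"] Q[of "Suc l"] 3 less.prems
      by simp_all
    have "A (Suc l) = Q (Suc l) * z (Suc l) * A l" "z (l + 2) * B (Suc l) = Q (Suc l) * z (Suc l) * B l"
      unfolding vals using nz by (simp_all add: field_simps power2_eq_square)
    then show ?thesis
      using short_row_step[of n z Q H l] less 3 by (simp add: eqv_iff_eq A_def B_def)
  qed
qed

text \<open>Row $n$ is short, so it is zero modulo $t^n$, and so is $S_n(u)$ as $H$ is invertible.  This leaves only the top
term of $S_n$ as a polynomial in $u-1$, with coefficient $(-1)^nz_1\cdots z_n=(-1)^n$.\<close>

theorem toda_F_of_generating_series: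
  assumes "i \<le> n"
  shows "toda_F z Q n i = of_nat (n choose i)"
proof -
  obtain V where V: "V * H = 1" using fps_monic_inverse[OF H0] by blast
  have "fps_nth (toda_fps z Q n) m = 0" if "m < n" for m
  proof -
    have e: "V * (H * toda_fps z Q n) = toda_fps z Q n"
      by (simp add: V flip: mult.assoc)
    have "ideal_cong.eqv {0} (fps_nth (V * (H * toda_fps z Q n)) m) (fps_nth (V * 0) m)"
      by (rule eqv_fps_mult[where n = n]) (use all_rows_short[of n] that in \<open>auto simp: short_row_def\<close>)
    then show ?thesis unfolding e eqv_iff_eq by simp
  qed
  moreover have "(\<Prod>j=1..n. z j) = 1"
    using prod_z[of n] H0 by (simp add: t_def s_def tau_det_0 sigma_det_0)
  ultimately have "toda_pol z Q n = monom ((-1) ^ n) n"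
    using toda_pol_monomial[of n z Q] by simp
  then show ?thesis using Q_n assms by (intro toda_F_of_monomial_toda_pol)
qed

text \<open>Up to a scalar, $H$ is the inverse of $S_{n-1}(u)$ modulo $t^n$; so $H$ is determined by the $z_i$ and $Q_i$.\<close>

theorem generating_series_inverse:
  assumes "1 \<le> m" "m < n"
  shows "fps_nth (H * toda_fps z Q (n - 1)) m = 0"
  using all_rows_short[of "n - 1"] assms by (auto simp: short_row_def eqv_iff_eq)

end

section \<open>Summation over the partitions in a rectangle\<close>

lemma comm_ring_hom_map_fps:
  assumes "comm_ring_hom h"
  shows "comm_ring_hom (\<lambda>f. Abs_fps (\<lambda>k. h (fps_nth f k)))"
proof -
  interpret comm_ring_hom h by fact
  show ?thesis
    by standard (simp_all add: fps_eq_iff fps_mult_nth hom_distribs)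
qed

lemma fps_nth_geo_power_hom:
  assumes "comm_ring_hom h"
  shows "h (fps_nth (H * geo ^ c * (geo - 1) ^ a) k) =
    fps_nth (Abs_fps (\<lambda>k. h (fps_nth H k)) * geo ^ c * (geo - 1) ^ a) k"
proof -
  interpret comm_ring_hom h by fact
  interpret m: comm_ring_hom "\<lambda>f. Abs_fps (\<lambda>k. h (fps_nth f k))"
    by (rule comm_ring_hom_map_fps) fact
  let ?m = "\<lambda>f. Abs_fps (\<lambda>k. h (fps_nth f k))"
  have g: "?m geo = geo" by (simp add: geo_def)
  have "?m (H * geo ^ c * (geo - 1) ^ a) = ?m H * ?m geo ^ c * (?m geo - 1) ^ a"
    by (simp only: m.hom_mult m.hom_power m.hom_minus m.hom_one)
  then show ?thesis unfolding g fps_eq_iff by simp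
qed

lemma tau_det_hom:
  assumes "comm_ring_hom h"
  shows "h (tau_det H m i) = tau_det (Abs_fps (\<lambda>k. h (fps_nth H k))) m i"
  unfolding tau_det_def comm_ring_hom.hom_det[OF assms, symmetric]
  by (rule arg_cong[of _ _ det], rule eq_matI)
     (use fps_nth_geo_power_hom[OF assms, of H 0] in simp_all)

lemma sigma_det_hom:
  assumes "comm_ring_hom h"
  shows "h (sigma_det H m i) = sigma_det (Abs_fps (\<lambda>k. h (fps_nth H k))) m i"
  unfolding sigma_det_def comm_ring_hom.hom_det[OF assms, symmetric]
  by (rule arg_cong[of _ _ det], rule eq_matI)
     (use fps_nth_geo_power_hom[OF assms, of H 1] in simp_all)

text \<open>The determinant for $g_\nu$, where $\nu$ may have trailing zeros.\<close>

definition gdet :: "'a::comm_ring_1 fps \<Rightarrow> nat list \<Rightarrow> 'a" where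
  "gdet H \<nu> = det (mat (length \<nu>) (length \<nu>) (\<lambda>(a, b). fps_nth (H * (geo - 1) ^ a) (\<nu> ! a + b)))"

lemma det_last_row_last_entry:
  fixes M :: "'a::comm_ring_1 mat"
  assumes M: "M \<in> carrier_mat (Suc i) (Suc i)" and z: "\<And>b. b < i \<Longrightarrow> M $$ (i, b) = 0"
  shows "det M = M $$ (i, i) * det (mat i i (\<lambda>(k, b). M $$ (k, b)))"
proof -
  have "det M = (\<Sum>j<Suc i. M $$ (i, j) * cofactor M i j)"
    by (rule laplace_expansion_row[OF M]) simp
  also have "\<dots> = M $$ (i, i) * cofactor M i i"
    by (rule sum.remove[of _ i, THEN trans]) (use z in auto)
  also have "mat_delete M i i = mat i i (\<lambda>(k, b). M $$ (k, b))"
    using M by (intro eq_matI) (auto simp: mat_delete_def)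
  then have "cofactor M i i = det (mat i i (\<lambda>(k, b). M $$ (k, b)))"
    by (simp add: cofactor_def flip: mult_2)
  finally show ?thesis .
qed

lemma fps_nth_power_basis_low:
  assumes "fps_nth H 0 = 1" "b \<le> a"
  shows "fps_nth (H * (geo - 1) ^ a) b = (if b = a then 1 else 0)"
  using assms by (auto simp: geo_minus_1 power_mult_distrib mult.left_commute[of H]
        fps_X_power_mult_nth fps_power_zeroth)

text \<open>A part equal to $0$ contributes a last row $(0,\dots,0,1)$.\<close>

lemma gdet_append_0:
  assumes "fps_nth H 0 = 1"
  shows "gdet H (\<nu> @ [0]) = gdet H \<nu>"
proof -
  let ?l = "length \<nu>"
  let ?M = "mat (Suc ?l) (Suc ?l) (\<lambda>(a, b). fps_nth (H * (geo - 1) ^ a) ((\<nu> @ [0]) ! a + b))"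
  have "gdet H (\<nu> @ [0]) = det ?M" by (simp add: gdet_def)
  also have "\<dots> = ?M $$ (?l, ?l) * det (mat ?l ?l (\<lambda>(k, b). ?M $$ (k, b)))"
    by (rule det_last_row_last_entry) (use assms in \<open>auto simp: fps_nth_power_basis_low\<close>)
  also have "mat ?l ?l (\<lambda>(k, b). ?M $$ (k, b)) = mat ?l ?l (\<lambda>(a, b). fps_nth (H * (geo - 1) ^ a) (\<nu> ! a + b))"
    by (intro eq_matI) (auto simp: nth_append)
  finally show ?thesis using assms by (simp add: gdet_def fps_nth_power_basis_low)
qed

lemma gdet_append_zeros: "fps_nth H 0 = 1 \<Longrightarrow> gdet H (\<nu> @ replicate k 0) = gdet H \<nu>"
proof (induction k arbitrary: \<nu>)
  case (Suc k)
  have "\<nu> @ replicate (Suc k) 0 = (\<nu> @ replicate k 0) @ [0]"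
    by (simp add: replicate_append_same)
  then show ?case using Suc by (simp only: gdet_append_0)
qed simp

text \<open>Expansion along row $p$, with cofactors that do not depend on the entries of that row.\<close>

lemma det_linear_in_row:
  fixes f :: "nat \<Rightarrow> nat \<Rightarrow> 'a::comm_ring_1"
  assumes "p < k"
  obtains C where "\<And>r. det (mat k k (\<lambda>(a, b). if a = p then r b else f a b)) = (\<Sum>b<k. r b * C b)"
proof
  let ?M = "\<lambda>r. mat k k (\<lambda>(a, b). if a = p then r b else f a b)"
  fix r
  have "det (?M r) = (\<Sum>b<k. ?M r $$ (p, b) * cofactor (?M r) p b)"
    by (rule laplace_expansion_row) (use assms in auto)
  also have "\<dots> = (\<Sum>b<k. r b * cofactor (?M (\<lambda>_. 0)) p b)"
  proof (rule sum.cong[OF refl])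
    fix b assume "b \<in> {..<k}"
    have "mat_delete (?M r) p b = mat_delete (?M (\<lambda>_. 0)) p b"
      using assms by (intro eq_matI) (auto simp: mat_delete_def)
    then show "?M r $$ (p, b) * cofactor (?M r) p b = r b * cofactor (?M (\<lambda>_. 0)) p b"
      using assms \<open>b \<in> {..<k}\<close> by (simp add: cofactor_def)
  qed
  finally show "det (?M r) = (\<Sum>b<k. r b * cofactor (?M (\<lambda>_. 0)) p b)" .
qed

text \<open>The partitions inside a rectangle with $l$ rows and $m$ columns, filled up with zeros to length $l$.\<close>

definition box :: "nat \<Rightarrow> nat \<Rightarrow> nat list set" where
  "box l m = {\<nu>. length \<nu> = l \<and> sorted_wrt (\<ge>) \<nu> \<and> (\<forall>x\<in>set \<nu>. x \<le> m)}"

text \<open>The smallest part that may be put in front of a partition.\<close>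

definition lower :: "nat list \<Rightarrow> nat" where
  "lower \<nu> = (case \<nu> of [] \<Rightarrow> 0 | x # _ \<Rightarrow> x)"

lemma finite_box: "finite (box l m)"
  by (rule finite_subset[OF _ finite_lists_length_eq[of "{..m}" l]]) (auto simp: box_def)

lemma box_Suc: "box (Suc l) m = (\<lambda>(\<nu>, x). x # \<nu>) ` (SIGMA \<nu>:box l m. {lower \<nu>..m})"
proof (intro equalityI subsetI)
  fix \<mu> assume "\<mu> \<in> box (Suc l) m"
  then obtain x \<nu> where e: "\<mu> = x # \<nu>" "\<nu> \<in> box l m" "x \<le> m" "\<forall>y\<in>set \<nu>. y \<le> x"
    by (auto simp: box_def length_Suc_conv)
  then have "lower \<nu> \<le> x" by (auto simp: lower_def split: list.split)
  with e show "\<mu> \<in> (\<lambda>(\<nu>, x). x # \<nu>) ` (SIGMA \<nu>:box l m. {lower \<nu>..m})" by force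
next
  fix \<mu> assume "\<mu> \<in> (\<lambda>(\<nu>, x). x # \<nu>) ` (SIGMA \<nu>:box l m. {lower \<nu>..m})"
  then obtain x \<nu> where e: "\<mu> = x # \<nu>" "\<nu> \<in> box l m" "x \<le> m" "lower \<nu> \<le> x" by auto
  then have "\<forall>y\<in>set \<nu>. y \<le> x"
    by (cases \<nu>) (auto simp: lower_def box_def)
  with e show "\<mu> \<in> box (Suc l) m" by (auto simp: box_def)
qed

lemma sum_box_Suc: "sum f (box (Suc l) m) = (\<Sum>\<nu>\<in>box l m. \<Sum>x=lower \<nu>..m. f (x # \<nu>))"
  unfolding box_Suc
  by (subst sum.reindex) (auto simp: inj_on_def sum.Sigma finite_box intro!: sum.cong)

text \<open>The determinant after the first $p$ parts have been summed over: the first $p$ rows are rows of partial sums, cut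
off at $m$, and the remaining rows belong to the parts in $\nu$.\<close>

definition mixed_det :: "'a::comm_ring_1 fps \<Rightarrow> nat \<Rightarrow> nat \<Rightarrow> nat list \<Rightarrow> 'a" where
  "mixed_det H m p \<nu> = det (mat (p + length \<nu>) (p + length \<nu>)
     (\<lambda>(a, b). if a < p then fps_nth (H * geo * (geo - 1) ^ a) (m + b)
               else fps_nth (H * (geo - 1) ^ a) (\<nu> ! (a - p) + b)))"

text \<open>The sum of row $p$ for a part $x$ over all integers $x<l$ is row $p+1$ for the part $l$, because
$(u-1)^{p+1}=tu(u-1)^p$.\<close>

lemma interval_sum_power_basis:
  assumes "l \<le> Suc m"
  shows "(\<Sum>x=l..m. fps_nth (H * (geo - 1) ^ p) (x + b)) =
    fps_nth (H * geo * (geo - 1) ^ p) (m + b) - fps_nth (H * (geo - 1) ^ Suc p) (l + b)"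
proof -
  let ?W = "H * (geo - 1) ^ p"
  have e: "fps_nth (H * (geo - 1) ^ Suc p) k = (\<Sum>j<k. fps_nth ?W j)" for k
  proof (cases k)
    case (Suc j)
    have "H * (geo - 1) ^ Suc p = fps_X * (?W * geo)"
      by (simp add: geo_minus_1 mult_ac)
    then show ?thesis using Suc by (simp add: fps_mult_geo_nth lessThan_Suc_atMost)
  qed (simp add: geo_minus_1 fps_mult_nth_0)
  have "H * geo * (geo - 1) ^ p = ?W * geo" by (simp add: mult_ac)
  then have 1: "fps_nth (H * geo * (geo - 1) ^ p) (m + b) = (\<Sum>j<Suc m + b. fps_nth ?W j)"
    by (simp only: fps_mult_geo_nth) (simp add: lessThan_Suc_atMost)
  have "{..<Suc m + b} = {..<l + b} \<union> {l + b..m + b}" using assms by auto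
  then have "(\<Sum>j<Suc m + b. fps_nth ?W j) = (\<Sum>j<l + b. fps_nth ?W j) + (\<Sum>j=l + b..m + b. fps_nth ?W j)"
    by (simp add: sum.union_disjoint ivl_disj_int)
  then show ?thesis
    unfolding 1 e by (simp add: sum.shift_bounds_cl_nat_ivl)
qed

text \<open>Summing row $p$ over the parts $x$ from $y$ to $m$, where $y$ is the next part, gives the full row of partial sums
minus row $p+1$ for the part $y$.  The latter is a row of the determinant already and can be dropped.  Without a
next part, the subtracted row is zero.\<close>

lemma sum_mixed_det_Cons:
  assumes H: "fps_nth H 0 = 1" and \<nu>: "\<nu> \<in> box l m"
  shows "(\<Sum>x=lower \<nu>..m. mixed_det H m p (x # \<nu>)) = mixed_det H m (Suc p) \<nu>"
proof -
  let ?k = "Suc (p + length \<nu>)"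
  let ?f = "\<lambda>a b. if a < p then fps_nth (H * geo * (geo - 1) ^ a) (m + b)
     else fps_nth (H * (geo - 1) ^ a) (\<nu> ! (a - Suc p) + b)"
  obtain C where C: "\<And>r. det (mat ?k ?k (\<lambda>(a, b). if a = p then r b else ?f a b)) = (\<Sum>b<?k. r b * C b)"
    using det_linear_in_row[of p ?k ?f] by auto
  let ?low = "\<lambda>b. fps_nth (H * (geo - 1) ^ Suc p) (lower \<nu> + b)"
  have cons: "mixed_det H m p (x # \<nu>) = (\<Sum>b<?k. fps_nth (H * (geo - 1) ^ p) (x + b) * C b)" for x
    unfolding C[symmetric] mixed_det_def
    by (rule arg_cong[of _ _ det], rule eq_matI) (auto simp: nth_Cons' Suc_diff_Suc)
  have suc: "mixed_det H m (Suc p) \<nu> = (\<Sum>b<?k. fps_nth (H * geo * (geo - 1) ^ p) (m + b) * C b)"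
    unfolding C[symmetric] mixed_det_def
    by (rule arg_cong[of _ _ det], rule eq_matI) (auto simp: less_Suc_eq)
  \<comment> \<open>The subtracted row repeats row $p+1$.\<close>
  have low: "(\<Sum>b<?k. ?low b * C b) = 0"
  proof (cases \<nu>)
    case Nil
    then show ?thesis
      using H by (intro sum.neutral) (auto simp: lower_def fps_nth_power_basis_low simp del: power_Suc)
  next
    case (Cons y ys)
    let ?M = "mat ?k ?k (\<lambda>(a, b). if a = p then ?low b else ?f a b)"
    have "det ?M = 0"
      by (rule det_identical_rows[of _ ?k p "Suc p"])
         (auto simp: Cons lower_def intro!: eq_vecI simp del: power_Suc)
    then show ?thesis by (simp only: C)
  qed
  have lo: "lower \<nu> \<le> Suc m"
    using \<nu> by (auto simp: lower_def box_def split: list.split)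
  have "(\<Sum>x=lower \<nu>..m. mixed_det H m p (x # \<nu>)) =
      (\<Sum>b<?k. (\<Sum>x=lower \<nu>..m. fps_nth (H * (geo - 1) ^ p) (x + b)) * C b)"
    unfolding cons sum_distrib_right by (rule sum.swap)
  also have "\<dots> = mixed_det H m (Suc p) \<nu> - (\<Sum>b<?k. ?low b * C b)"
    unfolding suc interval_sum_power_basis[OF lo] left_diff_distrib sum_subtractf ..
  finally show ?thesis by (simp only: low diff_zero)
qed

lemma sum_box_mixed_det:
  assumes "fps_nth H 0 = 1"
  shows "(\<Sum>\<nu>\<in>box l m. mixed_det H m p \<nu>) = mixed_det H m (p + l) []"
proof (induction l arbitrary: p)
  case 0
  have "box 0 m = {[]}" by (auto simp: box_def)
  then show ?case by simp
next
  case (Suc l)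
  then show ?case by (simp add: sum_box_Suc sum_mixed_det_Cons[OF assms])
qed

lemma sum_box_gdet:
  assumes "fps_nth H 0 = 1"
  shows "(\<Sum>\<nu>\<in>box l m. gdet H \<nu>) = sigma_det H m l"
proof -
  have "gdet H \<nu> = mixed_det H m 0 \<nu>" for \<nu>
    by (simp add: gdet_def mixed_det_def)
  moreover have "mixed_det H m l [] = sigma_det H m l"
    unfolding mixed_det_def sigma_det_def by (rule arg_cong[of _ _ det], rule eq_matI) auto
  ultimately show ?thesis using sum_box_mixed_det[OF assms, where p = 0] by simp
qed

section \<open>Determinants for tau and sigma\<close>

lemma comm_ring_hom_Const: "comm_ring_hom Const"
  by standard (simp_all add: Const_def single_add mult_single)

text \<open>Induction on $a$, with multiplication by $u$ as summation of alternating binomial coefficients.\<close>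

lemma fps_nth_geo_power_complex:
  "fps_nth (geo ^ a :: complex fps) m = (-1) ^ m * ((- of_nat a) gchoose m)"
proof (induction a arbitrary: m)
  case 0
  then show ?case by (cases m) (simp_all add: gbinomial_0(2)[symmetric])
next
  case (Suc a)
  have "fps_nth (geo ^ Suc a :: complex fps) m = (\<Sum>l\<le>m. (- of_nat a gchoose l) * (-1) ^ l)"
    unfolding power_Suc2 fps_mult_geo_nth Suc by (intro sum.cong refl) (rule mult.commute)
  also have "\<dots> = (-1) ^ m * ((- of_nat a - 1) gchoose m)"
    by (rule gbinomial_sum_lower_neg)
  also have "- of_nat a - 1 = - (of_nat (Suc a) :: complex)" by simp
  finally show ?case .
qed

lemma fps_nth_geo_power_cpoly:
  "fps_nth (geo ^ a :: 'v cpoly fps) m = Const ((-1) ^ m * ((- of_nat a) gchoose m))"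
proof -
  have "Abs_fps (\<lambda>k. Const (fps_nth 1 k)) = (1 :: 'v cpoly fps)"
    by (simp add: fps_eq_iff Const_def)
  then have "Const (fps_nth (geo ^ a) m) = fps_nth (geo ^ a :: 'v cpoly fps) m"
    using fps_nth_geo_power_hom[where h = "Const :: complex \<Rightarrow> 'v cpoly", OF comm_ring_hom_Const, of 1 a 0 m] by simp
  then show ?thesis by (simp add: fps_nth_geo_power_complex)
qed

text \<open>The generating function $\sum_kh_kt^k$ of the complete symmetric functions.\<close>

definition h_series :: "nat cpoly fps" where
  "h_series = Abs_fps (\<lambda>k. hsym (int k))"

lemma h_series_0: "fps_nth h_series 0 = 1"
  by (simp add: h_series_def hsym_def)

lemma g_entry_eq:
  "g_entry \<mu> (a + 1) (b + 1) = fps_nth (h_series * (geo - 1) ^ a) (\<mu> ! a + b)"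
proof -
  let ?N = "\<mu> ! a + b"
  have W: "h_series * (geo - 1) ^ a = fps_X ^ a * (geo ^ a * h_series)"
    by (simp add: geo_minus_1 power_mult_distrib mult_ac)
  show ?thesis
  proof (cases "?N < a")
    case True
    then show ?thesis
      unfolding W by (simp add: fps_X_power_mult_nth g_entry_def Let_def hsym_def)
  next
    case False
    then have k: "int (\<mu> ! a) + int (b + 1) - int (a + 1) = int (?N - a)" by simp
    have "g_entry \<mu> (a + 1) (b + 1) =
        (\<Sum>m\<le>?N - a. fps_nth (geo ^ a) m * fps_nth h_series (?N - a - m))"
      unfolding g_entry_def add_diff_cancel_right' k Let_def
      by (intro sum.cong) (auto simp: fps_nth_geo_power_cpoly h_series_def of_nat_diff simp del: diff_diff_left)
    also have "\<dots> = fps_nth (geo ^ a * h_series) (?N - a)"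
      by (simp add: fps_mult_nth atLeast0AtMost)
    finally show ?thesis
      using False unfolding W by (simp add: fps_X_power_mult_nth)
  qed
qed

lemma dual_Groth_eq_gdet: "dual_Groth \<mu> = gdet h_series \<mu>"
  unfolding dual_Groth_def gdet_def g_entry_eq ..

text \<open>For $i=n$, where $\tau$ is $1$ by convention, the determinant is that of a unitriangular matrix.\<close>

lemma tau_eq:
  assumes "i \<le> n"
  shows "tau n i = tau_det h_series (n - i) i"
proof -
  consider "i = 0" | "i = n" "0 < i" | "0 < i" "i < n" using assms by linarith
  then show ?thesis
  proof cases
    case 3
    then have "tau n i = gdet h_series (rect n i)" by (simp add: tau_def dual_Groth_eq_gdet)
    also have "\<dots> = tau_det h_series (n - i) i"
      unfolding gdet_def tau_det_def by (rule arg_cong[of _ _ det], rule eq_matI) (auto simp: rect_def)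
    finally show ?thesis .
  qed (simp_all add: tau_def tau_det_0 h_series_0, simp add: tau_det_def)
qed

lemma sorted_wrt_replicate_ge: "sorted_wrt (\<ge>) (replicate k (x::nat))"
  by (induction k) auto

text \<open>Filling up with zeros is a bijection onto the box, with inverse the removal of zeros.\<close>

lemma sum_partitions_in_rect:
  assumes H: "fps_nth H 0 = 1"
  shows "(\<Sum>\<mu> | is_partition \<mu> \<and> diagram_subset \<mu> (rect n i). gdet H \<mu>) = (\<Sum>\<nu>\<in>box i (n - i). gdet H \<nu>)"
proof (rule sum.reindex_bij_witness[where i = "filter (\<lambda>x. 0 < x)" and j = "\<lambda>\<mu>. \<mu> @ replicate (i - length \<mu>) 0"])
  fix \<mu> assume "\<mu> \<in> {\<mu>. is_partition \<mu> \<and> diagram_subset \<mu> (rect n i)}"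
  then have \<mu>: "sorted_wrt (\<ge>) \<mu>" "\<forall>x\<in>set \<mu>. 0 < x" "length \<mu> \<le> i" "\<forall>x\<in>set \<mu>. x \<le> n - i"
    by (auto simp: is_partition_def diagram_subset_def rect_def in_set_conv_nth)
  then show "filter (\<lambda>x. 0 < x) (\<mu> @ replicate (i - length \<mu>) 0) = \<mu>" by simp
  show "\<mu> @ replicate (i - length \<mu>) 0 \<in> box i (n - i)"
    using \<mu> sorted_wrt_replicate_ge by (auto simp: box_def sorted_wrt_append)
  show "gdet H (\<mu> @ replicate (i - length \<mu>) 0) = gdet H \<mu>"
    by (rule gdet_append_zeros[OF H])
next
  fix \<nu> assume \<nu>: "\<nu> \<in> box i (n - i)"
  let ?f = "filter (\<lambda>x. 0 < x) \<nu>"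
  have "\<xi> = filter (\<lambda>x. 0 < x) \<xi> @ replicate (length \<xi> - length (filter (\<lambda>x. 0 < x) \<xi>)) 0"
    if "sorted_wrt (\<ge>) \<xi>" for \<xi> :: "nat list"
    using that
  proof (induction \<xi>)
    case (Cons x \<xi>)
    show ?case
    proof (cases "x = 0")
      case True
      then have "\<forall>y\<in>set \<xi>. y = 0" using Cons.prems by auto
      then have "filter (\<lambda>x. 0 < x) \<xi> = []" "\<xi> = replicate (length \<xi>) 0"
        by (auto simp: filter_empty_conv intro: replicate_eqI)
      then show ?thesis using True by simp
    qed (use Cons in auto)
  qed simp
  then have e: "?f @ replicate (i - length ?f) 0 = \<nu>" using \<nu> by (auto simp: box_def)
  then show "?f @ replicate (i - length ?f) 0 = \<nu>" .
  have "?f ! k \<le> n - i" if "k < length ?f" for k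
    using nth_mem[OF that] \<nu> by (auto simp: box_def)
  moreover have "length ?f \<le> i" using \<nu> length_filter_le[of "\<lambda>x. 0 < x" \<nu>] by (simp add: box_def)
  ultimately show "?f \<in> {\<mu>. is_partition \<mu> \<and> diagram_subset \<mu> (rect n i)}"
    using \<nu> by (auto simp: is_partition_def diagram_subset_def rect_def box_def sorted_wrt_filter)
qed

lemma sigma_eq:
  assumes "i \<le> n"
  shows "sigma n i = sigma_det h_series (n - i) i"
proof -
  consider "i = 0" | "i = n" "0 < i" | "0 < i" "i < n" using assms by linarith
  then show ?thesis
  proof cases
    case 3
    then show ?thesis
      by (simp add: sigma_def dual_Groth_eq_gdet sum_partitions_in_rect sum_box_gdet h_series_0)
  qed (simp_all add: sigma_def sigma_det_0 h_series_0, simp add: sigma_det_def)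
qed

section \<open>Nonvanishing\<close>

text \<open>For $H=x+t^m$ the matrix is $xM+V$, where $V$ is unitriangular.  So its determinant is a polynomial in $x$ with
constant term $1$, which is nonzero at some $x\ne0$; dividing $H$ by $x$ makes its constant term $1$.\<close>

lemma exists_nonzero_det:
  assumes W: "fps_nth W 0 = (1 :: complex)" and m: "1 \<le> m"
  obtains H where "fps_nth H 0 = (1 :: complex)"
    "det (mat i i (\<lambda>(a, b). fps_nth (H * W * (geo - 1) ^ a) (m + b))) \<noteq> 0"
proof -
  let ?D = "\<lambda>H. det (mat i i (\<lambda>(a, b). fps_nth (H * W * (geo - 1) ^ a) (m + b)))"
  let ?M = "mat i i (\<lambda>(a, b). [: fps_nth (W * (geo - 1) ^ a) b, fps_nth (W * (geo - 1) ^ a) (m + b) :])"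
  have D: "?D (fps_const x + fps_X ^ m) = poly (det ?M) x" for x
  proof -
    have h: "comm_ring_hom (\<lambda>p. poly p x)" by standard simp_all
    show ?thesis
      unfolding comm_ring_hom.hom_det[OF h, symmetric]
      by (rule arg_cong[of _ _ det], rule eq_matI)
         (simp_all add: distrib_right mult.assoc fps_X_power_mult_nth)
  qed
  have "poly (det ?M) 0 = det (mat i i (\<lambda>(a, b). fps_nth (W * (geo - 1) ^ a) b))"
    unfolding D[symmetric]
    by (rule arg_cong[of _ _ det], rule eq_matI) (simp_all add: mult.assoc fps_X_power_mult_nth)
  also have "\<dots> = 1" by (rule det_power_basis_0[OF W])
  finally have "det ?M \<noteq> 0" by auto
  \<comment> \<open>The factor $x$ excludes the root $x=0$ from the choice.\<close>
  then have "[:0, 1:] * det ?M \<noteq> 0" by simp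
  then obtain x where x: "x \<noteq> 0" "poly (det ?M) x \<noteq> 0"
    using poly_all_0_iff_0[of "[:0, 1:] * det ?M"] by auto
  let ?H = "fps_const x + fps_X ^ m"
  have c: "fps_nth (fps_const c * G * W * V) k = c * fps_nth (G * W * V) k" for c :: complex and G V k
    by (simp only: mult.assoc fps_mult_left_const_nth)
  have "mat i i (\<lambda>(a, b). fps_nth (fps_const (1 / x) * ?H * W * (geo - 1) ^ a) (m + b)) =
      (1 / x) \<cdot>\<^sub>m mat i i (\<lambda>(a, b). fps_nth (?H * W * (geo - 1) ^ a) (m + b))"
    by (rule eq_matI) (simp_all only: c, simp_all)
  then have "?D (fps_const (1 / x) * ?H) = (1 / x) ^ i * ?D ?H" by simp
  then have "?D (fps_const (1 / x) * ?H) \<noteq> 0" using x D[of x] by simp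
  moreover have "fps_nth (fps_const (1 / x) * ?H) 0 = 1" using x m by (simp add: fps_X_power_nth)
  ultimately show ?thesis using that by blast
qed

section \<open>Evaluation of polynomials\<close>

definition mon_eval :: "('v \<Rightarrow> 'b::comm_ring_1) \<Rightarrow> ('v \<Rightarrow>\<^sub>0 nat) \<Rightarrow> 'b" where
  "mon_eval x m = (\<Prod>v\<in>Poly_Mapping.keys m. x v ^ Poly_Mapping.lookup m v)"

text \<open>Evaluation in a commutative ring, with $\kappa$ as the action on coefficients.\<close>

definition cpoly_eval :: "(complex \<Rightarrow> 'b) \<Rightarrow> ('v \<Rightarrow> 'b::comm_ring_1) \<Rightarrow> 'v cpoly \<Rightarrow> 'b" where
  "cpoly_eval \<kappa> x p = (\<Sum>m\<in>Poly_Mapping.keys p. \<kappa> (Poly_Mapping.lookup p m) * mon_eval x m)"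

lemma mon_eval_superset:
  assumes "finite A" "Poly_Mapping.keys m \<subseteq> A"
  shows "mon_eval x m = (\<Prod>v\<in>A. x v ^ Poly_Mapping.lookup m v)"
  unfolding mon_eval_def using assms
  by (intro prod.mono_neutral_left) (auto simp: Poly_Mapping.in_keys_iff)

lemma mon_eval_add: "mon_eval x (m + m') = mon_eval x m * mon_eval x m'"
proof -
  let ?A = "Poly_Mapping.keys m \<union> Poly_Mapping.keys m'"
  have "mon_eval x (m + m') = (\<Prod>v\<in>?A. x v ^ Poly_Mapping.lookup (m + m') v)"
    using keys_add[of m m'] by (intro mon_eval_superset) auto
  also have "\<dots> = (\<Prod>v\<in>?A. x v ^ Poly_Mapping.lookup m v) * (\<Prod>v\<in>?A. x v ^ Poly_Mapping.lookup m' v)"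
    by (simp add: lookup_add power_add prod.distrib)
  finally show ?thesis by (simp add: mon_eval_superset[of ?A])
qed

lemma cpoly_eval_superset:
  assumes "comm_ring_hom \<kappa>" "finite A" "Poly_Mapping.keys p \<subseteq> A"
  shows "cpoly_eval \<kappa> x p = (\<Sum>m\<in>A. \<kappa> (Poly_Mapping.lookup p m) * mon_eval x m)"
proof -
  interpret comm_ring_hom \<kappa> by fact
  show ?thesis unfolding cpoly_eval_def using assms(2,3)
    by (intro sum.mono_neutral_left) (auto simp: Poly_Mapping.in_keys_iff)
qed

lemma cpoly_eval_single:
  assumes "comm_ring_hom \<kappa>"
  shows "cpoly_eval \<kappa> x (Poly_Mapping.single m c) = \<kappa> c * mon_eval x m"
  by (subst cpoly_eval_superset[OF assms, of "{m}"]) auto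

lemma cpoly_eval_add:
  assumes "comm_ring_hom \<kappa>"
  shows "cpoly_eval \<kappa> x (p + q) = cpoly_eval \<kappa> x p + cpoly_eval \<kappa> x q"
proof -
  interpret comm_ring_hom \<kappa> by fact
  let ?A = "Poly_Mapping.keys p \<union> Poly_Mapping.keys q"
  show ?thesis
    using keys_add[of p q]
    by (simp add: cpoly_eval_superset[OF assms, of ?A] lookup_add hom_distribs algebra_simps sum.distrib)
qed

lemma cpoly_sum_monomials: "p = (\<Sum>m\<in>Poly_Mapping.keys p. Poly_Mapping.single m (Poly_Mapping.lookup p m))"
  by (rule poly_mapping_eqI)
     (auto simp: lookup_sum lookup_single when_def Poly_Mapping.in_keys_iff sum.delta)

lemma cpoly_monomial_induct [case_names single add]:
  assumes "\<And>m c. P (Poly_Mapping.single m c)" "\<And>p q. P p \<Longrightarrow> P q \<Longrightarrow> P (p + q)"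
  shows "P (p :: 'v cpoly)"
proof -
  have "P 0" using assms(1)[of 0 0] by simp
  then have "P (\<Sum>m\<in>A. Poly_Mapping.single m (Poly_Mapping.lookup p m))" for A
    by (induction A rule: infinite_finite_induct) (use assms in auto)
  then show ?thesis by (subst cpoly_sum_monomials)
qed

theorem comm_ring_hom_cpoly_eval:
  assumes "comm_ring_hom \<kappa>"
  shows "comm_ring_hom (cpoly_eval \<kappa> x)"
proof -
  interpret comm_ring_hom \<kappa> by fact
  note single = cpoly_eval_single[OF assms] and add = cpoly_eval_add[OF assms]
  have "cpoly_eval \<kappa> x (p * q) = cpoly_eval \<kappa> x p * cpoly_eval \<kappa> x q" for p q
  proof (induction p rule: cpoly_monomial_induct)
    case (single m c)
    show ?case
    proof (induction q rule: cpoly_monomial_induct)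
      case (single m' c')
      then show ?case
        by (simp add: mult_single cpoly_eval_single[OF assms] mon_eval_add hom_distribs mult_ac)
    qed (simp add: distrib_left add)
  qed (simp add: distrib_right add)
  moreover have "cpoly_eval \<kappa> x 1 = 1"
    unfolding single_one[symmetric] single by (simp add: mon_eval_def)
  ultimately show ?thesis
    by unfold_locales (simp_all add: add, simp add: cpoly_eval_def)
qed

lemma cpoly_eval_Const: "comm_ring_hom \<kappa> \<Longrightarrow> cpoly_eval \<kappa> x (Const c) = \<kappa> c"
  by (simp add: Const_def cpoly_eval_single mon_eval_def)

lemma cpoly_eval_Var:
  assumes "comm_ring_hom \<kappa>"
  shows "cpoly_eval \<kappa> x (Var v) = x v"
proof -
  interpret comm_ring_hom \<kappa> by fact
  show ?thesis by (simp add: Var_def cpoly_eval_single[OF assms] mon_eval_def)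
qed

text \<open>A polynomial ring is generated by its constants and variables.\<close>

lemma poly_ring_induct [consumes 1, case_names Const Var add mult]:
  assumes p: "p \<in> carrier (poly_ring V)"
    and Const: "\<And>c. P (Const c)" and Var: "\<And>v. v \<in> V \<Longrightarrow> P (Var v)"
    and add: "\<And>p q. p \<in> carrier (poly_ring V) \<Longrightarrow> q \<in> carrier (poly_ring V) \<Longrightarrow> P p \<Longrightarrow> P q \<Longrightarrow> P (p + q)"
    and mult: "\<And>p q. p \<in> carrier (poly_ring V) \<Longrightarrow> q \<in> carrier (poly_ring V) \<Longrightarrow> P p \<Longrightarrow> P q \<Longrightarrow> P (p * q)"
  shows "P p"
proof -
  let ?P = "\<lambda>p. p \<in> carrier (poly_ring V) \<and> P p"
  have V: "?P (Var v)" if "v \<in> V" for v using that by (simp add: Var poly_ring_Var)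
  have addP: "?P (p + q)" and mulP: "?P (p * q)" if "?P p" "?P q" for p q
    using that by (simp_all add: add mult poly_ring_add poly_ring_mult)
  have C: "?P (Const c)" for c by (simp add: Const poly_ring_Const)
  have 0: "?P 0" and 1: "?P 1" using C[of 0] C[of 1] by (simp_all add: Const_def)
  have mon: "?P (Poly_Mapping.single m 1)" if "Poly_Mapping.keys m \<subseteq> V" for m
  proof -
    have pw: "?P (Var v ^ k)" if "v \<in> V" for v k
      by (induction k) (simp_all only: power_0 power_Suc 1 mulP V that simp_thms)
    have pr: "?P (\<Prod>v\<in>A. Var v ^ Poly_Mapping.lookup m v)" if "A \<subseteq> V" for A
      using that
    proof (induction A rule: infinite_finite_induct)
      case (insert v A)
      then show ?case by (simp only: prod.insert not_False_eq_True) (intro mulP pw insert.IH; simp)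
    qed (simp_all only: prod.infinite prod.empty 1 simp_thms)
    have vp: "Var v ^ k = Poly_Mapping.single (Poly_Mapping.single v k) 1" for v :: 'a and k
      by (induction k) (simp_all add: Var_def mult_single single_add[symmetric])
    have "(\<Prod>v\<in>A. Var v ^ Poly_Mapping.lookup m v) =
        Poly_Mapping.single (\<Sum>v\<in>A. Poly_Mapping.single v (Poly_Mapping.lookup m v)) 1" if "finite A" for A
      using that by (induction A rule: finite_induct) (simp_all add: vp mult_single)
    moreover have "(\<Sum>v\<in>Poly_Mapping.keys m. Poly_Mapping.single v (Poly_Mapping.lookup m v)) = m"
      by (rule poly_mapping_eqI)
         (auto simp: lookup_sum lookup_single when_def Poly_Mapping.in_keys_iff sum.delta)
    ultimately have "Poly_Mapping.single m 1 = (\<Prod>v\<in>Poly_Mapping.keys m. Var v ^ Poly_Mapping.lookup m v)"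
      by simp
    with pr[OF that] show ?thesis by simp
  qed
  have single: "?P (Poly_Mapping.single m c)" if "Poly_Mapping.keys m \<subseteq> V" for m c
  proof -
    have "Poly_Mapping.single m c = Const c * Poly_Mapping.single m 1"
      by (simp add: Const_def mult_single)
    then show ?thesis using mulP[OF C mon[OF that]] by simp
  qed
  have "?P (\<Sum>m\<in>A. Poly_Mapping.single m (Poly_Mapping.lookup p m))" if "A \<subseteq> Poly_Mapping.keys p" for A
    using that
  proof (induction A rule: infinite_finite_induct)
    case (insert m A)
    then have "Poly_Mapping.keys m \<subseteq> V" using p by (auto simp: poly_ring_def)
    then show ?case
      using insert by (simp only: sum.insert not_False_eq_True) (intro addP single insert.IH; simp)
  qed (simp_all only: sum.infinite sum.empty 0 simp_thms)
  from this[OF order_refl] show ?thesis using cpoly_sum_monomials[of p] by simp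
qed

section \<open>The ideal of relations and its localization\<close>

lemma cring_QK_poly: "cring (QK_poly n)"
  unfolding QK_poly_def by (rule cring_poly_ring)

lemma QK_poly_simps [simp]:
  "x \<otimes>\<^bsub>QK_poly n\<^esub> y = x * y" "\<one>\<^bsub>QK_poly n\<^esub> = 1"
  "x \<oplus>\<^bsub>QK_poly n\<^esub> y = x + y" "\<zero>\<^bsub>QK_poly n\<^esub> = 0"
  by (simp_all add: QK_poly_def)

lemma QK_poly_closed:
  shows QK_poly_add: "p \<in> carrier (QK_poly n) \<Longrightarrow> q \<in> carrier (QK_poly n) \<Longrightarrow> p + q \<in> carrier (QK_poly n)"
    and QK_poly_mult: "p \<in> carrier (QK_poly n) \<Longrightarrow> q \<in> carrier (QK_poly n) \<Longrightarrow> p * q \<in> carrier (QK_poly n)"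
    and QK_poly_0: "0 \<in> carrier (QK_poly n)" and QK_poly_1: "1 \<in> carrier (QK_poly n)"
    and QK_poly_Const: "Const c \<in> carrier (QK_poly n)"
  by (simp_all add: QK_poly_def poly_ring_closed)

lemma poly_ring_a_inv: "p \<in> carrier (poly_ring V) \<Longrightarrow> \<ominus>\<^bsub>poly_ring V\<^esub> p = - p"
proof -
  interpret cring "poly_ring V" by (rule cring_poly_ring)
  assume "p \<in> carrier (poly_ring V)"
  then show ?thesis by (intro minus_equality) (simp_all add: poly_ring_uminus)
qed

lemma poly_ring_a_minus:
  assumes "p \<in> carrier (poly_ring V)" "q \<in> carrier (poly_ring V)"
  shows "p \<ominus>\<^bsub>poly_ring V\<^esub> q = p - q"
  using assms by (simp add: a_minus_def poly_ring_a_inv)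

lemma QK_ideal_closed:
  shows QK_ideal_carrier: "a \<in> QK_ideal n \<Longrightarrow> a \<in> carrier (QK_poly n)"
    and QK_ideal_add: "a \<in> QK_ideal n \<Longrightarrow> b \<in> QK_ideal n \<Longrightarrow> a + b \<in> QK_ideal n"
    and QK_ideal_mult: "a \<in> QK_ideal n \<Longrightarrow> p \<in> carrier (QK_poly n) \<Longrightarrow> p * a \<in> QK_ideal n"
    and QK_ideal_0: "0 \<in> QK_ideal n"
proof -
  interpret ideal "QK_ideal n" "QK_poly n" by (rule ideal_QK_ideal)
  show "a \<in> QK_ideal n \<Longrightarrow> a \<in> carrier (QK_poly n)" by simp
  show "a \<in> QK_ideal n \<Longrightarrow> b \<in> QK_ideal n \<Longrightarrow> a + b \<in> QK_ideal n" using additive_subgroup.a_closed[OF is_additive_subgroup, of a b] by simp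
  show "a \<in> QK_ideal n \<Longrightarrow> p \<in> carrier (QK_poly n) \<Longrightarrow> p * a \<in> QK_ideal n" using I_l_closed by simp
  show "0 \<in> QK_ideal n" using additive_subgroup.zero_closed[OF is_additive_subgroup] by simp
qed

lemma QK_relation_in_ideal:
  assumes "1 \<le> i" "i \<le> n"
  shows "QK_F n i - of_nat (n choose i) \<in> QK_ideal n"
proof -
  interpret cring "QK_poly n" by (rule cring_QK_poly)
  have "{QK_F n i - of_nat (n choose i) | i. 1 \<le> i \<and> i \<le> n} \<subseteq> carrier (QK_poly n)"
    using QK_F_closed[of n] by (auto simp: QK_poly_def intro!: poly_ring_minus poly_ring_of_nat)
  from genideal_self[OF this] show ?thesis using assms unfolding QK_ideal_def by blast
qed

text \<open>The kernel of $h$ is an ideal, and it contains the generators.\<close>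

lemma QK_ideal_vanish:
  assumes h: "comm_ring_hom h" and gen: "\<And>i. 1 \<le> i \<Longrightarrow> i \<le> n \<Longrightarrow> h (QK_F n i) = of_nat (n choose i)"
    and a: "a \<in> QK_ideal n"
  shows "h a = 0"
proof -
  interpret comm_ring_hom h by fact
  interpret R: cring "QK_poly n" by (rule cring_QK_poly)
  let ?K = "{p \<in> carrier (QK_poly n). h p = 0}"
  have "ideal ?K (QK_poly n)"
  proof (rule idealI)
    show "ring (QK_poly n)" by (rule R.ring_axioms)
    show "subgroup ?K (add_monoid (QK_poly n))"
    proof
      fix x assume "x \<in> ?K"
      then have "\<ominus>\<^bsub>QK_poly n\<^esub> x \<in> ?K"
        by (auto simp: QK_poly_def poly_ring_a_inv poly_ring_uminus hom_distribs)
      then show "inv\<^bsub>add_monoid (QK_poly n)\<^esub> x \<in> ?K" by (simp add: a_inv_def)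
    qed (auto simp: QK_poly_closed hom_distribs)
  qed (auto simp: QK_poly_closed hom_distribs)
  moreover have "{QK_F n i - of_nat (n choose i) | i. 1 \<le> i \<and> i \<le> n} \<subseteq> ?K"
    using gen QK_F_closed[of n]
    by (auto simp: QK_poly_def hom_distribs intro!: poly_ring_minus poly_ring_of_nat)
  ultimately have "QK_ideal n \<subseteq> ?K"
    unfolding QK_ideal_def by (rule R.genideal_minimal)
  with a show ?thesis by auto
qed

lemma QK_F_eq_toda_F: "QK_F n i = toda_F QK_z (QK_Q n) n i"
  by (simp add: QK_F_def toda_F_def)

definition qk_code :: "qk_var \<Rightarrow> nat" where
  "qk_code v = (case v of ZV i \<Rightarrow> 2 * i | QV i \<Rightarrow> 2 * i + 1)"

text \<open>Renumbers the variables by natural numbers.  As these are linearly ordered, the image is a polynomial ring that is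
known to be an integral domain, and the quantum side can be mapped into its field of fractions.\<close>

definition rename :: "qk_var cpoly \<Rightarrow> nat cpoly" where
  "rename = cpoly_eval Const (\<lambda>v. Var (qk_code v))"

lemma carrier_poly_ring_UNIV: "carrier (poly_ring UNIV) = UNIV"
  by (simp add: poly_ring_def)

lemma rename_hom: "comm_ring_hom rename"
  unfolding rename_def by (rule comm_ring_hom_cpoly_eval[OF comm_ring_hom_Const])

lemma rename_Var: "rename (Var v) = Var (qk_code v)"
  by (simp add: rename_def cpoly_eval_Var comm_ring_hom_Const)

lemma inj_rename: "rename p = rename q \<Longrightarrow> p = q"
proof -
  define un where "un = cpoly_eval (Const :: complex \<Rightarrow> qk_var cpoly)
     (\<lambda>k. Var (if even k then ZV (k div 2) else QV (k div 2)))"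
  have un: "comm_ring_hom un"
    unfolding un_def by (rule comm_ring_hom_cpoly_eval[OF comm_ring_hom_Const])
  interpret u: comm_ring_hom un by (rule un)
  interpret r: comm_ring_hom rename by (rule rename_hom)
  have inv: "un (rename p) = p" for p
  proof -
    have "p \<in> carrier (poly_ring UNIV)" by (simp add: carrier_poly_ring_UNIV)
    then show ?thesis
    proof (induction p rule: poly_ring_induct)
      case (Const c)
      then show ?case
        by (simp add: rename_def un_def cpoly_eval_Const comm_ring_hom_Const)
    next
      case (Var v)
      then show ?case
        by (simp add: rename_Var un_def cpoly_eval_Var comm_ring_hom_Const qk_code_def split: qk_var.split)
    qed (simp_all add: r.hom_add u.hom_add r.hom_mult u.hom_mult)
  qed
  show "rename p = rename q \<Longrightarrow> p = q" using inv by metis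
qed

definition frac_const :: "complex \<Rightarrow> nat cpoly fract" where
  "frac_const c = to_fract (Const c)"

lemma frac_const_hom: "comm_ring_hom frac_const"
proof -
  interpret comm_ring_hom Const by (rule comm_ring_hom_Const)
  show ?thesis by standard (simp_all add: frac_const_def hom_distribs)
qed

lemma to_fract_hom: "comm_ring_hom to_fract"
  by standard simp_all

text \<open>The monomials in $Q_1,\dots,Q_{n-1}$, which are the denominators of the localization before passing to the
quotient.\<close>

definition QK_mon :: "nat \<Rightarrow> qk_var cpoly set" where
  "QK_mon n = submonoid_gen (QK_poly n) {QK_Q n i | i. 1 \<le> i \<and> i \<le> n - 1}"

lemma mult_subset_QK_mon: "mult_subset (QK_poly n) (QK_mon n)"
  unfolding QK_mon_def
  by (rule cring.mult_subset_submonoid_gen[OF cring_QK_poly]) (auto intro!: QK_generators_closed)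

lemma QK_mon_closed:
  shows QK_mon_carrier: "s \<in> QK_mon n \<Longrightarrow> s \<in> carrier (QK_poly n)"
    and QK_mon_1: "1 \<in> QK_mon n"
    and QK_mon_mult: "s \<in> QK_mon n \<Longrightarrow> t \<in> QK_mon n \<Longrightarrow> s * t \<in> QK_mon n"
  using mult_subset.S_sub[OF mult_subset_QK_mon[of n]] mult_subset.S_one[OF mult_subset_QK_mon[of n]]
    mult_subset.S_mult[OF mult_subset_QK_mon[of n]] by auto

lemma QK_mon_Q: "1 \<le> i \<Longrightarrow> i < n \<Longrightarrow> QK_Q n i \<in> QK_mon n"
proof -
  assume i: "1 \<le> i" "i < n"
  have "QK_Q n i \<in> {QK_Q n i | i. 1 \<le> i \<and> i \<le> n - 1}"
    by (rule CollectI, rule exI[of _ i]) (use i in auto)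
  from submonoid_gen.step[OF this submonoid_gen.one, of "QK_poly n"]
  show ?thesis by (simp add: QK_mon_def)
qed

lemma QK_mon_induct [consumes 1, case_names one step]:
  assumes "s \<in> QK_mon n" "P 1" "\<And>i s. 1 \<le> i \<Longrightarrow> i < n \<Longrightarrow> s \<in> QK_mon n \<Longrightarrow> P s \<Longrightarrow> P (QK_Q n i * s)"
  shows "P s"
  using assms(1) unfolding QK_mon_def
proof induction
  case one
  then show ?case using assms(2) by simp
next
  case (step x s)
  then obtain i where "x = QK_Q n i" "1 \<le> i" "i \<le> n - 1" by auto
  then show ?case using step assms(3)[of i s] by (auto simp: QK_mon_def)
qed

lemma rename_mon_nonzero: "s \<in> QK_mon n \<Longrightarrow> rename s \<noteq> 0"
proof (induction s rule: QK_mon_induct)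
  case one
  interpret comm_ring_hom rename by (rule rename_hom)
  show ?case by simp
next
  case (step i s)
  interpret comm_ring_hom rename by (rule rename_hom)
  have "(Var k :: nat cpoly) \<noteq> 0" for k
    unfolding Var_def by (metis lookup_single_eq lookup_zero one_neq_zero)
  with step show ?case by (simp add: hom_mult QK_Q_def rename_Var)
qed

text \<open>Evaluation at given values of $z_1,\dots,z_n$ and $Q_1,\dots,Q_{n-1}$, where the otherwise idle variables with
index $n+j$ take the values $Q_j^{-1}$ and all others vanish.  In this way elements of the localized ring are
represented by polynomials, and there is no need to calculate with fractions.\<close>

definition with_inverses :: "nat \<Rightarrow> (nat \<Rightarrow> nat cpoly fract) \<Rightarrow> (nat \<Rightarrow> nat cpoly fract) \<Rightarrow> qk_var cpoly \<Rightarrow> nat cpoly fract" where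
  "with_inverses n z Q = cpoly_eval frac_const (\<lambda>v. case v of
      ZV i \<Rightarrow> if 1 \<le> i \<and> i \<le> n then z i else 0
    | QV i \<Rightarrow> if 1 \<le> i \<and> i < n then Q i else if n < i \<and> i < 2 * n then inverse (Q (i - n)) else 0)"

lemma with_inverses_hom: "comm_ring_hom (with_inverses n z Q)"
  unfolding with_inverses_def by (rule comm_ring_hom_cpoly_eval[OF frac_const_hom])

lemma with_inverses_Const: "with_inverses n z Q (Const c) = frac_const c"
  by (simp add: with_inverses_def cpoly_eval_Const frac_const_hom)

lemma with_inverses_Var: "with_inverses n z Q (Var v) = (case v of
      ZV i \<Rightarrow> if 1 \<le> i \<and> i \<le> n then z i else 0
    | QV i \<Rightarrow> if 1 \<le> i \<and> i < n then Q i else if n < i \<and> i < 2 * n then inverse (Q (i - n)) else 0)"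
  by (simp add: with_inverses_def cpoly_eval_Var frac_const_hom)

lemma with_inverses_z: "1 \<le> i \<Longrightarrow> i \<le> n \<Longrightarrow> with_inverses n z Q (QK_z i) = z i"
  by (simp add: QK_z_def with_inverses_Var)

lemma with_inverses_Q: "1 \<le> i \<Longrightarrow> i < n \<Longrightarrow> with_inverses n z Q (QK_Q n i) = Q i"
  by (simp add: QK_Q_def with_inverses_Var)

text \<open>The map onto $\mathbb{C}[z,Q,Q^{-1}]$, as a subring of a field.\<close>

definition loc_emb :: "nat \<Rightarrow> qk_var cpoly \<Rightarrow> nat cpoly fract" where
  "loc_emb n = with_inverses n (\<lambda>i. to_fract (rename (QK_z i))) (\<lambda>i. to_fract (rename (QK_Q n i)))"

lemma loc_emb_hom: "comm_ring_hom (loc_emb n)"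
  unfolding loc_emb_def by (rule with_inverses_hom)

lemma loc_emb_carrier: "p \<in> carrier (QK_poly n) \<Longrightarrow> loc_emb n p = to_fract (rename p)"
  unfolding QK_poly_def
proof (induction p rule: poly_ring_induct)
  case (Const c)
  then show ?case
    by (simp add: loc_emb_def with_inverses_Const frac_const_def rename_def cpoly_eval_Const comm_ring_hom_Const)
next
  case (Var v)
  then show ?case
    by (auto simp: loc_emb_def with_inverses_Var QK_z_def QK_Q_def)
next
  case (add p q)
  interpret r: comm_ring_hom rename by (rule rename_hom)
  interpret l: comm_ring_hom "loc_emb n" by (rule loc_emb_hom)
  show ?case using add by (simp add: r.hom_add l.hom_add)
next
  case (mult p q)
  interpret r: comm_ring_hom rename by (rule rename_hom)
  interpret l: comm_ring_hom "loc_emb n" by (rule loc_emb_hom)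
  show ?case using mult by (simp add: r.hom_mult l.hom_mult)
qed

text \<open>Every polynomial represents a fraction of $\mathbb{C}[z,Q,Q^{-1}]$.  The fraction is the same for all values of
$z$ and of invertible $Q$; the two equations say this for the generic values and for given ones.\<close>

lemma common_denominator:
  assumes Q: "\<And>i. 1 \<le> i \<Longrightarrow> i < n \<Longrightarrow> Q i \<noteq> 0"
  obtains b s where "b \<in> carrier (QK_poly n)" "s \<in> QK_mon n"
    "loc_emb n y * loc_emb n s = loc_emb n b" "with_inverses n z Q y * with_inverses n z Q s = with_inverses n z Q b"
proof -
  let ?f = "loc_emb n" and ?g = "with_inverses n z Q"
  interpret f: comm_ring_hom ?f by (rule loc_emb_hom)
  interpret g: comm_ring_hom ?g by (rule with_inverses_hom)
  have "y \<in> carrier (poly_ring UNIV)" by (simp add: carrier_poly_ring_UNIV)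
  then have "\<exists>b\<in>carrier (QK_poly n). \<exists>s\<in>QK_mon n. ?f y * ?f s = ?f b \<and> ?g y * ?g s = ?g b"
  proof (induction y rule: poly_ring_induct)
    case (Const c)
    show ?case by (intro bexI[of _ "Const c"] bexI[of _ 1]) (simp_all add: QK_mon_1 QK_poly_Const)
  next
    case (Var v)
    show ?case
    proof (cases "Var v \<in> carrier (QK_poly n)")
      case True
      then show ?thesis by (intro bexI[of _ "Var v"] bexI[of _ 1]) (simp_all add: QK_mon_1)
    next
      case False
      show ?thesis
      proof (cases "\<exists>i. 1 \<le> i \<and> i < n \<and> v = QV (n + i)")
        case True
        then obtain i where i: "1 \<le> i" "i < n" "v = QV (n + i)" by blast
        have "?f (Var v) * ?f (QK_Q n i) = 1"
          using i rename_mon_nonzero[OF QK_mon_Q[OF i(1,2)]]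
          by (simp add: loc_emb_def with_inverses_Q) (simp add: with_inverses_Var)
        moreover have "?g (Var v) * ?g (QK_Q n i) = 1"
          using i Q[of i] by (simp add: with_inverses_Q) (simp add: with_inverses_Var)
        ultimately show ?thesis
          using QK_mon_Q[OF i(1,2)] by (intro bexI[of _ 1] bexI[of _ "QK_Q n i"]) (simp_all add: QK_poly_1)
      next
        case nv: False
        have "?f (Var v) = 0 \<and> ?g (Var v) = 0"
        proof (cases v)
          case (ZV i)
          then show ?thesis using False
            by (auto simp: loc_emb_def with_inverses_Var QK_poly_def poly_ring_Var)
        next
          case (QV i)
          have "\<not> (1 \<le> i \<and> i < n)" using False QV by (auto simp: QK_poly_def poly_ring_Var)
          moreover have "\<not> (n < i \<and> i < 2 * n)"
            using nv QV by (auto dest!: spec[of _ "i - n"])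
          ultimately show ?thesis using QV by (auto simp: loc_emb_def with_inverses_Var)
        qed
        then show ?thesis by (intro bexI[of _ 0] bexI[of _ 1]) (simp_all add: QK_mon_1 QK_poly_0)
      qed
    qed
  next
    case (add p q)
    then obtain b s c t where *: "b \<in> carrier (QK_poly n)" "s \<in> QK_mon n" "c \<in> carrier (QK_poly n)" "t \<in> QK_mon n"
      "?f p * ?f s = ?f b" "?g p * ?g s = ?g b" "?f q * ?f t = ?f c" "?g q * ?g t = ?g c" by blast
    have "?f (p + q) * ?f (s * t) = ?f (b * t + c * s)" "?g (p + q) * ?g (s * t) = ?g (b * t + c * s)"
      unfolding f.hom_add f.hom_mult g.hom_add g.hom_mult *(5-8)[symmetric] by (simp_all add: algebra_simps)
    then show ?case
      using * by (intro bexI[of _ "b * t + c * s"] bexI[of _ "s * t"])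
        (auto intro: QK_poly_add QK_poly_mult QK_mon_mult QK_mon_carrier)
  next
    case (mult p q)
    then obtain b s c t where *: "b \<in> carrier (QK_poly n)" "s \<in> QK_mon n" "c \<in> carrier (QK_poly n)" "t \<in> QK_mon n"
      "?f p * ?f s = ?f b" "?g p * ?g s = ?g b" "?f q * ?f t = ?f c" "?g q * ?g t = ?g c" by blast
    have "?f (p * q) * ?f (s * t) = ?f (b * c)" "?g (p * q) * ?g (s * t) = ?g (b * c)"
      unfolding f.hom_mult g.hom_mult *(5-8)[symmetric] by (simp_all add: mult_ac)
    then show ?case
      using * by (intro bexI[of _ "b * c"] bexI[of _ "s * t"])
        (auto intro: QK_poly_mult QK_mon_mult)
  qed
  then show ?thesis using that by blast
qed

text \<open>The preimage of the ideal that the relations generate in $\mathbb{C}[z,Q,Q^{-1}]$.  It is an ideal of the whole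
polynomial type, and the quotient by it is the localized quantum $K$-ring.\<close>

definition loc_ideal :: "nat \<Rightarrow> qk_var cpoly set" where
  "loc_ideal n = {x. \<exists>a\<in>QK_ideal n. \<exists>s\<in>QK_mon n. loc_emb n x * loc_emb n s = loc_emb n a}"

lemma loc_idealI:
  "a \<in> QK_ideal n \<Longrightarrow> s \<in> QK_mon n \<Longrightarrow> loc_emb n x * loc_emb n s = loc_emb n a \<Longrightarrow> x \<in> loc_ideal n"
  by (auto simp: loc_ideal_def)

lemma loc_ideal_kernel: "loc_emb n x = 0 \<Longrightarrow> x \<in> loc_ideal n"
proof -
  interpret f: comm_ring_hom "loc_emb n" by (rule loc_emb_hom)
  show "loc_emb n x = 0 \<Longrightarrow> x \<in> loc_ideal n"
    by (rule loc_idealI[of 0 n 1]) (simp_all add: QK_mon_1 QK_ideal_0)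
qed

lemma loc_emb_inj: "p \<in> carrier (QK_poly n) \<Longrightarrow> q \<in> carrier (QK_poly n) \<Longrightarrow> loc_emb n p = loc_emb n q \<Longrightarrow> p = q"
  by (auto simp: loc_emb_carrier intro: inj_rename)

lemma QK_mon_inverse_exists: "1 \<le> i \<Longrightarrow> i < n \<Longrightarrow> QK_Q n i * Var (QV (n + i)) - 1 \<in> loc_ideal n"
proof -
  assume i: "1 \<le> i" "i < n"
  interpret f: comm_ring_hom "loc_emb n" by (rule loc_emb_hom)
  have "loc_emb n (QK_Q n i) * loc_emb n (Var (QV (n + i))) = 1"
    using i rename_mon_nonzero[OF QK_mon_Q[OF i(1,2)]]
    by (simp add: loc_emb_def with_inverses_Q) (simp add: with_inverses_Var)
  then have "loc_emb n (QK_Q n i * Var (QV (n + i)) - 1) = 0"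
    by (simp add: f.hom_minus f.hom_mult)
  then show ?thesis by (rule loc_ideal_kernel)
qed

lemma ideal_cong_loc_ideal: "ideal_cong (loc_ideal n)"
proof
  interpret f: comm_ring_hom "loc_emb n" by (rule loc_emb_hom)
  let ?f = "loc_emb n"
  show "0 \<in> loc_ideal n"
    by (rule loc_ideal_kernel) simp
  fix x assume "x \<in> loc_ideal n"
  then obtain a s where x: "a \<in> QK_ideal n" "s \<in> QK_mon n" "?f x * ?f s = ?f a"
    by (auto simp: loc_ideal_def)
  {
    fix y assume "y \<in> loc_ideal n"
    then obtain b t where y: "b \<in> QK_ideal n" "t \<in> QK_mon n" "?f y * ?f t = ?f b"
      by (auto simp: loc_ideal_def)
    have "?f (x + y) * ?f (s * t) = ?f (t * a + s * b)"
      unfolding f.hom_add f.hom_mult x(3)[symmetric] y(3)[symmetric] by (simp add: algebra_simps)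
    then show "x + y \<in> loc_ideal n"
      using x y unfolding loc_ideal_def
      by (blast intro: QK_ideal_add QK_ideal_mult QK_mon_mult QK_mon_carrier)
  next
    fix r
    obtain b t where r: "b \<in> carrier (QK_poly n)" "t \<in> QK_mon n" "?f r * ?f t = ?f b"
      by (rule common_denominator[of n "\<lambda>_. 1" r]) auto
    have "?f (r * x) * ?f (t * s) = ?f (b * a)"
      unfolding f.hom_mult x(3)[symmetric] r(3)[symmetric] by (simp add: mult_ac)
    then show "r * x \<in> loc_ideal n"
      using x r unfolding loc_ideal_def by (blast intro: QK_ideal_mult QK_mon_mult)
  }
qed

text \<open>The preimage meets $\mathbb{C}[z,Q]$ in the saturation of the ideal of relations with respect to the $Q_i$.\<close>

lemma loc_ideal_carrier:
  assumes "p \<in> loc_ideal n" "p \<in> carrier (QK_poly n)"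
  obtains s where "s \<in> QK_mon n" "s * p \<in> QK_ideal n"
proof -
  interpret f: comm_ring_hom "loc_emb n" by (rule loc_emb_hom)
  obtain a s where a: "a \<in> QK_ideal n" "s \<in> QK_mon n" "loc_emb n p * loc_emb n s = loc_emb n a"
    using assms(1) by (auto simp: loc_ideal_def)
  have "s * p = a"
    by (rule loc_emb_inj[of _ n])
       (use a assms in \<open>auto simp: f.hom_mult mult.commute intro: QK_poly_mult QK_mon_carrier QK_ideal_carrier\<close>)
  with a that show ?thesis by blast
qed

lemma QK_ideal_subset_loc_ideal: "a \<in> QK_ideal n \<Longrightarrow> a \<in> loc_ideal n"
proof -
  interpret f: comm_ring_hom "loc_emb n" by (rule loc_emb_hom)
  show "a \<in> QK_ideal n \<Longrightarrow> a \<in> loc_ideal n"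
    by (rule loc_idealI[of a n 1]) (simp_all add: QK_mon_1)
qed

section \<open>The homomorphism into the field of fractions\<close>

lemma toda_F_cong:
  assumes "\<And>j. 1 \<le> j \<Longrightarrow> j \<le> n \<Longrightarrow> z j = z' j" "\<And>j. 1 \<le> j \<Longrightarrow> j \<le> n \<Longrightarrow> Q j = Q' j"
  shows "toda_F z Q n i = toda_F z' Q' n i"
  unfolding toda_F_def
  by (intro sum.cong arg_cong2[of _ _ _ _ "(*)"] prod.cong refl) (use assms in auto)

lemma toda_poly_cong:
  assumes "\<And>j. 1 \<le> j \<Longrightarrow> j \<le> k \<Longrightarrow> z j = z' j" "\<And>j. 1 \<le> j \<Longrightarrow> j < k \<Longrightarrow> Q j = Q' j"
  shows "toda_poly z Q x k = toda_poly z' Q' x k"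
  using assms by (induction z Q x k rule: toda_poly.induct) auto

lemma cpoly_eval_id_hom: "comm_ring_hom (cpoly_eval (\<lambda>c. c) x)"
  by (rule comm_ring_hom_cpoly_eval) (standard, simp_all)

text \<open>A homomorphism out of $\Lambda$ amounts to a power series with constant term $1$.\<close>

lemma map_h_series:
  assumes h: "comm_ring_hom h" and H: "\<And>k. 1 \<le> k \<Longrightarrow> h (Var k) = fps_nth H k" "fps_nth H 0 = 1"
  shows "Abs_fps (\<lambda>k. h (fps_nth h_series k)) = H"
proof (rule fps_ext)
  interpret comm_ring_hom h by fact
  fix k show "fps_nth (Abs_fps (\<lambda>k. h (fps_nth h_series k))) k = fps_nth H k"
    using H by (cases "k = 0") (simp_all add: h_series_def hsym_def)
qed

lemma tau_hom:
  assumes "comm_ring_hom h" "\<And>k. 1 \<le> k \<Longrightarrow> h (Var k) = fps_nth H k" "fps_nth H 0 = 1" "i \<le> n"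
  shows "h (tau n i) = tau_det H (n - i) i"
  using assms(4) by (simp add: tau_eq tau_det_hom[OF assms(1)] map_h_series[OF assms(1-3)])

lemma sigma_hom:
  assumes "comm_ring_hom h" "\<And>k. 1 \<le> k \<Longrightarrow> h (Var k) = fps_nth H k" "fps_nth H 0 = 1" "i \<le> n"
  shows "h (sigma n i) = sigma_det H (n - i) i"
  using assms(4) by (simp add: sigma_eq sigma_det_hom[OF assms(1)] map_h_series[OF assms(1-3)])

text \<open>It is enough that the polynomial does not vanish at one specialization of the $h_k$ to complex numbers.\<close>

lemma tau_nonzero: "i \<le> n \<Longrightarrow> tau n i \<noteq> 0"
  and sigma_nonzero: "i \<le> n \<Longrightarrow> sigma n i \<noteq> 0"
proof -
  assume i: "i \<le> n"
  have id: "comm_ring_hom (\<lambda>c::complex. c)" by standard simp_all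
  have ev: "cpoly_eval (\<lambda>c. c) (fps_nth H) (Var k) = fps_nth H k" for k and H :: "complex fps"
    by (rule cpoly_eval_Var[OF id])
  have h0: "cpoly_eval (\<lambda>c. c) (fps_nth H) 0 = 0" for H :: "complex fps"
    by (simp add: cpoly_eval_def)
  show "tau n i \<noteq> 0"
  proof (cases "i = n")
    case False
    obtain H where H: "fps_nth H 0 = (1 :: complex)"
      "det (mat i i (\<lambda>(a, b). fps_nth (H * 1 * (geo - 1) ^ a) (n - i + b))) \<noteq> 0"
      by (rule exists_nonzero_det[of 1 "n - i" i]) (use i False in auto)
    then have "tau_det H (n - i) i \<noteq> 0" by (simp add: tau_det_def)
    then show ?thesis
      using tau_hom[OF cpoly_eval_id_hom ev H(1) i] h0[of H] by auto
  qed (simp add: tau_def)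
  show "sigma n i \<noteq> 0"
  proof (cases "i = n")
    case False
    obtain H where H: "fps_nth H 0 = (1 :: complex)"
      "det (mat i i (\<lambda>(a, b). fps_nth (H * geo * (geo - 1) ^ a) (n - i + b))) \<noteq> 0"
      by (rule exists_nonzero_det[of geo "n - i" i]) (use i False in auto)
    then have "sigma_det H (n - i) i \<noteq> 0" by (simp add: sigma_det_def)
    then show ?thesis
      using sigma_hom[OF cpoly_eval_id_hom ev H(1) i] h0[of H] by auto
  qed (simp add: sigma_def)
qed

text \<open>The images of $z_i$ and $Q_i$ under $\Phi_n$, in the field of fractions of $\Lambda$.\<close>

definition toda_z :: "nat \<Rightarrow> nat \<Rightarrow> nat cpoly fract" where
  "toda_z n i = to_fract (tau n i) * to_fract (sigma n (i - 1)) / (to_fract (sigma n i) * to_fract (tau n (i - 1)))"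

definition toda_Q :: "nat \<Rightarrow> nat \<Rightarrow> nat cpoly fract" where
  "toda_Q n i = (if i = n then 0 else to_fract (tau n (i - 1)) * to_fract (tau n (i + 1)) / (to_fract (tau n i))\<^sup>2)"

definition toda_emb :: "nat \<Rightarrow> qk_var cpoly \<Rightarrow> nat cpoly fract" where
  "toda_emb n = with_inverses n (toda_z n) (toda_Q n)"

definition h_frac :: "nat cpoly fract fps" where
  "h_frac = Abs_fps (\<lambda>k. to_fract (fps_nth h_series k))"

lemma h_frac_nth: "1 \<le> k \<Longrightarrow> to_fract (Var k) = fps_nth h_frac k" "fps_nth h_frac 0 = 1"
  by (simp_all add: h_frac_def h_series_def hsym_def)

lemma toda_emb_hom: "comm_ring_hom (toda_emb n)"
  unfolding toda_emb_def by (rule with_inverses_hom)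

lemma to_fract_tau: "i \<le> n \<Longrightarrow> tau_det h_frac (n - i) i = to_fract (tau n i)"
  and to_fract_sigma: "i \<le> n \<Longrightarrow> sigma_det h_frac (n - i) i = to_fract (sigma n i)"
  using tau_hom[OF to_fract_hom h_frac_nth] sigma_hom[OF to_fract_hom h_frac_nth] by metis+

lemma toda_Q_nonzero: "1 \<le> i \<Longrightarrow> i < n \<Longrightarrow> toda_Q n i \<noteq> 0"
  by (simp add: toda_Q_def tau_nonzero)

lemma toda_emb_z: "1 \<le> i \<Longrightarrow> i \<le> n \<Longrightarrow> toda_emb n (QK_z i) = toda_z n i"
  by (simp add: toda_emb_def with_inverses_z)

lemma toda_emb_Q: "1 \<le> i \<Longrightarrow> i \<le> n \<Longrightarrow> toda_emb n (QK_Q n i) = toda_Q n i"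
proof -
  interpret comm_ring_hom "toda_emb n" by (rule toda_emb_hom)
  assume i: "1 \<le> i" "i \<le> n"
  show ?thesis
  proof (cases "i = n")
    case False
    with i show ?thesis by (simp add: toda_emb_def with_inverses_Q)
  qed (simp add: QK_Q_def toda_Q_def)
qed

text \<open>The formulas of the theorem define a solution of the Toda relations over the field of fractions.\<close>

lemma toda_field_facts:
  assumes n: "2 \<le> n"
  shows toda_F_toda_z_toda_Q: "i \<le> n \<Longrightarrow> toda_F (toda_z n) (toda_Q n) n i = of_nat (n choose i)"
    and h_frac_inverse: "1 \<le> m \<Longrightarrow> m < n \<Longrightarrow> fps_nth (h_frac * toda_fps (toda_z n) (toda_Q n) (n - 1)) m = 0"
proof -
  let ?t = "\<lambda>i. tau_det h_frac (n - i) i" and ?s = "\<lambda>i. sigma_det h_frac (n - i) i"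
  have t: "?t i \<noteq> 0" and s: "?s i \<noteq> 0" if "i \<le> n" for i
    using that by (simp_all add: to_fract_tau to_fract_sigma tau_nonzero sigma_nonzero)
  have z: "toda_z n i = ?t i * ?s (i - 1) / (?s i * ?t (i - 1))" if "1 \<le> i" "i \<le> n" for i
    using that to_fract_tau[of "i - 1" n] to_fract_sigma[of "i - 1" n] to_fract_tau[of i n] to_fract_sigma[of i n]
    by (simp add: toda_z_def)
  have Q: "toda_Q n i = ?t (i - 1) * ?t (i + 1) / (?t i)\<^sup>2" if "1 \<le> i" "i < n" for i
    using that to_fract_tau[of "i - 1" n] to_fract_tau[of "i + 1" n] to_fract_tau[of i n] by (simp add: toda_Q_def)
  have Qn: "toda_Q n n = 0" by (simp add: toda_Q_def)
  show "i \<le> n \<Longrightarrow> toda_F (toda_z n) (toda_Q n) n i = of_nat (n choose i)"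
    by (rule toda_F_of_generating_series[OF n h_frac_nth(2) t s z Q Qn])
  show "1 \<le> m \<Longrightarrow> m < n \<Longrightarrow> fps_nth (h_frac * toda_fps (toda_z n) (toda_Q n) (n - 1)) m = 0"
    by (rule generating_series_inverse[OF n h_frac_nth(2) t s z Q Qn])
qed

lemma toda_emb_QK_F:
  assumes "2 \<le> n" "1 \<le> i" "i \<le> n"
  shows "toda_emb n (QK_F n i) = of_nat (n choose i)"
proof -
  have "toda_emb n (QK_F n i) = toda_F (\<lambda>j. toda_emb n (QK_z j)) (\<lambda>j. toda_emb n (QK_Q n j)) n i"
    unfolding QK_F_eq_toda_F by (rule toda_F_hom[OF toda_emb_hom])
  also have "\<dots> = toda_F (toda_z n) (toda_Q n) n i"
    by (rule toda_F_cong) (simp_all add: toda_emb_z toda_emb_Q)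
  finally show ?thesis using assms by (simp add: toda_F_toda_z_toda_Q)
qed

lemma toda_emb_QK_ideal: "2 \<le> n \<Longrightarrow> a \<in> QK_ideal n \<Longrightarrow> toda_emb n a = 0"
  by (rule QK_ideal_vanish[OF toda_emb_hom toda_emb_QK_F])

lemma toda_emb_mon_nonzero: "s \<in> QK_mon n \<Longrightarrow> toda_emb n s \<noteq> 0"
proof (induction s rule: QK_mon_induct)
  case one
  interpret comm_ring_hom "toda_emb n" by (rule toda_emb_hom)
  show ?case by simp
next
  case (step i s)
  interpret comm_ring_hom "toda_emb n" by (rule toda_emb_hom)
  show ?case using step by (simp add: hom_mult toda_emb_Q toda_Q_nonzero)
qed

lemma toda_emb_common_denominator:
  obtains b s where "b \<in> carrier (QK_poly n)" "s \<in> QK_mon n"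
    "loc_emb n y * loc_emb n s = loc_emb n b" "toda_emb n y * toda_emb n s = toda_emb n b"
  using common_denominator[of n "toda_Q n" y "toda_z n"] toda_Q_nonzero unfolding toda_emb_def by blast

text \<open>This makes $\Phi_n$ well defined on the localized ring: times a monomial in the $Q_i$, whose image is not zero, an
element of the preimage is an element of the ideal of relations.\<close>

lemma toda_emb_loc_ideal:
  assumes n: "2 \<le> n" and x: "x \<in> loc_ideal n"
  shows "toda_emb n x = 0"
proof -
  interpret f: comm_ring_hom "loc_emb n" by (rule loc_emb_hom)
  interpret g: comm_ring_hom "toda_emb n" by (rule toda_emb_hom)
  obtain a s where a: "a \<in> QK_ideal n" "s \<in> QK_mon n" "loc_emb n x * loc_emb n s = loc_emb n a"
    using x by (auto simp: loc_ideal_def)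
  obtain b t where b: "b \<in> carrier (QK_poly n)" "t \<in> QK_mon n"
    "loc_emb n x * loc_emb n t = loc_emb n b" "toda_emb n x * toda_emb n t = toda_emb n b"
    by (rule toda_emb_common_denominator)
  have "loc_emb n (b * s) = loc_emb n (a * t)"
    unfolding f.hom_mult a(3)[symmetric] b(3)[symmetric] by (simp add: mult_ac)
  then have "b * s = a * t"
    using a b by (intro loc_emb_inj) (auto intro: QK_poly_mult QK_mon_carrier QK_ideal_carrier)
  then have "toda_emb n b * toda_emb n s = toda_emb n a * toda_emb n t"
    by (metis g.hom_mult)
  then have "toda_emb n b = 0"
    using toda_emb_QK_ideal[OF n a(1)] toda_emb_mon_nonzero[OF a(2)] by simp
  then show ?thesis using b(4) toda_emb_mon_nonzero[OF b(2)] by simp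
qed

lemma K_denoms_induct [consumes 1, case_names one tau sigma]:
  assumes "D \<in> K_denoms n" "P 1"
    "\<And>i D. 1 \<le> i \<Longrightarrow> i < n \<Longrightarrow> P D \<Longrightarrow> P (tau n i * D)"
    "\<And>i D. 1 \<le> i \<Longrightarrow> i < n \<Longrightarrow> P D \<Longrightarrow> P (sigma n i * D)"
  shows "P D"
  using assms(1) unfolding K_denoms_def
proof induction
  case one
  then show ?case using assms(2) by (simp add: Lambda_n_def)
next
  case (step x s)
  then show ?case using assms(3)[of _ s] assms(4)[of _ s] by (auto simp: Lambda_n_def)
qed

lemma K_denoms_closed:
  shows K_denoms_carrier: "D \<in> K_denoms n \<Longrightarrow> D \<in> carrier (Lambda_n n)"
    and K_denoms_1: "1 \<in> K_denoms n"
    and K_denoms_mult: "D \<in> K_denoms n \<Longrightarrow> E \<in> K_denoms n \<Longrightarrow> D * E \<in> K_denoms n"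
  using mult_subset.S_sub[OF mult_subset_K[of n]] mult_subset.S_one[OF mult_subset_K[of n]]
    mult_subset.S_mult[OF mult_subset_K[of n]] by (auto simp: Lambda_n_def)

lemma tau_in_K_denoms: "i \<le> n \<Longrightarrow> tau n i \<in> K_denoms n"
  and sigma_in_K_denoms: "i \<le> n \<Longrightarrow> sigma n i \<in> K_denoms n"
proof -
  let ?X = "{sigma n i | i. 1 \<le> i \<and> i \<le> n - 1} \<union> {tau n i | i. 1 \<le> i \<and> i \<le> n - 1}"
  have gen: "x \<in> K_denoms n" if "x \<in> ?X" for x
    using submonoid_gen.step[OF that submonoid_gen.one, of "Lambda_n n"]
    by (simp add: K_denoms_def Lambda_n_def)
  assume i: "i \<le> n"
  show "tau n i \<in> K_denoms n"
  proof (cases "i = 0 \<or> i = n")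
    case False
    then show ?thesis using i by (intro gen UnI2 CollectI exI[of _ i]) auto
  qed (auto simp: tau_def K_denoms_1)
  show "sigma n i \<in> K_denoms n"
  proof (cases "i = 0 \<or> i = n")
    case False
    then show ?thesis using i by (intro gen UnI1 CollectI exI[of _ i]) auto
  qed (auto simp: sigma_def K_denoms_1)
qed

lemma K_denoms_nonzero: "D \<in> K_denoms n \<Longrightarrow> D \<noteq> 0"
  by (induction D rule: K_denoms_induct) (auto simp: tau_nonzero sigma_nonzero)

lemma Lambda_n_closed:
  shows Lambda_n_add: "p \<in> carrier (Lambda_n n) \<Longrightarrow> q \<in> carrier (Lambda_n n) \<Longrightarrow> p + q \<in> carrier (Lambda_n n)"
    and Lambda_n_mult: "p \<in> carrier (Lambda_n n) \<Longrightarrow> q \<in> carrier (Lambda_n n) \<Longrightarrow> p * q \<in> carrier (Lambda_n n)"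
    and Lambda_n_Const: "Const c \<in> carrier (Lambda_n n)"
    and Lambda_n_0: "0 \<in> carrier (Lambda_n n)"
  by (simp_all add: Lambda_n_def poly_ring_closed)

text \<open>Modulo $t^n$ a series is determined by its constant term and the nonconstant part of its product with an
invertible series.\<close>

lemma fps_truncated_inverse_unique:
  fixes G H T :: "'a::field fps"
  assumes "fps_nth T 0 \<noteq> 0" "fps_nth G 0 = fps_nth H 0"
    "\<And>m. 1 \<le> m \<Longrightarrow> m < n \<Longrightarrow> fps_nth (G * T) m = fps_nth (H * T) m" "m < n"
  shows "fps_nth G m = fps_nth H m"
  using assms(4)
proof (induction m rule: less_induct)
  case (less m)
  show ?case
  proof (cases "m = 0")
    case False
    have e: "fps_nth (X * T) m = (\<Sum>l<m. fps_nth X l * fps_nth T (m - l)) + fps_nth X m * fps_nth T 0" for X :: "'a fps"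
      by (simp add: fps_mult_nth atLeast0AtMost flip: lessThan_Suc_atMost)
    have "(\<Sum>l<m. fps_nth G l * fps_nth T (m - l)) = (\<Sum>l<m. fps_nth H l * fps_nth T (m - l))"
      using less by (intro sum.cong) auto
    then have "fps_nth G m * fps_nth T 0 = fps_nth H m * fps_nth T 0"
      using assms(3)[of m] less.prems False unfolding e by simp
    then show ?thesis using assms(1) by simp
  qed (use assms(2) in simp)
qed

section \<open>The inverse homomorphism\<close>

text \<open>The inverse $\Psi$ sends $h_k$ to the coefficients of the generating series of the universal solution, namely the
classes of $z_i$ and $Q_i$ themselves, modulo the ideal of relations.  It is inverse to $\Phi_n$ on the one side
because $\tau_i$ and $\sigma_i$ of that series recover $z_i$ and $Q_i$.  On the other side, $\Phi_n\circ\Psi$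
fixes $h_1,\dots,h_{n-1}$: the series of the $h_k$ and its image are both, up to a scalar and modulo $t^n$, the
inverse of $S_{n-1}(u)$.\<close>

lemma inverse_homomorphism_exists:
  assumes n: "2 \<le> n"
  obtains \<Psi> :: "nat cpoly \<Rightarrow> qk_var cpoly" where "comm_ring_hom \<Psi>" "\<And>c. \<Psi> (Const c) = Const c"
    "\<And>i. i \<le> n \<Longrightarrow> ideal_cong.unit (loc_ideal n) (\<Psi> (tau n i))"
    "\<And>i. i \<le> n \<Longrightarrow> ideal_cong.unit (loc_ideal n) (\<Psi> (sigma n i))"
    "\<And>i. 1 \<le> i \<Longrightarrow> i \<le> n \<Longrightarrow> \<Psi> (sigma n i * tau n (i - 1)) * QK_z i - \<Psi> (tau n i * sigma n (i - 1)) \<in> loc_ideal n"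
    "\<And>i. 1 \<le> i \<Longrightarrow> i < n \<Longrightarrow> \<Psi> ((tau n i)\<^sup>2) * QK_Q n i - \<Psi> (tau n (i - 1) * tau n (i + 1)) \<in> loc_ideal n"
    "\<And>u. u \<in> carrier (Lambda_n n) \<Longrightarrow> toda_emb n (\<Psi> u) = to_fract u"
proof -
  interpret ideal_cong "loc_ideal n" by (rule ideal_cong_loc_ideal)
  have unit_Q: "unit (QK_Q n j)" if "1 \<le> j" "j < n" for j
    using QK_mon_inverse_exists[OF that] by (auto simp: unit_def eqv_def)
  have F: "eqv (toda_F QK_z (QK_Q n) n i) (of_nat (n choose i))" if "1 \<le> i" "i \<le> n" for i
    using QK_ideal_subset_loc_ideal[OF QK_relation_in_ideal[OF that]]
    by (simp add: eqv_def QK_F_eq_toda_F)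
  have Qn: "QK_Q n n = 0" by (simp add: QK_Q_def)
  obtain H where H0: "fps_nth H 0 = 1"
    and ut: "\<And>i. i \<le> n \<Longrightarrow> unit (tau_det H (n - i) i)" and us: "\<And>i. i \<le> n \<Longrightarrow> unit (sigma_det H (n - i) i)"
    and z: "\<And>i. 1 \<le> i \<Longrightarrow> i \<le> n \<Longrightarrow> eqv (QK_z i * (sigma_det H (n - i) i * tau_det H (n - (i - 1)) (i - 1)))
       (tau_det H (n - i) i * sigma_det H (n - (i - 1)) (i - 1))"
    and Q: "\<And>i. 1 \<le> i \<Longrightarrow> i < n \<Longrightarrow> eqv (QK_Q n i * (tau_det H (n - i) i)\<^sup>2)
       (tau_det H (n - (i - 1)) (i - 1) * tau_det H (n - (i + 1)) (i + 1))"
    and short: "short_row n QK_z (QK_Q n) H (n - 1)"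
    and u1: "unit (fps_nth (H * toda_fps QK_z (QK_Q n) (n - 1)) 0)"
    using toda_solution_determinants[OF n Qn unit_Q F] by blast
  define \<Psi> where "\<Psi> = cpoly_eval (Const :: complex \<Rightarrow> qk_var cpoly) (fps_nth H)"
  have hom: "comm_ring_hom \<Psi>"
    unfolding \<Psi>_def by (rule comm_ring_hom_cpoly_eval[OF comm_ring_hom_Const])
  have psi_Var: "\<Psi> (Var k) = fps_nth H k" for k
    by (simp add: \<Psi>_def cpoly_eval_Var comm_ring_hom_Const)
  have psi_Const: "\<Psi> (Const c) = Const c" for c
    by (simp add: \<Psi>_def cpoly_eval_Const comm_ring_hom_Const)
  have t: "\<Psi> (tau n i) = tau_det H (n - i) i" and s: "\<Psi> (sigma n i) = sigma_det H (n - i) i"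
    if "i \<le> n" for i
    using tau_hom[OF hom psi_Var H0 that] sigma_hom[OF hom psi_Var H0 that] by auto
  interpret p: comm_ring_hom \<Psi> by (rule hom)
  interpret e: comm_ring_hom "toda_emb n" by (rule toda_emb_hom)
  let ?m = "\<lambda>f. Abs_fps (\<lambda>k. toda_emb n (fps_nth f k))"
  interpret m: comm_ring_hom ?m by (rule comm_ring_hom_map_fps[OF toda_emb_hom])
  let ?TP = "toda_fps QK_z (QK_Q n) (n - 1)" and ?T = "toda_fps (toda_z n) (toda_Q n) (n - 1)"
  have mc: "?m (fps_const c) = fps_const (toda_emb n c)" for c
    by (simp add: fps_eq_iff)
  have mg: "?m geo = geo" by (simp add: geo_def)
  have mT: "?m ?TP = ?T"
  proof -
    have "?m ?TP = toda_poly (\<lambda>j. fps_const (toda_emb n (QK_z j))) (\<lambda>j. fps_const (toda_emb n (QK_Q n j))) geo (n - 1)"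
      unfolding toda_fps_def toda_poly_hom[OF comm_ring_hom_map_fps[OF toda_emb_hom]] mc mg ..
    also have "\<dots> = ?T"
      unfolding toda_fps_def by (rule toda_poly_cong) (auto simp: toda_emb_z toda_emb_Q)
    finally show ?thesis .
  qed
  have mH: "?m H * ?T = ?m (H * ?TP)" by (simp only: m.hom_mult mT)
  have emb_unit: "toda_emb n x \<noteq> 0" if "unit x" for x
  proof -
    from that obtain y where "x * y - 1 \<in> loc_ideal n" by (auto simp: unit_def eqv_def)
    then have "toda_emb n x * toda_emb n y = 1"
      using toda_emb_loc_ideal[OF n, of "x * y - 1"] by (simp add: e.hom_minus e.hom_mult)
    then show ?thesis by auto
  qed
  have "fps_nth (H * ?TP) 0 = fps_nth ?TP 0" using H0 by simp
  \<comment> \<open>A unit modulo the ideal has nonzero image in the field.\<close>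
  then have T0: "fps_nth ?T 0 \<noteq> 0"
    using emb_unit[OF u1] unfolding mT[symmetric] by simp
  have series: "fps_nth (?m H) k = fps_nth h_frac k" if "k < n" for k
  proof (rule fps_truncated_inverse_unique[OF T0])
    show "fps_nth (?m H) 0 = fps_nth h_frac 0" using H0 by (simp add: h_frac_nth)
    show "k < n" by fact
    fix m assume m: "1 \<le> m" "m < n"
    then have "fps_nth (H * ?TP) m \<in> loc_ideal n"
      using short by (auto simp: short_row_def eqv_def)
    then have "fps_nth (?m H * ?T) m = 0" unfolding mH using toda_emb_loc_ideal[OF n] by simp
    then show "fps_nth (?m H * ?T) m = fps_nth (h_frac * ?T) m"
      using h_frac_inverse[OF n m] by simp
  qed
  have "toda_emb n (\<Psi> u) = to_fract u" if "u \<in> carrier (Lambda_n n)" for u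
    using that unfolding Lambda_n_def
  proof (induction u rule: poly_ring_induct)
    case (Const c)
    then show ?case
      by (simp add: psi_Const toda_emb_def with_inverses_Const frac_const_def)
  next
    case (Var k)
    then have "1 \<le> k" "k < n" using n by auto
    then show ?case using series[of k] by (simp add: psi_Var h_frac_nth)
  qed (simp_all add: p.hom_add p.hom_mult e.hom_add e.hom_mult)
  moreover have "\<Psi> (sigma n i * tau n (i - 1)) * QK_z i - \<Psi> (tau n i * sigma n (i - 1)) \<in> loc_ideal n"
    if "1 \<le> i" "i \<le> n" for i
    using z[OF that] that t[of i] s[of i] t[of "i - 1"] s[of "i - 1"]
    by (simp add: eqv_def p.hom_mult mult.commute)
  moreover have "\<Psi> ((tau n i)\<^sup>2) * QK_Q n i - \<Psi> (tau n (i - 1) * tau n (i + 1)) \<in> loc_ideal n"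
    if "1 \<le> i" "i < n" for i
    using Q[OF that] that t[of i] t[of "i + 1"] t[of "i - 1"]
    by (simp add: eqv_def p.hom_mult p.hom_power mult.commute)
  ultimately show ?thesis
    using that[OF hom psi_Const] ut us t s by simp
qed

lemma poly_ring_UNIV_induct:
  assumes "\<And>c. P (Const c)" "\<And>v. P (Var v)" "\<And>p q. P p \<Longrightarrow> P q \<Longrightarrow> P (p + q)" "\<And>p q. P p \<Longrightarrow> P q \<Longrightarrow> P (p * q)"
  shows "P p"
proof -
  have "p \<in> carrier (poly_ring UNIV)" by (simp add: carrier_poly_ring_UNIV)
  then show ?thesis by (induction p rule: poly_ring_induct) (use assms in auto)
qed

text \<open>Every $y$ satisfies $D\,\Phi_n(y)=q$ and, modulo the ideal, $\Psi(D)y=\Psi(q)$ for some product $D$ of $\tau$'s and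
$\sigma$'s and some $q$ in $\Lambda_{(n)}$: this holds for the variables and is inherited by sums and products.
As $\Psi(D)$ is a unit, $\Phi_n(y)=0$ forces $y$ into the ideal.  The equations also describe the image.\<close>

lemma toda_emb_kernel_image:
  assumes n: "2 \<le> n"
  shows toda_emb_kernel: "toda_emb n y = 0 \<Longrightarrow> y \<in> loc_ideal n"
    and toda_emb_image: "\<exists>u\<in>carrier (Lambda_n n). \<exists>D\<in>K_denoms n. toda_emb n y = to_fract u / to_fract D"
    and toda_emb_onto: "u \<in> carrier (Lambda_n n) \<Longrightarrow> D \<in> K_denoms n \<Longrightarrow> \<exists>y. toda_emb n y = to_fract u / to_fract D"
proof -
  interpret ideal_cong "loc_ideal n" by (rule ideal_cong_loc_ideal)
  obtain \<Psi> where hom: "comm_ring_hom \<Psi>" and Const: "\<And>c. \<Psi> (Const c) = Const c"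
    and ut: "\<And>i. i \<le> n \<Longrightarrow> unit (\<Psi> (tau n i))"
    and us: "\<And>i. i \<le> n \<Longrightarrow> unit (\<Psi> (sigma n i))"
    and z: "\<And>i. 1 \<le> i \<Longrightarrow> i \<le> n \<Longrightarrow> eqv (\<Psi> (sigma n i * tau n (i - 1)) * QK_z i) (\<Psi> (tau n i * sigma n (i - 1)))"
    and Q: "\<And>i. 1 \<le> i \<Longrightarrow> i < n \<Longrightarrow> eqv (\<Psi> ((tau n i)\<^sup>2) * QK_Q n i) (\<Psi> (tau n (i - 1) * tau n (i + 1)))"
    and inv: "\<And>u. u \<in> carrier (Lambda_n n) \<Longrightarrow> toda_emb n (\<Psi> u) = to_fract u"
    using inverse_homomorphism_exists[OF n] unfolding eqv_def by blast
  interpret p: comm_ring_hom \<Psi> by (rule hom)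
  interpret e: comm_ring_hom "toda_emb n" by (rule toda_emb_hom)
  have unit_D: "unit (\<Psi> D)" if "D \<in> K_denoms n" for D
    using that by (induction D rule: K_denoms_induct) (simp_all add: p.hom_mult unit_mult_iff ut us)
  have frac: "\<exists>D\<in>K_denoms n. \<exists>u\<in>carrier (Lambda_n n). to_fract D * toda_emb n y = to_fract u \<and> eqv (\<Psi> D * y) (\<Psi> u)" for y
  proof (induction y rule: poly_ring_UNIV_induct)
    case (1 c)
    show ?case
      by (rule bexI[of _ 1], rule bexI[of _ "Const c"])
         (simp_all add: Const K_denoms_1 Lambda_n_Const toda_emb_def with_inverses_Const frac_const_def)
  next
    case (2 v)
    have zero: ?case if "toda_emb n (Var v) = 0" "loc_emb n (Var v) = 0"
      by (rule bexI[of _ 1], rule bexI[of _ 0])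
         (simp_all add: that K_denoms_1 Lambda_n_0 eqv_def loc_ideal_kernel)
    have Qcase: "toda_emb n (QK_Q n i) = to_fract (tau n (i - 1) * tau n (i + 1)) / to_fract ((tau n i)\<^sup>2)"
      if "1 \<le> i" "i < n" for i
      using that by (simp add: toda_emb_Q toda_Q_def power2_eq_square)
    show ?case
    proof (cases v)
      case (ZV i)
      show ?thesis
      proof (cases "1 \<le> i \<and> i \<le> n")
        case True
        then have nz: "sigma n i \<noteq> 0" "tau n (i - 1) \<noteq> 0"
          by (auto intro!: sigma_nonzero tau_nonzero)
        show ?thesis
        proof (intro bexI conjI)
          show "sigma n i * tau n (i - 1) \<in> K_denoms n"
            using True by (intro K_denoms_mult sigma_in_K_denoms tau_in_K_denoms) auto
          show "tau n i * sigma n (i - 1) \<in> carrier (Lambda_n n)"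
            using True by (intro K_denoms_carrier K_denoms_mult sigma_in_K_denoms tau_in_K_denoms) auto
          show "eqv (\<Psi> (sigma n i * tau n (i - 1)) * Var v) (\<Psi> (tau n i * sigma n (i - 1)))"
            using z[of i] True ZV by (simp add: QK_z_def)
          show "to_fract (sigma n i * tau n (i - 1)) * toda_emb n (Var v) = to_fract (tau n i * sigma n (i - 1))"
            using toda_emb_z[of i n] True ZV nz
            by (simp add: QK_z_def toda_z_def)
        qed
      next
        case False
        then show ?thesis using ZV by (intro zero) (auto simp: toda_emb_def loc_emb_def with_inverses_Var)
      qed
    next
      case (QV i)
      consider "1 \<le> i \<and> i < n" | "n < i \<and> i < 2 * n" | "\<not> (1 \<le> i \<and> i < n)" "\<not> (n < i \<and> i < 2 * n)" by blast
      then show ?thesis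
      proof cases
        case 1
        show ?thesis
        proof (intro bexI conjI)
          show "(tau n i)\<^sup>2 \<in> K_denoms n"
            using 1 by (simp add: power2_eq_square K_denoms_mult tau_in_K_denoms)
          show "tau n (i - 1) * tau n (i + 1) \<in> carrier (Lambda_n n)"
            using 1 by (intro K_denoms_carrier K_denoms_mult tau_in_K_denoms) auto
          show "eqv (\<Psi> ((tau n i)\<^sup>2) * Var v) (\<Psi> (tau n (i - 1) * tau n (i + 1)))"
            using Q[of i] 1 QV by (simp add: QK_Q_def)
          show "to_fract ((tau n i)\<^sup>2) * toda_emb n (Var v) = to_fract (tau n (i - 1) * tau n (i + 1))"
            using Qcase[of i] 1 QV tau_nonzero[of i n] by (simp add: QK_Q_def)
        qed
      next
        case 2
        define j where "j = i - n"
        have j: "1 \<le> j" "j < n" "v = QV (n + j)" using 2 QV by (auto simp: j_def)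
        have inv: "eqv (QK_Q n j * Var v) 1"
          using QK_mon_inverse_exists[OF j(1,2)] j(3) by (simp add: eqv_def)
        show ?thesis
        proof (intro bexI conjI)
          show "tau n (j - 1) * tau n (j + 1) \<in> K_denoms n"
            using j by (intro K_denoms_mult tau_in_K_denoms) auto
          show "(tau n j)\<^sup>2 \<in> carrier (Lambda_n n)"
            using j by (simp add: power2_eq_square K_denoms_carrier K_denoms_mult tau_in_K_denoms)
          have "eqv (\<Psi> (tau n (j - 1) * tau n (j + 1)) * Var v) (\<Psi> ((tau n j)\<^sup>2) * QK_Q n j * Var v)"
            by (rule eqv_mult[OF eqv_sym[OF Q[OF j(1,2)]] eqv_refl])
          also have "\<Psi> ((tau n j)\<^sup>2) * QK_Q n j * Var v = \<Psi> ((tau n j)\<^sup>2) * (QK_Q n j * Var v)"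
            by (simp add: mult_ac)
          also have "eqv \<dots> (\<Psi> ((tau n j)\<^sup>2) * 1)" by (rule eqv_mult_left[OF inv])
          finally show "eqv (\<Psi> (tau n (j - 1) * tau n (j + 1)) * Var v) (\<Psi> ((tau n j)\<^sup>2))" by simp
          have "toda_emb n (QK_Q n j) * toda_emb n (Var v) = 1"
            using toda_emb_loc_ideal[OF n, of "QK_Q n j * Var v - 1"] inv
            by (simp add: eqv_def e.hom_minus e.hom_mult)
          then show "to_fract (tau n (j - 1) * tau n (j + 1)) * toda_emb n (Var v) = to_fract ((tau n j)\<^sup>2)"
            unfolding Qcase[OF j(1,2)] using tau_nonzero[of j n] j by (simp add: field_simps)
        qed
      next
        case 3
        then show ?thesis using QV by (intro zero) (auto simp: toda_emb_def loc_emb_def with_inverses_Var)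
      qed
    qed
  next
    case (3 p q)
    then obtain D u E w where *: "D \<in> K_denoms n" "u \<in> carrier (Lambda_n n)" "E \<in> K_denoms n" "w \<in> carrier (Lambda_n n)"
      and e: "to_fract D * toda_emb n p = to_fract u" "to_fract E * toda_emb n q = to_fract w"
      and c: "eqv (\<Psi> D * p) (\<Psi> u)" "eqv (\<Psi> E * q) (\<Psi> w)" by blast
    show ?case
    proof (intro bexI conjI)
      show "D * E \<in> K_denoms n" "E * u + D * w \<in> carrier (Lambda_n n)"
        using * by (auto intro: K_denoms_mult Lambda_n_add Lambda_n_mult K_denoms_carrier)
      show "to_fract (D * E) * toda_emb n (p + q) = to_fract (E * u + D * w)"
        by (simp add: e.hom_add algebra_simps flip: e)
      have "eqv (\<Psi> E * (\<Psi> D * p) + \<Psi> D * (\<Psi> E * q)) (\<Psi> E * \<Psi> u + \<Psi> D * \<Psi> w)"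
        by (intro eqv_add eqv_mult_left c)
      then show "eqv (\<Psi> (D * E) * (p + q)) (\<Psi> (E * u + D * w))"
        by (simp add: p.hom_mult p.hom_add algebra_simps)
    qed
  next
    case (4 p q)
    then obtain D u E w where *: "D \<in> K_denoms n" "u \<in> carrier (Lambda_n n)" "E \<in> K_denoms n" "w \<in> carrier (Lambda_n n)"
      and e: "to_fract D * toda_emb n p = to_fract u" "to_fract E * toda_emb n q = to_fract w"
      and c: "eqv (\<Psi> D * p) (\<Psi> u)" "eqv (\<Psi> E * q) (\<Psi> w)" by blast
    show ?case
    proof (intro bexI conjI)
      show "D * E \<in> K_denoms n" "u * w \<in> carrier (Lambda_n n)"
        using * by (auto intro: K_denoms_mult Lambda_n_mult)
      show "to_fract (D * E) * toda_emb n (p * q) = to_fract (u * w)"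
        by (simp add: e.hom_mult mult_ac flip: e)
      have "eqv ((\<Psi> D * p) * (\<Psi> E * q)) (\<Psi> u * \<Psi> w)" by (rule eqv_mult[OF c])
      then show "eqv (\<Psi> (D * E) * (p * q)) (\<Psi> (u * w))"
        by (simp add: p.hom_mult mult_ac)
    qed
  qed
  show "y \<in> loc_ideal n" if "toda_emb n y = 0"
  proof -
    obtain D u where D: "D \<in> K_denoms n" "to_fract D * toda_emb n y = to_fract u" "eqv (\<Psi> D * y) (\<Psi> u)"
      using frac[of y] by blast
    then have "u = 0" using that by simp
    then have "eqv (\<Psi> D * y) (\<Psi> D * 0)" using D(3) by simp
    from eqv_cancel[OF unit_D[OF D(1)] this] show ?thesis by (simp add: eqv_def)
  qed
  show "\<exists>u\<in>carrier (Lambda_n n). \<exists>D\<in>K_denoms n. toda_emb n y = to_fract u / to_fract D"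
  proof -
    obtain D u where D: "D \<in> K_denoms n" "u \<in> carrier (Lambda_n n)" "to_fract D * toda_emb n y = to_fract u"
      using frac[of y] by blast
    then have "toda_emb n y = to_fract u / to_fract D"
      using K_denoms_nonzero[OF D(1)] by (simp add: field_simps)
    with D show ?thesis by blast
  qed
  show "\<exists>y. toda_emb n y = to_fract u / to_fract D" if uD: "u \<in> carrier (Lambda_n n)" "D \<in> K_denoms n"
  proof -
    obtain y where "\<Psi> D * y - 1 \<in> loc_ideal n"
      using unit_D[OF uD(2)] by (auto simp: unit_def eqv_def)
    then have "to_fract D * toda_emb n y = 1"
      using toda_emb_loc_ideal[OF n, of "\<Psi> D * y - 1"] inv[OF K_denoms_carrier[OF uD(2)]]
      by (simp add: e.hom_minus e.hom_mult)
    then have "toda_emb n y = 1 / to_fract D"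
      using K_denoms_nonzero[OF uD(2)] by (simp add: field_simps)
    then have "toda_emb n (\<Psi> u * y) = to_fract u / to_fract D"
      by (simp add: e.hom_mult inv[OF uD(1)])
    then show ?thesis by blast
  qed
qed

section \<open>The isomorphism\<close>

text \<open>A homomorphism into a field that does not vanish on $S$ extends to the localization; it is injective as soon as
the elements of its kernel are killed by elements of $S$.\<close>

lemma localization_embeds_in_field:
  fixes R :: "('a, 'b) ring_scheme" (structure) and g :: "'a \<Rightarrow> 'f::field"
  assumes "mult_subset R S"
    and g_add: "\<And>a b. a \<in> carrier R \<Longrightarrow> b \<in> carrier R \<Longrightarrow> g (a \<oplus> b) = g a + g b"
    and g_mult: "\<And>a b. a \<in> carrier R \<Longrightarrow> b \<in> carrier R \<Longrightarrow> g (a \<otimes> b) = g a * g b"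
    and g_one: "g \<one> = 1"
    and g_S: "\<And>s. s \<in> S \<Longrightarrow> g s \<noteq> 0"
    and ker: "\<And>a. a \<in> carrier R \<Longrightarrow> g a = 0 \<Longrightarrow> \<exists>u\<in>S. u \<otimes> a = \<zero>"
  obtains \<rho> where "\<And>a s. a \<in> carrier R \<Longrightarrow> s \<in> S \<Longrightarrow> \<rho> (loc_frac R S a s) = g a / g s"
    "inj_on \<rho> (carrier (localization R S))"
    "\<And>X Y. X \<in> carrier (localization R S) \<Longrightarrow> Y \<in> carrier (localization R S) \<Longrightarrow>
       \<rho> (X \<oplus>\<^bsub>localization R S\<^esub> Y) = \<rho> X + \<rho> Y"
    "\<And>X Y. X \<in> carrier (localization R S) \<Longrightarrow> Y \<in> carrier (localization R S) \<Longrightarrow>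
       \<rho> (X \<otimes>\<^bsub>localization R S\<^esub> Y) = \<rho> X * \<rho> Y"
    "\<rho> \<one>\<^bsub>localization R S\<^esub> = 1"
proof -
  interpret mult_subset R S by fact
  define \<rho> where "\<rho> X = (case SOME as. fst as \<in> carrier R \<and> snd as \<in> S \<and> X = loc_frac R S (fst as) (snd as)
     of (a, s) \<Rightarrow> g a / g s)" for X
  have eq: "loc_frac R S a s = loc_frac R S b t \<longleftrightarrow> g a / g s = g b / g t"
    if m: "a \<in> carrier R" "b \<in> carrier R" "s \<in> S" "t \<in> S" for a b s t
  proof
    assume "loc_frac R S a s = loc_frac R S b t"
    then obtain u where u: "u \<in> S" "u \<otimes> (a \<otimes> t) = u \<otimes> (b \<otimes> s)"
      using m by (auto simp: loc_frac_eq_iff)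
    from arg_cong[OF this(2), of g] have "g u * (g a * g t) = g u * (g b * g s)"
      using m u(1) by (simp add: g_mult)
    then show "g a / g s = g b / g t" using g_S m u(1) by (simp add: frac_eq_eq)
  next
    assume "g a / g s = g b / g t"
    then have e: "g a * g t = g b * g s" using g_S m by (simp add: frac_eq_eq)
    let ?d = "a \<otimes> t \<ominus> b \<otimes> s"
    have "?d \<oplus> b \<otimes> s = a \<otimes> t" using m by (simp add: a_minus_def a_assoc l_neg)
    from arg_cong[OF this, of g] have "g ?d = 0" using m e by (simp add: g_add g_mult)
    then obtain u where u: "u \<in> S" "u \<otimes> ?d = \<zero>" using ker[of ?d] m by auto
    have "u \<otimes> (a \<otimes> t) = u \<otimes> (?d \<oplus> b \<otimes> s)" using m by (simp add: a_minus_def a_assoc l_neg)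
    also have "\<dots> = u \<otimes> (b \<otimes> s)" using m u by (simp add: r_distr)
    finally show "loc_frac R S a s = loc_frac R S b t" using m u(1) by (auto simp: loc_frac_eq_iff)
  qed
  have \<rho>: "\<rho> (loc_frac R S a s) = g a / g s" if m: "a \<in> carrier R" "s \<in> S" for a s
  proof -
    let ?P = "\<lambda>as. fst as \<in> carrier R \<and> snd as \<in> S \<and> loc_frac R S a s = loc_frac R S (fst as) (snd as)"
    have "?P (SOME as. ?P as)" by (rule someI[of ?P "(a, s)"]) (use m in simp)
    then show ?thesis
      unfolding \<rho>_def using eq[of a "fst (SOME as. ?P as)" s "snd (SOME as. ?P as)"] m
      by (simp add: case_prod_beta)
  qed
  show ?thesis
  proof
    show "\<rho> (loc_frac R S a s) = g a / g s" if "a \<in> carrier R" "s \<in> S" for a s using \<rho>[OF that] .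
    show "inj_on \<rho> (carrier (localization R S))"
      by (rule inj_onI) (metis loc_frac_cases \<rho> eq)
    show "\<rho> \<one>\<^bsub>localization R S\<^esub> = 1"
      using S_one by (simp add: localization_one \<rho> g_one)
    fix X Y assume "X \<in> carrier (localization R S)" "Y \<in> carrier (localization R S)"
    then obtain a s b t where m: "a \<in> carrier R" "b \<in> carrier R" "s \<in> S" "t \<in> S"
      and e: "X = loc_frac R S a s" "Y = loc_frac R S b t" by (metis loc_frac_cases)
    show "\<rho> (X \<oplus>\<^bsub>localization R S\<^esub> Y) = \<rho> X + \<rho> Y"
      using m g_S S_mult by (simp add: e loc_frac_add \<rho> g_add g_mult add_frac_eq)
    show "\<rho> (X \<otimes>\<^bsub>localization R S\<^esub> Y) = \<rho> X * \<rho> Y"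
      using m S_mult by (simp add: e loc_frac_mult \<rho> g_mult)
  qed
qed

text \<open>Two rings embedded in a field with the same image are isomorphic.\<close>

lemma ring_iso_through_field:
  fixes \<rho> :: "'a \<Rightarrow> 'f::field" and \<iota> :: "'b \<Rightarrow> 'f"
  assumes R: "ring R" and S: "ring S"
    and inj: "inj_on \<rho> (carrier R)" "inj_on \<iota> (carrier S)" and im: "\<rho> ` carrier R = \<iota> ` carrier S"
    and \<rho>: "\<And>x y. x \<in> carrier R \<Longrightarrow> y \<in> carrier R \<Longrightarrow> \<rho> (x \<oplus>\<^bsub>R\<^esub> y) = \<rho> x + \<rho> y"
      "\<And>x y. x \<in> carrier R \<Longrightarrow> y \<in> carrier R \<Longrightarrow> \<rho> (x \<otimes>\<^bsub>R\<^esub> y) = \<rho> x * \<rho> y" "\<rho> \<one>\<^bsub>R\<^esub> = 1"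
    and \<iota>: "\<And>x y. x \<in> carrier S \<Longrightarrow> y \<in> carrier S \<Longrightarrow> \<iota> (x \<oplus>\<^bsub>S\<^esub> y) = \<iota> x + \<iota> y"
      "\<And>x y. x \<in> carrier S \<Longrightarrow> y \<in> carrier S \<Longrightarrow> \<iota> (x \<otimes>\<^bsub>S\<^esub> y) = \<iota> x * \<iota> y" "\<iota> \<one>\<^bsub>S\<^esub> = 1"
  shows "(\<lambda>x. inv_into (carrier S) \<iota> (\<rho> x)) \<in> ring_iso R S"
proof -
  interpret R: ring R by fact
  interpret S: ring S by fact
  let ?\<Phi> = "\<lambda>x. inv_into (carrier S) \<iota> (\<rho> x)"
  have mem: "?\<Phi> x \<in> carrier S" and val: "\<iota> (?\<Phi> x) = \<rho> x" if "x \<in> carrier R" for x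
  proof -
    have "\<rho> x \<in> \<iota> ` carrier S" using im that by blast
    then show "?\<Phi> x \<in> carrier S" "\<iota> (?\<Phi> x) = \<rho> x" by (rule inv_into_into, rule f_inv_into_f)
  qed
  have eqI: "?\<Phi> x = y" if "x \<in> carrier R" "y \<in> carrier S" "\<rho> x = \<iota> y" for x y
    using inj(2) that by (auto simp: inv_into_f_f)
  show ?thesis
  proof (rule ring_iso_memI)
    show "bij_betw ?\<Phi> (carrier R) (carrier S)"
    proof (rule bij_betw_imageI)
      show "inj_on ?\<Phi> (carrier R)"
        by (rule inj_onI) (metis inj(1) inj_onD val)
      show "?\<Phi> ` carrier R = carrier S"
      proof (intro equalityI subsetI)
        fix y assume y: "y \<in> carrier S"
        then obtain x where "x \<in> carrier R" "\<rho> x = \<iota> y" using im by (metis imageE imageI)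
        with y show "y \<in> ?\<Phi> ` carrier R" using eqI by (metis imageI)
      qed (use mem in auto)
    qed
  next
    fix x y assume xy: "x \<in> carrier R" "y \<in> carrier R"
    show "?\<Phi> (x \<otimes>\<^bsub>R\<^esub> y) = ?\<Phi> x \<otimes>\<^bsub>S\<^esub> ?\<Phi> y" "?\<Phi> (x \<oplus>\<^bsub>R\<^esub> y) = ?\<Phi> x \<oplus>\<^bsub>S\<^esub> ?\<Phi> y"
      by (rule eqI; simp add: xy mem val \<rho> \<iota>)+
  next
    show "?\<Phi> \<one>\<^bsub>R\<^esub> = \<one>\<^bsub>S\<^esub>" by (rule eqI) (simp_all add: \<rho> \<iota>)
  qed (rule mem)
qed

lemma QK_class_hom:
  assumes "p \<in> carrier (QK_poly n)" "q \<in> carrier (QK_poly n)"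
  shows "QK_class n (p + q) = QK_class n p \<oplus>\<^bsub>QK n\<^esub> QK_class n q"
    and "QK_class n (p * q) = QK_class n p \<otimes>\<^bsub>QK n\<^esub> QK_class n q"
    and "QK_class n 1 = \<one>\<^bsub>QK n\<^esub>" and "QK_class n 0 = \<zero>\<^bsub>QK n\<^esub>"
proof -
  interpret ideal "QK_ideal n" "QK_poly n" by (rule ideal_QK_ideal)
  have h: "QK_class n \<in> Ring.ring_hom (QK_poly n) (QK n)"
    using rcos_ring_hom unfolding QK_class_def QK_def .
  show "QK_class n (p + q) = QK_class n p \<oplus>\<^bsub>QK n\<^esub> QK_class n q"
    "QK_class n (p * q) = QK_class n p \<otimes>\<^bsub>QK n\<^esub> QK_class n q"
    "QK_class n 1 = \<one>\<^bsub>QK n\<^esub>"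
    using ring_hom_add[OF h assms] ring_hom_mult[OF h assms] ring_hom_one[OF h] by simp_all
  show "QK_class n 0 = \<zero>\<^bsub>QK n\<^esub>"
    using ring_hom_zero[OF h ring_axioms quotient_is_ring[folded QK_def]] by simp
qed

lemma QK_class_eq_iff:
  assumes "p \<in> carrier (QK_poly n)" "q \<in> carrier (QK_poly n)"
  shows "QK_class n p = QK_class n q \<longleftrightarrow> p - q \<in> QK_ideal n"
proof -
  interpret cring "QK_poly n" by (rule cring_QK_poly)
  show ?thesis
    using quotient_eq_iff_same_a_r_cos[OF ideal_QK_ideal assms] assms
      poly_ring_a_minus[of p "ZV ` {1..n} \<union> QV ` {1..n - 1}" q]
    by (simp add: QK_class_def QK_poly_def)
qed

lemma QK_carrier_cases:
  assumes "C \<in> carrier (QK n)"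
  obtains p where "p \<in> carrier (QK_poly n)" "C = QK_class n p"
  using assms by (auto simp: QK_class_def QK_def FactRing_def A_RCOSETS_def')

text \<open>The denominators of the localized ring are the classes of monomials.\<close>

lemma QK_denoms_eq: "QK_denoms n = QK_class n ` QK_mon n"
proof (intro equalityI subsetI)
  fix x assume "x \<in> QK_denoms n"
  then show "x \<in> QK_class n ` QK_mon n"
    unfolding QK_denoms_def
  proof induction
    case one
    then show ?case using QK_class_hom(3)[OF QK_poly_1 QK_poly_1] QK_mon_1 by (metis imageI)
  next
    case (step x s)
    then obtain i t where i: "x = QK_class n (QK_Q n i)" "1 \<le> i" "i \<le> n - 1" "s = QK_class n t" "t \<in> QK_mon n"
      by auto
    then have m: "QK_Q n i \<in> QK_mon n" by (intro QK_mon_Q) auto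
    have "x \<otimes>\<^bsub>QK n\<^esub> s = QK_class n (QK_Q n i * t)"
      using QK_class_hom(2)[OF QK_mon_carrier[OF m] QK_mon_carrier[OF i(5)]] i by simp
    then show ?case using QK_mon_mult[OF m i(5)] by simp
  qed
next
  fix x assume "x \<in> QK_class n ` QK_mon n"
  then obtain t where t: "x = QK_class n t" "t \<in> QK_mon n" by auto
  from t(2) have "QK_class n t \<in> QK_denoms n"
  proof (induction t rule: QK_mon_induct)
    case one
    then show ?case
      using QK_class_hom(3)[OF QK_poly_1 QK_poly_1] submonoid_gen.one by (simp add: QK_denoms_def)
  next
    case (step i s)
    have "QK_class n (QK_Q n i) \<in> {QK_class n (QK_Q n i) | i. 1 \<le> i \<and> i \<le> n - 1}"
      by (rule CollectI, rule exI[of _ i]) (use step in auto)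
    from submonoid_gen.step[OF this step(4)[unfolded QK_denoms_def]]
    show ?case
      using QK_class_hom(2)[OF QK_mon_carrier[OF QK_mon_Q[OF step(1,2)]] QK_mon_carrier[OF step(3)]]
      by (simp add: QK_denoms_def)
  qed
  then show "x \<in> QK_denoms n" by (simp add: t)
qed

theorem theorem1p5:
  fixes n :: nat
  assumes "2 \<le> n"
  shows "\<exists>\<Phi> \<in> ring_iso (QK_loc n) (K_loc n).
    (\<forall>c. \<Phi> (QK_elem n (Const c)) = K_frac n (Const c) 1) \<and>
    (\<forall>i\<in>{1..n}. \<Phi> (QK_elem n (QK_z i)) =
        K_frac n (tau n i * sigma n (i - 1)) (sigma n i * tau n (i - 1))) \<and>
    (\<forall>i\<in>{1..n - 1}. \<Phi> (QK_elem n (QK_Q n i)) =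
        K_frac n (tau n (i - 1) * tau n (i + 1)) ((tau n i)\<^sup>2))"
proof -
  interpret e: comm_ring_hom "toda_emb n" by (rule toda_emb_hom)
  \<comment> \<open>The map that the quotient ring inherits; the representative does not matter since the ideal is in the kernel.\<close>
  define g where "g C = toda_emb n (SOME p. p \<in> carrier (QK_poly n) \<and> QK_class n p = C)" for C
  have g: "g (QK_class n p) = toda_emb n p" if p: "p \<in> carrier (QK_poly n)" for p
  proof -
    let ?P = "\<lambda>q. q \<in> carrier (QK_poly n) \<and> QK_class n q = QK_class n p"
    have "?P (SOME q. ?P q)" by (rule someI[of ?P p]) (use p in simp)
    then have "(SOME q. ?P q) - p \<in> QK_ideal n" using QK_class_eq_iff p by blast
    from toda_emb_QK_ideal[OF assms this] show ?thesis by (simp add: g_def e.hom_minus)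
  qed
  have ker: "\<exists>u\<in>QK_denoms n. u \<otimes>\<^bsub>QK n\<^esub> C = \<zero>\<^bsub>QK n\<^esub>" if "C \<in> carrier (QK n)" "g C = 0" for C
  proof -
    obtain p where p: "p \<in> carrier (QK_poly n)" "C = QK_class n p" using QK_carrier_cases[OF \<open>C \<in> carrier (QK n)\<close>] .
    then have "p \<in> loc_ideal n" using that g toda_emb_kernel[OF assms] by simp
    from loc_ideal_carrier[OF this p(1)] obtain s where s: "s \<in> QK_mon n" "s * p \<in> QK_ideal n" .
    have "QK_class n s \<otimes>\<^bsub>QK n\<^esub> C = QK_class n (s * p)"
      using QK_class_hom(2)[OF QK_mon_carrier[OF s(1)] p(1)] p(2) by simp
    also have "\<dots> = QK_class n 0"
      using s p by (subst QK_class_eq_iff) (auto intro: QK_poly_mult QK_mon_carrier QK_poly_0)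
    also have "\<dots> = \<zero>\<^bsub>QK n\<^esub>" by (rule QK_class_hom(4)[OF QK_poly_0 QK_poly_0])
    finally show ?thesis using s(1) by (auto simp: QK_denoms_eq)
  qed
  have g_one: "g \<one>\<^bsub>QK n\<^esub> = 1"
    using g[OF QK_poly_1] QK_class_hom(3)[OF QK_poly_1 QK_poly_1, of n] by simp
  obtain \<rho> where \<rho>: "\<And>a s. a \<in> carrier (QK n) \<Longrightarrow> s \<in> QK_denoms n \<Longrightarrow> \<rho> (loc_frac (QK n) (QK_denoms n) a s) = g a / g s"
    and inj_\<rho>: "inj_on \<rho> (carrier (QK_loc n))"
    and \<rho>_add: "\<And>X Y. X \<in> carrier (QK_loc n) \<Longrightarrow> Y \<in> carrier (QK_loc n) \<Longrightarrow> \<rho> (X \<oplus>\<^bsub>QK_loc n\<^esub> Y) = \<rho> X + \<rho> Y"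
    and \<rho>_mult: "\<And>X Y. X \<in> carrier (QK_loc n) \<Longrightarrow> Y \<in> carrier (QK_loc n) \<Longrightarrow> \<rho> (X \<otimes>\<^bsub>QK_loc n\<^esub> Y) = \<rho> X * \<rho> Y"
    and \<rho>_one: "\<rho> \<one>\<^bsub>QK_loc n\<^esub> = 1"
    unfolding QK_loc_def
  proof (rule localization_embeds_in_field[OF mult_subset_QK[of n], where g = g])
    fix a b assume "a \<in> carrier (QK n)" "b \<in> carrier (QK n)"
    then obtain p q where pq: "p \<in> carrier (QK_poly n)" "q \<in> carrier (QK_poly n)" "a = QK_class n p" "b = QK_class n q"
      by (metis QK_carrier_cases)
    show "g (a \<oplus>\<^bsub>QK n\<^esub> b) = g a + g b" "g (a \<otimes>\<^bsub>QK n\<^esub> b) = g a * g b"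
      using pq by (simp_all add: g QK_poly_add QK_poly_mult e.hom_add e.hom_mult flip: QK_class_hom)
  next
    show "g s \<noteq> 0" if "s \<in> QK_denoms n" for s
      using that by (auto simp: QK_denoms_eq g QK_mon_carrier toda_emb_mon_nonzero)
  qed (use g_one ker in auto)
  obtain \<iota> where \<iota>: "\<And>u D. u \<in> carrier (Lambda_n n) \<Longrightarrow> D \<in> K_denoms n \<Longrightarrow> \<iota> (K_frac n u D) = to_fract u / to_fract D"
    and inj_\<iota>: "inj_on \<iota> (carrier (K_loc n))"
    and \<iota>_add: "\<And>X Y. X \<in> carrier (K_loc n) \<Longrightarrow> Y \<in> carrier (K_loc n) \<Longrightarrow> \<iota> (X \<oplus>\<^bsub>K_loc n\<^esub> Y) = \<iota> X + \<iota> Y"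
    and \<iota>_mult: "\<And>X Y. X \<in> carrier (K_loc n) \<Longrightarrow> Y \<in> carrier (K_loc n) \<Longrightarrow> \<iota> (X \<otimes>\<^bsub>K_loc n\<^esub> Y) = \<iota> X * \<iota> Y"
    and \<iota>_one: "\<iota> \<one>\<^bsub>K_loc n\<^esub> = 1"
    unfolding K_loc_def K_frac_def
  proof (rule localization_embeds_in_field[OF mult_subset_K[of n], where g = to_fract])
    show "to_fract s \<noteq> 0" if "s \<in> K_denoms n" for s using K_denoms_nonzero[OF that] by simp
    show "\<exists>u\<in>K_denoms n. u \<otimes>\<^bsub>Lambda_n n\<^esub> a = \<zero>\<^bsub>Lambda_n n\<^esub>" if "to_fract a = 0" for a
      using that K_denoms_1[of n] by (auto simp: Lambda_n_def)
  qed (auto simp: Lambda_n_def)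
  have QK_loc_cases: "\<exists>p\<in>carrier (QK_poly n). \<exists>s\<in>QK_mon n. \<rho> X = toda_emb n p / toda_emb n s"
    if X: "X \<in> carrier (QK_loc n)" for X
  proof -
    obtain a t where "a \<in> carrier (QK n)" "t \<in> QK_denoms n" "X = loc_frac (QK n) (QK_denoms n) a t"
      using mult_subset.loc_frac_cases[OF mult_subset_QK X[unfolded QK_loc_def]] .
    moreover obtain p where "p \<in> carrier (QK_poly n)" "a = QK_class n p"
      using QK_carrier_cases[OF calculation(1)] .
    moreover obtain s where "s \<in> QK_mon n" "t = QK_class n s" using calculation(2) by (auto simp: QK_denoms_eq)
    ultimately show ?thesis using \<rho>[of a t] g[of p] g[of s] QK_mon_carrier[of s n] by auto
  qed
  have K_frac_mem: "K_frac n u D \<in> carrier (K_loc n)" if "u \<in> carrier (Lambda_n n)" "D \<in> K_denoms n" for u D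
    unfolding K_frac_def K_loc_def by (rule mult_subset.loc_frac_closed[OF mult_subset_K that])
  have im: "\<rho> ` carrier (QK_loc n) = \<iota> ` carrier (K_loc n)"
  proof (intro equalityI subsetI)
    fix f assume "f \<in> \<rho> ` carrier (QK_loc n)"
    then obtain p s where ps: "p \<in> carrier (QK_poly n)" "s \<in> QK_mon n" "f = toda_emb n p / toda_emb n s"
      using QK_loc_cases by blast
    have "\<exists>y. toda_emb n s * toda_emb n y = 1"
      using ps(2)
    proof (induction s rule: QK_mon_induct)
      case one
      show ?case by (rule exI[of _ 1]) simp
    next
      case (step i s)
      then obtain y where y: "toda_emb n s * toda_emb n y = 1" by blast
      have v: "toda_emb n (QK_Q n i) * toda_emb n (Var (QV (n + i))) = 1"
        using toda_emb_loc_ideal[OF assms QK_mon_inverse_exists[OF step(1,2)]]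
        by (simp add: e.hom_minus e.hom_mult)
      have "toda_emb n (QK_Q n i * s) * toda_emb n (Var (QV (n + i)) * y) =
          (toda_emb n (QK_Q n i) * toda_emb n (Var (QV (n + i)))) * (toda_emb n s * toda_emb n y)"
        by (simp only: e.hom_mult mult_ac)
      then show ?case unfolding v y by auto
    qed
    then obtain y where y: "toda_emb n s * toda_emb n y = 1" by blast
    have "toda_emb n y = inverse (toda_emb n s)" using inverse_unique[OF y] by simp
    then have "f = toda_emb n (p * y)" by (simp only: ps(3) e.hom_mult divide_inverse)
    then obtain u D where "u \<in> carrier (Lambda_n n)" "D \<in> K_denoms n" "f = to_fract u / to_fract D"
      using toda_emb_image[OF assms, of "p * y"] by auto
    then show "f \<in> \<iota> ` carrier (K_loc n)" using \<iota> K_frac_mem by (metis imageI)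
  next
    fix f assume "f \<in> \<iota> ` carrier (K_loc n)"
    then obtain Y where Y: "Y \<in> carrier (K_loc n)" "f = \<iota> Y" by auto
    obtain u D where uD: "u \<in> carrier (Lambda_n n)" "D \<in> K_denoms n" "Y = K_frac n u D"
      using mult_subset.loc_frac_cases[OF mult_subset_K Y(1)[unfolded K_loc_def]] unfolding K_frac_def .
    then obtain y where y: "toda_emb n y = f" using toda_emb_onto[OF assms uD(1,2)] \<iota> Y by auto
    obtain b s where bs: "b \<in> carrier (QK_poly n)" "s \<in> QK_mon n" "toda_emb n y * toda_emb n s = toda_emb n b"
      by (rule toda_emb_common_denominator[of n y])
    have "f = toda_emb n b / toda_emb n s"
      using bs y toda_emb_mon_nonzero[OF bs(2)] by (simp add: field_simps)
    also have "\<dots> = \<rho> (loc_frac (QK n) (QK_denoms n) (QK_class n b) (QK_class n s))"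
      using bs by (subst \<rho>) (auto simp: g QK_mon_carrier QK_class_closed QK_denoms_eq)
    also have "\<dots> \<in> \<rho> ` carrier (QK_loc n)"
      unfolding QK_loc_def
      by (intro imageI mult_subset.loc_frac_closed[OF mult_subset_QK])
         (use bs in \<open>auto simp: QK_class_closed QK_denoms_eq\<close>)
    finally show "f \<in> \<rho> ` carrier (QK_loc n)" .
  qed
  let ?\<Phi> = "\<lambda>X. inv_into (carrier (K_loc n)) \<iota> (\<rho> X)"
  have iso: "?\<Phi> \<in> ring_iso (QK_loc n) (K_loc n)"
    by (rule ring_iso_through_field[OF _ _ inj_\<rho> inj_\<iota> im \<rho>_add \<rho>_mult \<rho>_one \<iota>_add \<iota>_mult \<iota>_one])
       (simp_all add: cring.axioms(1) cring_QK_loc cring_K_loc)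
  have image: "?\<Phi> (QK_elem n p) = K_frac n u D"
    if "p \<in> carrier (QK_poly n)" "u \<in> carrier (Lambda_n n)" "D \<in> K_denoms n" "toda_emb n p = to_fract u / to_fract D"
    for p u D
  proof -
    have "\<one>\<^bsub>QK n\<^esub> \<in> QK_denoms n" by (rule mult_subset.S_one[OF mult_subset_QK])
    then have "\<rho> (QK_elem n p) = \<iota> (K_frac n u D)"
      unfolding QK_elem_def using that by (simp add: \<rho> \<iota> g g_one QK_class_closed)
    then show ?thesis using inj_\<iota> K_frac_mem[OF that(2,3)] by (simp add: inv_into_f_f)
  qed
  have on_Const: "?\<Phi> (QK_elem n (Const c)) = K_frac n (Const c) 1" for c
    by (rule image) (simp_all add: QK_poly_Const Lambda_n_Const K_denoms_1 toda_emb_def with_inverses_Const frac_const_def)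
  have on_z: "?\<Phi> (QK_elem n (QK_z i)) = K_frac n (tau n i * sigma n (i - 1)) (sigma n i * tau n (i - 1))"
    if i: "i \<in> {1..n}" for i
  proof (rule image)
    show "QK_z i \<in> carrier (QK_poly n)" using i by (auto intro: QK_generators_closed)
    show "tau n i * sigma n (i - 1) \<in> carrier (Lambda_n n)" "sigma n i * tau n (i - 1) \<in> K_denoms n"
      using i by (auto intro!: K_denoms_carrier K_denoms_mult tau_in_K_denoms sigma_in_K_denoms)
    show "toda_emb n (QK_z i) = to_fract (tau n i * sigma n (i - 1)) / to_fract (sigma n i * tau n (i - 1))"
      using i by (simp add: toda_emb_z toda_z_def)
  qed
  have on_Q: "?\<Phi> (QK_elem n (QK_Q n i)) = K_frac n (tau n (i - 1) * tau n (i + 1)) ((tau n i)\<^sup>2)"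
    if i: "i \<in> {1..n - 1}" for i
  proof (rule image)
    show "QK_Q n i \<in> carrier (QK_poly n)" using i by (auto intro: QK_generators_closed)
    show "tau n (i - 1) * tau n (i + 1) \<in> carrier (Lambda_n n)"
      using i by (auto intro!: K_denoms_carrier K_denoms_mult tau_in_K_denoms)
    show "(tau n i)\<^sup>2 \<in> K_denoms n"
      using i by (auto simp: power2_eq_square intro!: K_denoms_mult tau_in_K_denoms)
    show "toda_emb n (QK_Q n i) = to_fract (tau n (i - 1) * tau n (i + 1)) / to_fract ((tau n i)\<^sup>2)"
      using i by (auto simp: toda_emb_Q toda_Q_def power2_eq_square)
  qed
  show ?thesis
    by (rule bexI[OF _ iso], intro conjI allI ballI on_Const on_z on_Q)
qed

end
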